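(* Let $\Omega\subset\mathbb{R}^{2}$ be a domain contained in a ball of radius $R$ and star-shaped with respect to a concentric ball of radius $\rho$. Then $$\beta(\Omega)\ \ge\ \frac{\rho}{\sqrt{2}\,R}\,\bigg(1+\sqrt{1-\frac{\rho^{2}}{R^{2}}}\,\bigg)^{-\frac12}\ \ge\ \frac{\rho}{2R}.$$
   Context: A domain is a nonempty connected open set. $\Omega$ is star-shaped with respect to an open ball $B\subset\Omega$ if every segment with one end in $B$ and the other in $\Omega$ is contained in $\Omega$. $L^2_\circ(\Omega)$ is the space of $q\in L^2(\Omega)$ with mean value zero, $\|\cdot\|_{0,\Omega}$ the $L^2(\Omega)$ norm, $\langle\cdot,\cdot\rangle_\Omega$ the $L^2(\Omega)$ scalar product, $H^1_0(\Omega)$ the closure of $C_0^\infty(\Omega)$ in $H^1(\Omega)$, and $|\mathbf{v}|_{1,\Omega}=\big(\sum_{k,j}\|\partial_{x_j}v_k\|_{0,\Omega}^2\big)^{1/2}$ for $\mathbf{v}\in H^1_0(\Omega)^2$. The inf-sup constant of $\Omega$ is $$\beta(\Omega)=\inf_{q\in L^2_\circ(\Omega)\setminus\{0\}}\ \sup_{\mathbf{v}\in H^1_0(\Omega)^2\setminus\{0\}}\ \frac{\langle\operatorname{div}\mathbf{v},q\rangle_\Omega}{|\mathbf{v}|_{1,\Omega}\,\|q\|_{0,\Omega}} .$$ *)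

theory Defs
  imports "HOL-Analysis.Analysis"
begin

text \<open>
  Spaces of functions on \<open>\<Omega>\<close> are sets of real-valued functions on the whole of \<open>real^'n\<close>, of
  which only the values on \<open>\<Omega>\<close> matter, and equality in them is equality almost everywhere.
\<close>

definition L2 :: "(real^'n) set \<Rightarrow> (real^'n \<Rightarrow> real) set" where
  "L2 \<Omega> = {f. f \<in> borel_measurable (lebesgue_on \<Omega>) \<and>
               integrable (lebesgue_on \<Omega>) (\<lambda>x. (f x)\<^sup>2)}"

definition L2_inner :: "(real^'n) set \<Rightarrow> (real^'n \<Rightarrow> real) \<Rightarrow> (real^'n \<Rightarrow> real) \<Rightarrow> real" where
  "L2_inner \<Omega> f g = (LINT x|lebesgue_on \<Omega>. f x * g x)"

definition L2_norm :: "(real^'n) set \<Rightarrow> (real^'n \<Rightarrow> real) \<Rightarrow> real" where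
  "L2_norm \<Omega> f = sqrt (L2_inner \<Omega> f f)"

text \<open>
  Mean value zero; integrability is automatic when \<open>\<Omega>\<close> has finite measure, and is stated so that
  the condition on the integral is meaningful for every \<open>\<Omega>\<close>.
\<close>

definition L2_mean_zero :: "(real^'n) set \<Rightarrow> (real^'n \<Rightarrow> real) set" where
  "L2_mean_zero \<Omega> = {q \<in> L2 \<Omega>. integrable (lebesgue_on \<Omega>) q \<and>
                                 (LINT x|lebesgue_on \<Omega>. q x) = 0}"

definition partial_deriv :: "'n::finite \<Rightarrow> (real^'n \<Rightarrow> real) \<Rightarrow> real^'n \<Rightarrow> real" where
  "partial_deriv j f x = frechet_derivative f (at x) (axis j 1)"

primrec C_k :: "nat \<Rightarrow> (real^'n \<Rightarrow> real) \<Rightarrow> bool" where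
  "C_k 0 f \<longleftrightarrow> continuous_on UNIV f"
| "C_k (Suc k) f \<longleftrightarrow> f differentiable_on UNIV \<and> (\<forall>j. C_k k (partial_deriv j f))"

definition test_functions :: "(real^'n) set \<Rightarrow> (real^'n \<Rightarrow> real) set" where
  "test_functions \<Omega> = {\<phi>. (\<forall>k. C_k k \<phi>) \<and>
     compact (closure {x. \<phi> x \<noteq> 0}) \<and> closure {x. \<phi> x \<noteq> 0} \<subseteq> \<Omega>}"

definition has_weak_deriv ::
  "(real^'n) set \<Rightarrow> 'n::finite \<Rightarrow> (real^'n \<Rightarrow> real) \<Rightarrow> (real^'n \<Rightarrow> real) \<Rightarrow> bool" where
  "has_weak_deriv \<Omega> j f g \<longleftrightarrow> f \<in> L2 \<Omega> \<and> g \<in> L2 \<Omega> \<and>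
     (\<forall>\<phi>\<in>test_functions \<Omega>. L2_inner \<Omega> f (partial_deriv j \<phi>) = - L2_inner \<Omega> g \<phi>)"

text \<open>The choice below is immaterial: weak derivatives are unique almost everywhere on open sets.\<close>

definition weak_deriv :: "(real^'n) set \<Rightarrow> 'n::finite \<Rightarrow> (real^'n \<Rightarrow> real) \<Rightarrow> real^'n \<Rightarrow> real" where
  "weak_deriv \<Omega> j f = (SOME g. has_weak_deriv \<Omega> j f g)"

definition H1 :: "(real^'n) set \<Rightarrow> (real^'n \<Rightarrow> real) set" where
  "H1 \<Omega> = {f \<in> L2 \<Omega>. \<forall>j. \<exists>g. has_weak_deriv \<Omega> j f g}"

definition H1_norm :: "(real^'n) set \<Rightarrow> (real^'n \<Rightarrow> real) \<Rightarrow> real" where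
  "H1_norm \<Omega> f = sqrt ((L2_norm \<Omega> f)\<^sup>2 + (\<Sum>j\<in>UNIV. (L2_norm \<Omega> (weak_deriv \<Omega> j f))\<^sup>2))"

definition H1_0 :: "(real^'n) set \<Rightarrow> (real^'n \<Rightarrow> real) set" where
  "H1_0 \<Omega> = {f \<in> H1 \<Omega>. \<forall>\<epsilon>>0. \<exists>\<phi>\<in>test_functions \<Omega>. H1_norm \<Omega> (\<lambda>x. f x - \<phi> x) < \<epsilon>}"

definition H1_0_vec :: "(real^'n) set \<Rightarrow> (real^'n \<Rightarrow> real^'n) set" where
  "H1_0_vec \<Omega> = {v. \<forall>k. (\<lambda>x. v x $ k) \<in> H1_0 \<Omega>}"

definition weak_div :: "(real^'n) set \<Rightarrow> (real^'n \<Rightarrow> real^'n) \<Rightarrow> real^'n \<Rightarrow> real" where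
  "weak_div \<Omega> v x = (\<Sum>j\<in>UNIV. weak_deriv \<Omega> j (\<lambda>y. v y $ j) x)"

definition H1_seminorm_vec :: "(real^'n) set \<Rightarrow> (real^'n \<Rightarrow> real^'n) \<Rightarrow> real" where
  "H1_seminorm_vec \<Omega> v =
     sqrt (\<Sum>k\<in>UNIV. \<Sum>j\<in>UNIV. (L2_norm \<Omega> (weak_deriv \<Omega> j (\<lambda>x. v x $ k)))\<^sup>2)"

text \<open>
  Extended reals make infimum and supremum unconditionally meaningful. Being nonzero as an element
  of a function space means not vanishing almost everywhere on \<open>\<Omega>\<close>.
\<close>

definition inf_sup_constant :: "(real^'n) set \<Rightarrow> ereal" where
  "inf_sup_constant \<Omega> =
     (INF q\<in>{q \<in> L2_mean_zero \<Omega>. \<not> (AE x in lebesgue_on \<Omega>. q x = 0)}.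
      SUP v\<in>{v \<in> H1_0_vec \<Omega>. \<not> (AE x in lebesgue_on \<Omega>. v x = 0)}.
        ereal (L2_inner \<Omega> (weak_div \<Omega> v) q / (H1_seminorm_vec \<Omega> v * L2_norm \<Omega> q)))"

definition star_shaped_wrt_ball :: "(real^'n) set \<Rightarrow> real^'n \<Rightarrow> real \<Rightarrow> bool" where
  "star_shaped_wrt_ball \<Omega> c \<rho> \<longleftrightarrow> ball c \<rho> \<subseteq> \<Omega> \<and>
     (\<forall>a\<in>ball c \<rho>. \<forall>x\<in>\<Omega>. closed_segment a x \<subseteq> \<Omega>)"

end

theory Submission
  imports Defs "HOL-Complex_Analysis.Cauchy_Integral_Formula"
begin

text \<open>
  Put $k=\sqrt{1-\rho^2/R^2}$ and $\Gamma=(1+k)/(1-k)$, so that the asserted bound is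
  $(\Gamma+1)^{-1/2}$. Let $G$ be the $L^2$ projection of $pI$ on the closure of the gradients of test
  fields; the supremum for $p$ is at least $\|G\|/\|p\|$. With $q={\rm tr}\,G$ and $r$ the
  antisymmetric part of $G$, integration by parts gives $\|G\|^2=\|q\|^2+\|r\|^2=\langle p,q\rangle$,
  and $h=q-p$ and $r$ satisfy the Cauchy--Riemann equations weakly. Friedrichs' inequality
  $\|h\|^2\le\Gamma\|r\|^2$ then yields $\|p\|^2\le(\Gamma+1)\|G\|^2$.

  For Friedrichs' inequality let $N$ be the Minkowski functional of $\Omega$, which is $1/\rho$-Lipschitz
  because of the star shape, and $F=h+ir$ holomorphic near the closure of $\Omega$ with $h(0)=0$
  (reached by mollification and dilation). The function
  $J(\mu)=\int (F^2(z)-F^2(0))\,(1-N(\mu z)^2)_+\,|z|^{-2}\,dz$ is complex differentiable at $\mu=1$;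
  comparing its derivatives in the directions $1$ (dilations) and $i$ (rotations) gives, with
  $M=N(z)/|z|\in[1/R,1/\rho]$,
  $\int_\Omega M^2(h^2-r^2)\le\int_\Omega 2M\sqrt{\rho^{-2}-M^2}\,|hr|$,
  and a pointwise estimate of quadratic forms finishes the proof. Only difference quotients of $N$
  occur, so no regularity of the boundary is used.
\<close>

subsection \<open>The plane and the complex numbers\<close>

text \<open>Why \<Gamma> + 1: let P, Q, S, H be the squared norms of p, q, r and h. The energy
  identity gives H = P - Q - 2S and <h,q> = -S, so H \<le> \<Gamma>S used once yields only P \<le> Q
  + (\<Gamma> + 2)S. Cauchy-Schwarz adds S^2 \<le> HQ \<le> \<Gamma>SQ, hence S \<le> \<Gamma>Q;
  applying this to one copy of S gives P \<le> (\<Gamma> + 1)(Q + S).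

  Where sqrt (\<rho>^(-2) - M^2) comes from: were N differentiable, its gradient would have length
  at most 1/\<rho> and radial component M, and this root bounds what is left for the angular
  component. A Lipschitz N need not have an angular derivative at a given point, so the direction
  \<i> provides only an asymptotic bound. That suffices, because in the direction 1 homogeneity
  gives the exact limit, and holomorphy ties both limits to one complex number.

  The square F^2 is taken because it is again holomorphic and its real part is h^2 - r^2, while its
  imaginary part 2hr is exactly what the angular bound can absorb.\<close>

definition plane_of :: "complex \<Rightarrow> real^2" where
  "plane_of z = vector [Re z, Im z]"

definition complex_of :: "real^2 \<Rightarrow> complex" where
  "complex_of x = Complex (x $ 1) (x $ 2)"

lemma plane_of_nth [simp]: "plane_of z $ 1 = Re z" "plane_of z $ 2 = Im z"
  by (simp_all add: plane_of_def)

lemma complex_of_sel [simp]: "Re (complex_of x) = x $ 1" "Im (complex_of x) = x $ 2"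
  by (simp_all add: complex_of_def)

lemma complex_of_plane_of [simp]: "complex_of (plane_of z) = z"
  by (simp add: complex_eq_iff)

lemma plane_of_complex_of [simp]: "plane_of (complex_of x) = x"
  by (simp add: vec_eq_iff forall_2)

lemma linear_complex_of: "linear complex_of"
  by (rule linearI) (simp_all add: complex_eq_iff)

lemma linear_plane_of: "linear plane_of"
  by (rule linearI) (simp_all add: vec_eq_iff forall_2)

lemma continuous_on_complex_of [continuous_intros]:
  "continuous_on S f \<Longrightarrow> continuous_on S (\<lambda>x. complex_of (f x))"
  by (rule bounded_linear.continuous_on[OF linear_complex_of[unfolded linear_conv_bounded_linear]])

lemma continuous_on_plane_of [continuous_intros]:
  "continuous_on S f \<Longrightarrow> continuous_on S (\<lambda>x. plane_of (f x))"
  by (rule bounded_linear.continuous_on[OF linear_plane_of[unfolded linear_conv_bounded_linear]])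

lemma measurable_complex_of [measurable]: "complex_of \<in> borel_measurable borel"
  by (intro borel_measurable_continuous_onI continuous_intros)

lemma measurable_plane_of [measurable]: "plane_of \<in> borel_measurable borel"
  by (intro borel_measurable_continuous_onI continuous_intros)

lemma norm_complex_of [simp]: "norm (complex_of x) = norm x"
  by (simp add: cmod_def norm_vec_def L2_set_def sum_2)

lemma box_complex_of: "complex_of -` box l u = box (plane_of l) (plane_of u)"
  by (auto simp: box_def Basis_complex_def Basis_vec_def inner_axis axis_def inner_vec_def sum_2 UNIV_2 inner_complex_def)

text \<open>Boxes with equal sides correspond under the coordinate map, and Lebesgue measure is
  determined by its values on boxes. The holomorphic half of the proof can thus live on the complex
  type and the weak half on \<open>real^2\<close>.\<close>

lemma lborel_distr_complex_of: "distr lborel borel complex_of = lborel"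
proof (rule lborel_eqI[symmetric])
  fix l u :: complex
  assume le: "\<And>b. b \<in> Basis \<Longrightarrow> l \<bullet> b \<le> u \<bullet> b"
  have "Re l \<le> Re u" "Im l \<le> Im u"
    using le[of 1] le[of \<i>] by (auto simp: Basis_complex_def inner_complex_def)
  then have "\<And>b. b \<in> Basis \<Longrightarrow> plane_of l \<bullet> b \<le> plane_of u \<bullet> b"
    by (auto simp: Basis_vec_def UNIV_2 inner_axis)
  then have "emeasure lborel (box (plane_of l) (plane_of u)) = (\<Prod>b\<in>Basis. (plane_of u - plane_of l) \<bullet> b)"
    by simp
  also have "(\<Prod>b\<in>Basis. (plane_of u - plane_of l) \<bullet> b) = (\<Prod>b\<in>Basis. (u - l) \<bullet> b)"
  proof -
    have "axis 1 1 \<noteq> (axis 2 1 :: real^2)" by (simp add: axis_eq_axis)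
    then show ?thesis
      by (simp add: Basis_vec_def UNIV_2 Basis_complex_def inner_axis)
  qed
  finally show "emeasure (distr lborel borel complex_of) (box l u) = (\<Prod>b\<in>Basis. (u - l) \<bullet> b)"
    by (simp add: emeasure_distr box_complex_of)
qed simp

text \<open>The Jacobian of multiplication by \<open>c\<close>, obtained from the determinant of
  division by \<open>c\<close> in real coordinates.\<close>

lemma lborel_complex_mult:
  fixes c :: complex
  assumes "c \<noteq> 0"
  shows "lborel = density (distr lborel borel ((*) c)) (\<lambda>_. (norm c)\<^sup>2)"
proof (rule lborel_eqI)
  fix l u :: complex
  assume le: "\<And>b. b \<in> Basis \<Longrightarrow> l \<bullet> b \<le> u \<bullet> b"
  \<comment> \<open>\<open>L\<close> is division by \<open>c\<close>, not multiplication: the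
    push-forward measures the preimage of a box, which is the image of the box under the inverse
    map.\<close>
  define L where "L x = plane_of (complex_of x / c)" for x
  have sc: "(r *\<^sub>R w) / c = r *\<^sub>R (w / c)" for r w
    by (simp add: scaleR_conv_of_real)
  have "linear L" unfolding L_def
    by (rule linearI) (simp_all add: linear_add[OF linear_complex_of] linear_add[OF linear_plane_of]
        linear_scale[OF linear_complex_of] linear_scale[OF linear_plane_of] add_divide_distrib sc)
  have ax: "complex_of (axis 1 1) = 1" "complex_of (axis 2 1) = \<i>"
    by (simp_all add: complex_eq_iff axis_def)
  have ax': "axis 1 1 $ (2::2) = (0::real)" "axis 2 1 $ (1::2) = (0::real)"
    by (simp_all add: axis_def)
  have "det (matrix L) = (Re (1/c))\<^sup>2 + (Im (1/c))\<^sup>2"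
    unfolding det_2 matrix_def L_def by (simp add: ax ax' power2_eq_square Re_divide Im_divide)
  also have "\<dots> = 1 / (norm c)\<^sup>2"
    by (simp only: cmod_power2[symmetric] norm_divide power_divide) simp
  finally have det: "\<bar>det (matrix L)\<bar> = 1 / (norm c)\<^sup>2" by simp
  let ?B = "box (plane_of l) (plane_of u)"
  have eq: "complex_of -` ((*) c -` box l u) = L ` ?B"
  proof -
    have "x \<in> L ` ?B \<longleftrightarrow> c * complex_of x \<in> box l u" for x
    proof
      assume "c * complex_of x \<in> box l u"
      then have "plane_of (c * complex_of x) \<in> ?B"
        using box_complex_of by (metis complex_of_plane_of vimage_eq)
      moreover have "x = L (plane_of (c * complex_of x))" using assms by (simp add: L_def)
      ultimately show "x \<in> L ` ?B" by blast
    next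
      assume "x \<in> L ` ?B"
      then obtain y where y: "y \<in> ?B" "x = L y" by blast
      then show "c * complex_of x \<in> box l u"
        using assms box_complex_of[of l u] by (auto simp: L_def)
    qed
    then show ?thesis by auto
  qed
  have m: "?B \<in> lmeasurable" by simp
  have mm: "measure lebesgue (L ` ?B) = \<bar>det (matrix L)\<bar> * measure lebesgue ?B"
    by (rule measure_linear_image[OF \<open>linear L\<close> m])
  have ml: "L ` ?B \<in> lmeasurable"
    by (rule measurable_linear_image[OF \<open>linear L\<close> m])
  have bor: "L ` ?B \<in> sets borel"
    unfolding eq[symmetric]
    by (intro borel_open open_vimage continuous_intros open_box continuous_on_id)
  have borc: "(*) c -` box l u \<in> sets borel"
    by (intro borel_open open_vimage continuous_intros open_box continuous_on_id)
  have "emeasure (distr lborel borel ((*) c)) (box l u) = emeasure lborel ((*) c -` box l u)"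
    by (simp add: emeasure_distr)
  also have "\<dots> = emeasure (distr lborel borel complex_of) ((*) c -` box l u)"
    by (simp add: lborel_distr_complex_of)
  also have "\<dots> = emeasure lborel (L ` ?B)"
    using borc by (subst emeasure_distr) (auto simp: eq)
  also have "\<dots> = emeasure lebesgue (L ` ?B)" using bor by simp
  also have "\<dots> = ennreal (measure lebesgue (L ` ?B))"
    by (rule emeasure_eq_measure2[OF ml])
  also have "\<dots> = ennreal (1 / (norm c)\<^sup>2 * measure lborel ?B)" by (simp add: mm det)
  finally have 1: "emeasure (distr lborel borel ((*) c)) (box l u) = ennreal (1 / (norm c)\<^sup>2 * measure lborel ?B)" .
  have 2: "emeasure lborel ?B = (\<Prod>b\<in>Basis. (u - l) \<bullet> b)"
  proof -
    have "emeasure lborel ?B = emeasure (distr lborel borel complex_of) (box l u)"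
      by (subst emeasure_distr) (auto simp: box_complex_of)
    then show ?thesis using le by (simp add: lborel_distr_complex_of)
  qed
  have "emeasure (density (distr lborel borel ((*) c)) (\<lambda>_. (norm c)\<^sup>2)) (box l u)
      = ennreal ((norm c)\<^sup>2) * emeasure (distr lborel borel ((*) c)) (box l u)"
    by (subst emeasure_density) (auto simp: nn_integral_cmult_indicator)
  also have "\<dots> = ennreal (measure lborel ?B)"
    unfolding 1 using assms by (simp add: ennreal_mult'[symmetric])
  also have "\<dots> = (\<Prod>b\<in>Basis. (u - l) \<bullet> b)"
    unfolding 2[symmetric] by (subst emeasure_eq_ennreal_measure) (auto simp: 2)
  finally show "emeasure (density (distr lborel borel ((*) c)) (\<lambda>_. (norm c)\<^sup>2)) (box l u) = (\<Prod>b\<in>Basis. (u - l) \<bullet> b)"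
    by simp
qed simp

lemma lborel_integral_complex_mult:
  fixes f :: "complex \<Rightarrow> 'a::{banach,second_countable_topology}"
  assumes "c \<noteq> 0" and [measurable]: "f \<in> borel_measurable borel"
  shows "(LINT z|lborel. f z) = (LINT z|lborel. (norm c)\<^sup>2 *\<^sub>R f (c * z))"
proof -
  have "(LINT z|lborel. f z) = (LINT z|density (distr lborel borel ((*) c)) (\<lambda>_. (norm c)\<^sup>2). f z)"
    using lborel_complex_mult[OF assms(1)] by simp
  also have "\<dots> = (LINT z|distr lborel borel ((*) c). (norm c)\<^sup>2 *\<^sub>R f z)"
    by (subst integral_density) auto
  also have "\<dots> = (LINT z|lborel. (norm c)\<^sup>2 *\<^sub>R f (c * z))"
    by (subst integral_distr) auto
  finally show ?thesis .
qed

subsection \<open>The Minkowski functional\<close>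

text \<open>Dyadic discs replace polar coordinates: for |z| between r/2^(k+1) and r/2^k the
  integrand is at most 2^(k+1)/r, while the disc has area proportional to r^2/4^k, so the series is
  geometric. This function dominates the kernel |z|^(-2) multiplied by a factor of order
  |z|.\<close>

lemma integrable_inverse_norm_complex:
  fixes r :: real
  shows "integrable lborel (\<lambda>z::complex. indicator (cball 0 r) z / norm z)"
proof (cases "r > 0")
  case False
  then have "(\<lambda>z::complex. indicator (cball 0 r) z / norm z) = (\<lambda>z. 0)"
    by (auto simp: fun_eq_iff indicator_def) (metis norm_le_zero_iff not_le order_le_less_trans norm_ge_zero order_antisym)
  then show ?thesis by simp
next
  case r: True
  have [measurable]: "cball (0::complex) s \<in> sets borel" for s by simp
  define v where "v = unit_ball_vol (real DIM(complex))"
  have v: "v \<ge> 0" by (simp add: v_def)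
  have "(\<integral>\<^sup>+z. ennreal (indicator (cball 0 r) z / norm (z::complex)) \<partial>lborel)
     \<le> (\<integral>\<^sup>+z. (\<Sum>k. ennreal (2^(k+1) / r) * indicator (cball (0::complex) (r / 2^k)) z) \<partial>lborel)"
  proof (rule nn_integral_mono)
    fix z :: complex
    show "ennreal (indicator (cball 0 r) z / norm z)
       \<le> (\<Sum>k. ennreal (2^(k+1) / r) * indicator (cball (0::complex) (r / 2^k)) z)"
    proof (cases "z \<noteq> 0 \<and> norm z \<le> r")
      case True
      have "\<exists>k. (1/2)^(k+1) < norm z / r"
      proof -
        obtain k where k: "(1/2)^k < norm z / r"
          using real_arch_pow_inv[of "norm z / r" "1/2"] True r by auto
        have "(1/2::real)^(k+1) \<le> (1/2)^k" by simp
        then show ?thesis using k by (intro exI[of _ k]) linarith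
      qed
      \<comment> \<open>The index of the dyadic shell that contains \<open>z\<close>: minimality
        gives the upper bound on the norm, the defining property the lower one.\<close>
      define k where "k = (LEAST k. (1/2)^(k+1) < norm z / r)"
      have k1: "(1/2)^(k+1) < norm z / r"
        unfolding k_def by (rule LeastI_ex) fact
      have k2: "norm z / r \<le> (1/2)^k"
      proof (cases k)
        case 0 then show ?thesis using True r by simp
      next
        case (Suc j)
        have "\<not> (1/2)^(j+1) < norm z / r"
          using not_less_Least[of j "\<lambda>k. (1/2)^(k+1) < norm z / r"] Suc k_def by simp
        then show ?thesis using Suc by simp
      qed
      have in_ball: "z \<in> cball 0 (r / 2^k)"
        using k2 r by (simp add: power_one_over divide_simps mult.commute)
      have "1 / norm z \<le> 2^(k+1) / r"
        using k1 r True by (simp add: power_one_over divide_simps mult.commute)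
      define f where "f k = ennreal (2^(k+1) / r) * indicator (cball (0::complex) (r / 2^k)) z" for k
      have "ennreal (indicator (cball 0 r) z / norm z) \<le> sum f {k}"
        using True in_ball \<open>1 / norm z \<le> _\<close> by (auto simp: f_def indicator_def intro!: ennreal_leI)
      also have "\<dots> \<le> (\<Sum>k. f k)"
        by (rule sum_le_suminf) auto
      finally show ?thesis by (simp add: f_def)
    qed (auto simp: indicator_def)
  qed
  also have "\<dots> = (\<Sum>k. \<integral>\<^sup>+z. ennreal (2^(k+1) / r) * indicator (cball (0::complex) (r / 2^k)) z \<partial>lborel)"
    by (subst nn_integral_suminf) auto
  also have "\<dots> = (\<Sum>k. ennreal (2^(k+1) / r) * ennreal (v * (r/2^k)^2))"
    using r by (subst nn_integral_cmult_indicator) (auto simp: emeasure_cball v_def)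
  also have "\<dots> = (\<Sum>k. ennreal ((2 * v * r) * (1/2)^k))"
    using r v by (intro suminf_cong, subst ennreal_mult[symmetric])
      (auto simp: power2_eq_square power_one_over field_simps intro!: mult_nonneg_nonneg)
  also have "\<dots> < \<infinity>"
  proof -
    have "summable (\<lambda>k. (2 * v * r) * (1/2::real)^k)"
      by (intro summable_mult summable_geometric) auto
    then show ?thesis
      using r v by (subst suminf_ennreal2) (auto intro!: mult_nonneg_nonneg)
  qed
  finally show ?thesis
    by (intro integrableI_bounded) (auto simp: norm_divide)
qed

text \<open>The axioms encode the geometry: \<open>N_add_le\<close> is star-shapedness with respect
  to the disc of radius \<rho>, \<open>N_lower\<close> is containment in the disc of radius R.
  Homogeneity concerns nonnegative factors, and \<open>N\<close> may fail to be symmetric or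
  subadditive, because the domain may fail to be symmetric or convex.\<close>

locale gauge_function =
  fixes N :: "complex \<Rightarrow> real" and \<rho> R :: real
  assumes homogeneous: "s \<ge> 0 \<Longrightarrow> N (of_real s * z) = s * N z"
    and N_add_le: "N (z + w) \<le> N z + norm w / \<rho>"
    and N_lower: "norm z / R \<le> N z"
    and rho_pos: "\<rho> > 0" and rho_le_R: "\<rho> \<le> R"
begin

lemma R_pos: "R > 0" using rho_pos rho_le_R by simp

lemma N_0 [simp]: "N 0 = 0" using homogeneous[of 0 0] by simp

lemma N_nonneg [simp]: "N z \<ge> 0"
  using N_lower[of z] R_pos by (meson divide_nonneg_pos norm_ge_zero order_trans)

lemma N_upper: "N z \<le> norm z / \<rho>"
  using N_add_le[of 0 z] by simp

lemma N_lipschitz: "\<bar>N z - N w\<bar> \<le> norm (z - w) / \<rho>"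
  using N_add_le[of w "z - w"] N_add_le[of z "w - z"] by (simp add: norm_minus_commute abs_le_iff)

lemma norm_le_N: "norm z \<le> R * N z"
  using N_lower[of z] R_pos by (simp add: field_simps)

lemma continuous_N: "continuous_on UNIV N"
proof (rule continuous_onI)
  fix x :: complex and e :: real
  assume "e > 0"
  show "\<exists>d>0. \<forall>x'\<in>UNIV. dist x' x < d \<longrightarrow> dist (N x') (N x) \<le> e"
  proof (intro exI conjI ballI impI)
    show "e * \<rho> > 0" using \<open>e > 0\<close> rho_pos by simp
    fix y assume "dist y x < e * \<rho>"
    then have "norm (y - x) / \<rho> < e" using rho_pos by (simp add: dist_norm pos_divide_less_eq)
    then show "dist (N y) (N x) \<le> e"
      using N_lipschitz[of y x] by (simp add: dist_real_def)
  qed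
qed

lemma N_measurable [measurable]: "N \<in> borel_measurable borel"
  by (rule borel_measurable_continuous_onI[OF continuous_N])

definition sublevel :: "real \<Rightarrow> complex set" where
  "sublevel t = {z. N z < t}"

lemma open_sublevel: "open (sublevel t)"
  unfolding sublevel_def by (intro open_Collect_less continuous_N continuous_on_const)

lemma sublevel_measurable [measurable]: "sublevel t \<in> sets borel"
  using open_sublevel by auto

lemma compact_N_le: "compact {z. N z \<le> t}"
proof -
  have "bounded {z. N z \<le> t}"
  proof (rule boundedI)
    fix z assume "z \<in> {z. N z \<le> t}"
    then have "R * N z \<le> R * t" using R_pos by auto
    then show "norm z \<le> R * t" using norm_le_N[of z] by linarith
  qed
  moreover have "closed {z. N z \<le> t}"
    by (intro closed_Collect_le continuous_N continuous_on_const)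
  ultimately show ?thesis using compact_eq_bounded_closed by blast
qed

text \<open>Each ray from 0 meets the level set at most once. The difference quotients below are not
  controlled at points with \<open>N z = 1\<close>, and these form a null set whatever the boundary
  looks like.\<close>

lemma AE_N_neq: 
  assumes "t > 0"
  shows "AE z in lborel. N z \<noteq> t"
proof -
  have "negligible {z. N z = t}"
  proof (rule starlike_negligible[where a=0])
    show "closed {z. N z = t}"
      by (intro closed_Collect_eq continuous_N continuous_on_const)
    fix c :: real and x
    assume "0 + c *\<^sub>R x \<in> {z. N z = t}" "0 \<le> c" "0 + x \<in> {z. N z = t}"
    then show "c = 1" using homogeneous[of c x] assms by (simp add: scaleR_conv_of_real)
  qed
  then have "{z. N z = t} \<in> null_sets lebesgue" by (simp add: negligible_iff_null_sets)
  moreover have "{z. N z = t} \<in> sets borel" by measurable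
  ultimately have "{z. N z = t} \<in> null_sets lborel"
    by (simp add: null_sets_def)
  then show ?thesis by (intro AE_I'[of "{z. N z = t}"]) auto
qed

text \<open>
  Comparing \<open>(1 + \<i>\<tau>) z\<close> with the multiple \<open>(1 - c\<tau>) z\<close>, on which \<open>N\<close> is known by
  homogeneity, improves the Lipschitz bound for rotations; the optimal \<open>c\<close> is the one of
  \<open>exists_tangent_slope\<close>.
\<close>

lemma rotation_estimate:
  assumes "c \<ge> 0" "\<tau> \<ge> 0" "c * \<tau> \<le> 1"
  shows "\<bar>N ((1 + \<i> * of_real \<tau>) * z) - N z\<bar>
     \<le> \<tau> * (sqrt (1 + c\<^sup>2) * norm z / \<rho> - c * N z + 2 * c * \<tau> * norm z / \<rho>)"
proof -
  define \<mu> where "\<mu> = 1 + \<i> * complex_of_real \<tau>"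
  define x where "x = norm z / \<rho>"
  have x0: "x \<ge> 0" using rho_pos by (simp add: x_def)
  have n1: "norm (of_real (c * \<tau>) + \<i> * of_real \<tau>) = \<tau> * sqrt (1 + c\<^sup>2)"
    and n1': "norm (of_real (c * \<tau>) - \<i> * of_real \<tau>) = \<tau> * sqrt (1 + c\<^sup>2)"
  proof -
    have e: "(c * \<tau>)\<^sup>2 + \<tau>\<^sup>2 = \<tau>\<^sup>2 * (1 + c\<^sup>2)" by (simp add: power2_eq_square algebra_simps)
    show "norm (of_real (c * \<tau>) + \<i> * of_real \<tau>) = \<tau> * sqrt (1 + c\<^sup>2)"
      "norm (of_real (c * \<tau>) - \<i> * of_real \<tau>) = \<tau> * sqrt (1 + c\<^sup>2)"
      using e assms by (simp_all add: cmod_def real_sqrt_mult)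
  qed
  \<comment> \<open>Homogeneity evaluates \<open>N\<close> exactly at the multiple (1 - c\<tau>) z.
    The rest has length \<tau> |c + \<i>| |z| = \<tau> sqrt (1 + c^2) |z| and costs 1/\<rho> per
    unit of length.\<close>
  have "\<mu> * z = of_real (1 - c * \<tau>) * z + (of_real (c * \<tau>) + \<i> * of_real \<tau>) * z"
    by (simp add: \<mu>_def algebra_simps)
  then have "N (\<mu> * z) \<le> N (of_real (1 - c * \<tau>) * z) + norm ((of_real (c * \<tau>) + \<i> * of_real \<tau>) * z) / \<rho>"
    using N_add_le by metis
  also have "\<dots> = (1 - c * \<tau>) * N z + \<tau> * sqrt (1 + c\<^sup>2) * x"
    using assms homogeneous[of "1 - c * \<tau>" z] by (simp only: norm_mult n1 x_def) simp
  finally have up: "N (\<mu> * z) - N z \<le> \<tau> * (sqrt (1 + c\<^sup>2) * x - c * N z)"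
    by (simp add: algebra_simps)
  have n2: "norm (of_real (c * \<tau>) - \<i> * of_real \<tau> + \<i> * of_real (c * \<tau>\<^sup>2)) \<le> \<tau> * sqrt (1 + c\<^sup>2) + c * \<tau>\<^sup>2"
    using norm_triangle_ineq[of "of_real (c * \<tau>) - \<i> * of_real \<tau>" "\<i> * of_real (c * \<tau>\<^sup>2)"] assms
    unfolding n1' by (simp add: norm_mult norm_power)
  \<comment> \<open>The same comparison with z and \<mu>z exchanged. The product (1 - c\<tau>)(1 +
    \<i>\<tau>) contains -\<i>c\<tau>^2, which has to be compensated in the rest.\<close>
  have "z = of_real (1 - c * \<tau>) * (\<mu> * z) + (of_real (c * \<tau>) - \<i> * of_real \<tau> + \<i> * of_real (c * \<tau>\<^sup>2)) * z"
    by (simp add: \<mu>_def algebra_simps power2_eq_square)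
  then have "N z \<le> N (of_real (1 - c * \<tau>) * (\<mu> * z))
      + norm ((of_real (c * \<tau>) - \<i> * of_real \<tau> + \<i> * of_real (c * \<tau>\<^sup>2)) * z) / \<rho>"
    using N_add_le by metis
  also have "\<dots> \<le> (1 - c * \<tau>) * N (\<mu> * z) + (\<tau> * sqrt (1 + c\<^sup>2) + c * \<tau>\<^sup>2) * x"
    unfolding norm_mult x_def
    using assms homogeneous[of "1 - c * \<tau>" "\<mu> * z"] mult_right_mono[OF n2 x0]
    by (simp add: x_def)
  finally have lo: "N z - N (\<mu> * z) \<le> - (c * \<tau>) * N (\<mu> * z) + (\<tau> * sqrt (1 + c\<^sup>2) + c * \<tau>\<^sup>2) * x"
    by (simp add: algebra_simps)
  have "N z - N (\<mu> * z) \<le> norm (z - \<mu> * z) / \<rho>"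
    using N_lipschitz[of z "\<mu> * z"] by simp
  also have "norm (z - \<mu> * z) = \<tau> * norm z"
    using assms by (simp add: \<mu>_def algebra_simps norm_mult)
  finally have "N (\<mu> * z) \<ge> N z - \<tau> * x" by (simp add: x_def)
  \<comment> \<open>Replacing \<open>N (\<mu> * z)\<close> by \<open>N z\<close> in a term that
    already carries \<tau> costs one more c\<tau>^2; with the previous one this makes the 2c\<tau>
    of the statement.\<close>
  then have "c * \<tau> * (N z - \<tau> * x) \<le> c * \<tau> * N (\<mu> * z)"
    using assms by (intro mult_left_mono) auto
  then have lo': "N z - N (\<mu> * z) \<le> \<tau> * (sqrt (1 + c\<^sup>2) * x - c * N z + 2 * c * \<tau> * x)"
    using lo by (simp add: algebra_simps power2_eq_square)
  have "\<tau> * (2 * c * \<tau> * x) \<ge> 0" using assms x0 by simp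
  then have up': "N (\<mu> * z) - N z \<le> \<tau> * (sqrt (1 + c\<^sup>2) * x - c * N z + 2 * c * \<tau> * x)"
    using up by (simp add: algebra_simps)
  from up' lo' show ?thesis
    unfolding \<mu>_def[symmetric] x_def by (simp add: abs_le_iff)
qed

end

text \<open>A sqrt (1 + c^2) - cM is minimal at c = M / sqrt (A^2 - M^2), with value sqrt (A^2 -
  M^2). For M = A the infimum 0 is only approached as c grows, whence the error e.\<close>

lemma exists_tangent_slope:
  fixes A M e :: real
  assumes "0 \<le> M" "M \<le> A" "e > 0" "A > 0"
  shows "\<exists>c\<ge>0. A * sqrt (1 + c\<^sup>2) - c * M \<le> sqrt (A\<^sup>2 - M\<^sup>2) + e"
proof (cases "M = A")
  case True
  \<comment> \<open>By sqrt (1 + c^2) \<le> c + 1/(2c) the excess over cA is at most A/(2c), and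
    this choice makes that equal to e.\<close>
  define c where "c = A / (2 * e)"
  have c: "c > 0" using assms by (simp add: c_def)
  have "sqrt (1 + c\<^sup>2) \<le> c + 1 / (2 * c)"
  proof (rule real_le_lsqrt)
    show "1 + c\<^sup>2 \<le> (c + 1 / (2 * c))\<^sup>2"
      using c by (simp add: power2_eq_square field_simps)
  qed (use c in auto)
  then have "A * sqrt (1 + c\<^sup>2) \<le> A * (c + 1 / (2 * c))" using assms by (intro mult_left_mono) auto
  also have "\<dots> = c * A + e" using c assms by (simp add: c_def field_simps)
  finally show ?thesis using c True by (intro exI[of _ c]) auto
next
  case False
  define q where "q = sqrt (A\<^sup>2 - M\<^sup>2)"
  have MA: "M\<^sup>2 < A\<^sup>2" using False assms by (intro power_strict_mono) auto
  then have q: "q > 0" "q\<^sup>2 = A\<^sup>2 - M\<^sup>2" by (auto simp: q_def)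
  have "sqrt (1 + (M/q)\<^sup>2) = A / q"
  proof (rule real_sqrt_unique)
    show "(A / q)\<^sup>2 = 1 + (M / q)\<^sup>2"
      using q by (simp add: power_divide field_simps)
  qed (use q assms in auto)
  then have "A * sqrt (1 + (M/q)\<^sup>2) - (M/q) * M = (A\<^sup>2 - M\<^sup>2) / q"
    by (simp add: power2_eq_square diff_divide_distrib)
  also have "\<dots> = q" using q by (metis nonzero_divide_eq_eq order_less_irrefl power2_eq_square)
  finally show ?thesis using q assms by (intro exI[of _ "M/q"]) (auto simp: q_def)
qed

subsection \<open>Dilation and rotation flow\<close>

text \<open>
  The substitution \<open>z \<mapsto> z / \<mu>\<close> preserves \<open>dz / \<bar>z\<bar>\<^sup>2\<close> and moves \<open>\<mu>\<close> from the Lipschitz factor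
  \<open>V (\<mu> z)\<close> to the holomorphic one. Hence the difference quotients along \<open>\<mu> = 1 + \<zeta> \<tau>\<close> converge,
  with limit \<open>- \<zeta> * flux\<close> for \<open>\<zeta> = 1\<close> as well as for \<open>\<zeta> = \<i>\<close>.
\<close>

locale star_flow = gauge_function +
  fixes G :: "complex \<Rightarrow> complex" and \<kappa> :: real
  assumes kappa: "\<kappa> > 1" and holo: "G holomorphic_on {z. N z < \<kappa>}"
begin

text \<open>\<open>V\<close> is continuous across the boundary of the unit sublevel set, so moving
  its argument creates no boundary term. By homogeneity its derivative under dilations is -2N^2
  inside, which the kernel |z|^(-2) turns into -2M^2.\<close>

definition V :: "complex \<Rightarrow> real" where "V z = max 0 (1 - (N z)\<^sup>2)"

text \<open>Subtracting the value at 0 gains the factor |z| that makes the product with |z|^(-2)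
  integrable. The indicator only serves to get a Borel function on the plane: all arguments that
  matter stay in \<open>K\<close>, away from level \<kappa>.\<close>

definition Gt :: "complex \<Rightarrow> complex" where
  "Gt z = indicator (sublevel \<kappa>) z *\<^sub>R (G z - G 0)"

text \<open>An intermediate level: \<open>K\<close> is compact inside the domain of holomorphy and
  still contains z/\<mu> for z in the unit sublevel set and \<mu> near 1.\<close>

definition \<kappa>' :: real where "\<kappa>' = (1 + \<kappa>) / 2"

lemma kappa': "1 < \<kappa>'" "\<kappa>' < \<kappa>" using kappa by (auto simp: \<kappa>'_def)

definition K :: "complex set" where "K = {z. N z \<le> \<kappa>'}"

lemma compact_K: "compact K" unfolding K_def by (rule compact_N_le)

lemma K_sub: "K \<subseteq> sublevel \<kappa>" using kappa' by (auto simp: K_def sublevel_def)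

lemma holo': "G holomorphic_on sublevel \<kappa>" using holo by (simp add: sublevel_def)

lemma V_measurable [measurable]: "V \<in> borel_measurable borel"
  unfolding V_def by measurable

lemma V_bounds: "0 \<le> V z" "V z \<le> 1" by (auto simp: V_def)

lemma V_eq_0: "N z \<ge> 1 \<Longrightarrow> V z = 0" by (auto simp: V_def)

lemma V_eq: "N z \<le> 1 \<Longrightarrow> V z = 1 - (N z)\<^sup>2" by (auto simp: V_def power_le_one)

lemma Gt_measurable [measurable]: "Gt \<in> borel_measurable borel"
  unfolding Gt_def
  by (intro borel_measurable_continuous_on_indicator continuous_intros holomorphic_on_imp_continuous_on holo')
     measurable

lemma Gt_0 [simp]: "Gt 0 = 0" by (simp add: Gt_def)

text \<open>A bound on the derivative can be integrated along a segment only if the segment stays in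
  \<open>K\<close>, and \<open>K\<close> need not be convex.\<close>

lemma lipschitz_on_K: obtains L where "L \<ge> 0"
  "\<And>z w. closed_segment z w \<subseteq> K \<Longrightarrow> norm (G w - G z) \<le> L * norm (w - z)"
proof -
  have "continuous_on (sublevel \<kappa>) (deriv G)"
    by (intro holomorphic_on_imp_continuous_on holomorphic_deriv holo' open_sublevel)
  then have "compact (deriv G ` K)"
    using compact_K K_sub by (intro compact_continuous_image) (auto intro: continuous_on_subset)
  then obtain L where L: "L > 0" "\<And>z. z \<in> K \<Longrightarrow> norm (deriv G z) \<le> L"
    using compact_imp_bounded bounded_pos by (metis image_eqI)
  show thesis
  proof (rule that[of L])
    fix z w assume s: "closed_segment z w \<subseteq> K"
    show "norm (G w - G z) \<le> L * norm (w - z)"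
    proof (rule field_differentiable_bound[of "closed_segment z w" G "deriv G" L w z])
      fix u assume "u \<in> closed_segment z w"
      then have "u \<in> sublevel \<kappa>" "u \<in> K" using s K_sub by auto
      then show "(G has_field_derivative deriv G u) (at u within closed_segment z w)"
        using holomorphic_derivI[OF holo' open_sublevel] by blast
      show "norm (deriv G u) \<le> L" using L \<open>u \<in> K\<close> by auto
    qed auto
  qed (use L in auto)
qed

lemma Gt_bound: "\<exists>L\<ge>0. (\<forall>z\<in>K. norm (Gt z) \<le> L * norm z) \<and>
   (\<forall>z w. closed_segment z w \<subseteq> K \<longrightarrow> norm (Gt w - Gt z) \<le> L * norm (w - z))"
proof -
  obtain L where L: "L \<ge> 0" "\<And>z w. closed_segment z w \<subseteq> K \<Longrightarrow> norm (G w - G z) \<le> L * norm (w - z)"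
    using lipschitz_on_K by blast
  have Gt_K: "Gt z = G z - G 0" if "z \<in> K" for z
    using that K_sub by (auto simp: Gt_def)
  show ?thesis
  proof (intro exI[of _ L] conjI ballI allI impI L(1))
    fix z assume z: "z \<in> K"
    have "closed_segment 0 z \<subseteq> K"
    proof
      fix u assume "u \<in> closed_segment 0 z"
      then obtain t where t: "0 \<le> t" "t \<le> 1" "u = of_real t * z"
        by (auto simp: closed_segment_def scaleR_conv_of_real)
      then have "N u = t * N z" using homogeneous by simp
      also have "\<dots> \<le> N z" using t by (intro mult_left_le_one_le) auto
      finally show "u \<in> K" using z by (simp add: K_def)
    qed
    from L(2)[OF this] show "norm (Gt z) \<le> L * norm z" using Gt_K[OF z] by simp
  next
    fix z w assume s: "closed_segment z w \<subseteq> K"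
    then have "z \<in> K" "w \<in> K" by auto
    then show "norm (Gt w - Gt z) \<le> L * norm (w - z)"
      using L(2)[OF s] Gt_K by simp
  qed
qed

text \<open>The first condition keeps \<mu> away from 0 and gives |1/\<mu> - 1| \<le> 2 |\<mu> - 1|.
  The second limits the growth of \<open>N\<close> when z, of norm at most R, moves to z/\<mu>: the
  displacement is at most 2 |\<mu> - 1| R.\<close>

definition close_to_1 :: "complex \<Rightarrow> bool" where
  "close_to_1 \<mu> \<longleftrightarrow> norm (\<mu> - 1) \<le> 1/2 \<and> 2 * norm (\<mu> - 1) * R / \<rho> \<le> \<kappa>' - 1"

lemma close_nonzero: "close_to_1 \<mu> \<Longrightarrow> \<mu> \<noteq> 0" by (auto simp: close_to_1_def)

lemma close_inverse:
  assumes "close_to_1 \<mu>" 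
  shows "norm (1/\<mu> - 1) \<le> 2 * norm (\<mu> - 1)" "norm (1/\<mu>) \<le> 2"
proof -
  have n: "norm \<mu> \<ge> 1/2" 
    using assms norm_triangle_ineq2[of 1 "1 - \<mu>"] by (auto simp: close_to_1_def norm_minus_commute)
  have "1/\<mu> - 1 = (1 - \<mu>) / \<mu>" using close_nonzero[OF assms] by (simp add: field_simps)
  then have "norm (1/\<mu> - 1) = norm (\<mu> - 1) / norm \<mu>" by (simp add: norm_divide norm_minus_commute)
  also have "\<dots> \<le> norm (\<mu> - 1) / (1/2)" using n by (intro divide_left_mono) auto
  finally show "norm (1/\<mu> - 1) \<le> 2 * norm (\<mu> - 1)" by simp
  have "norm (1/\<mu>) = 1 / norm \<mu>" by (simp add: norm_divide)
  also have "\<dots> \<le> 1 / (1/2)" using n by (intro divide_left_mono) auto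
  finally show "norm (1/\<mu>) \<le> 2" by simp
qed

lemma close_segment:
  assumes "close_to_1 \<mu>" "N z \<le> 1"
  shows "closed_segment z (z / \<mu>) \<subseteq> K"
proof
  fix u assume "u \<in> closed_segment z (z / \<mu>)"
  then obtain t where t: "0 \<le> t" "t \<le> 1" "u = z + of_real t * (z / \<mu> - z)"
    by (auto simp: closed_segment_def scaleR_conv_of_real algebra_simps)
  have "norm (of_real t * (z / \<mu> - z)) \<le> 1 * norm (z / \<mu> - z)"
    using t by (simp only: norm_mult) (intro mult_right_mono, auto)
  also have "1 * norm (z / \<mu> - z) = norm (1 / \<mu> - 1) * norm z"
    by (simp add: norm_mult[symmetric] algebra_simps)
  also have "norm z \<le> R" using norm_le_N[of z] mult_left_mono[OF assms(2), of R] R_pos by linarith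
  then have "norm (1 / \<mu> - 1) * norm z \<le> (2 * norm (\<mu> - 1)) * R"
    using close_inverse[OF assms(1)] by (intro mult_mono) auto
  finally have "norm (of_real t * (z / \<mu> - z)) / \<rho> \<le> 2 * norm (\<mu> - 1) * R / \<rho>"
    using rho_pos by (intro divide_right_mono) auto
  then have "N u \<le> 1 + (\<kappa>' - 1)"
    using N_add_le[of z "of_real t * (z / \<mu> - z)"] assms unfolding close_to_1_def t(3) by linarith
  then show "u \<in> K" by (simp add: K_def)
qed

lemma N_mult_lt_1: 
  assumes "close_to_1 \<mu>" "N (\<mu> * z) \<le> 1"
  shows "z \<in> K"
  using close_segment[OF assms] close_nonzero[OF assms(1)] by auto

definition ball_R :: "complex set" where "ball_R = cball 0 (R * \<kappa>')"

lemma K_ball: "K \<subseteq> ball_R"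
proof
  fix z assume "z \<in> K"
  then have "R * N z \<le> R * \<kappa>'" using R_pos by (auto simp: K_def)
  then show "z \<in> ball_R" using norm_le_N[of z] by (simp add: ball_R_def)
qed

lemma ball_R_measurable [measurable]: "ball_R \<in> sets borel" by (simp add: ball_R_def)

lemma integrable_kernel: "integrable lborel (\<lambda>z. C * (indicator ball_R z / norm z))"
  unfolding ball_R_def by (intro integrable_mult_right integrable_inverse_norm_complex)

lemma one_in_K: "N z \<le> 1 \<Longrightarrow> z \<in> K" using kappa' by (auto simp: K_def)

lemma integrable_left:
  assumes "close_to_1 \<mu>"
  shows "integrable lborel (\<lambda>z. (V (\<mu> * z) / (norm z)\<^sup>2) *\<^sub>R Gt z)"
proof -
  obtain L where L: "L \<ge> 0" "\<And>z. z \<in> K \<Longrightarrow> norm (Gt z) \<le> L * norm z"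
    "\<And>z w. closed_segment z w \<subseteq> K \<Longrightarrow> norm (Gt w - Gt z) \<le> L * norm (w - z)"
    using Gt_bound by blast
  show ?thesis
  proof (rule Bochner_Integration.integrable_bound[OF integrable_kernel[of L]])
    show "AE z in lborel. norm ((V (\<mu> * z) / (norm z)\<^sup>2) *\<^sub>R Gt z) \<le> norm (L * (indicator ball_R z / norm z))"
    proof (rule AE_I2)
      fix z
      show "norm ((V (\<mu> * z) / (norm z)\<^sup>2) *\<^sub>R Gt z) \<le> norm (L * (indicator ball_R z / norm z))"
      proof (cases "z = 0 \<or> N (\<mu> * z) \<ge> 1")
        case True then show ?thesis by (auto simp: V_eq_0)
      next
        case False
        then have zK: "z \<in> K" using N_mult_lt_1[OF assms] by auto
        have "V (\<mu> * z) * norm (Gt z) \<le> 1 * (L * norm z)"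
          using V_bounds[of "\<mu> * z"] L zK by (intro mult_mono) auto
        then show ?thesis using False zK K_ball L V_bounds[of "\<mu> * z"]
          by (auto simp: norm_mult indicator_def power2_eq_square divide_simps)
      qed
    qed
  qed measurable
qed

lemma right_pointwise:
  assumes "close_to_1 \<mu>" and L: "L \<ge> 0" "\<And>z. z \<in> K \<Longrightarrow> norm (Gt z) \<le> L * norm z"
  shows "norm ((V z / (norm z)\<^sup>2) *\<^sub>R Gt (z / \<mu>)) \<le> norm ((2 * L) * (indicator ball_R z / norm z))"
proof (cases "z = 0 \<or> N z \<ge> 1")
  case True then show ?thesis by (auto simp: V_eq_0)
next
  case False
  have zK: "z \<in> K" "z / \<mu> \<in> K" using close_segment[OF assms(1), of z] False by auto
  have "norm (Gt (z / \<mu>)) \<le> L * (norm (1/\<mu>) * norm z)"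
    using L(2)[OF zK(2)] by (simp add: norm_divide)
  also have "\<dots> \<le> L * (2 * norm z)"
    using close_inverse[OF assms(1)] L by (intro mult_left_mono mult_right_mono) auto
  finally have "V z * norm (Gt (z/\<mu>)) \<le> 1 * (L * (2 * norm z))"
    using V_bounds[of z] L by (intro mult_mono) auto
  then show ?thesis using False zK K_ball L V_bounds[of z]
    by (auto simp: norm_mult indicator_def power2_eq_square divide_simps)
qed

lemma integrable_right:
  assumes "close_to_1 \<mu>"
  shows "integrable lborel (\<lambda>z. (V z / (norm z)\<^sup>2) *\<^sub>R Gt (z / \<mu>))"
proof -
  obtain L where L: "L \<ge> 0" "\<And>z. z \<in> K \<Longrightarrow> norm (Gt z) \<le> L * norm z"
    "\<And>z w. closed_segment z w \<subseteq> K \<Longrightarrow> norm (Gt w - Gt z) \<le> L * norm (w - z)"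
    using Gt_bound by blast
  show ?thesis
    by (rule Bochner_Integration.integrable_bound[OF integrable_kernel[of "2 * L"]])
      (use right_pointwise[OF assms L(1,2)] in auto)
qed

lemma substitution:
  assumes "close_to_1 \<mu>"
  shows "(LINT z|lborel. ((V (\<mu> * z) - V z) / (norm z)\<^sup>2) *\<^sub>R Gt z)
       = (LINT z|lborel. (V z / (norm z)\<^sup>2) *\<^sub>R (Gt (z / \<mu>) - Gt z))"
proof -
  note nz = close_nonzero[OF assms]
  have c1: "close_to_1 1" using kappa' by (simp add: close_to_1_def)
  \<comment> \<open>The Jacobian |\<mu>|^2 cancels the change of the kernel from |z|^(-2) to
    |\<mu>z|^(-2). Both halves of each difference are integrable separately, so the identity follows
    by subtraction.\<close>
  have "(LINT z|lborel. (V z / (norm z)\<^sup>2) *\<^sub>R Gt (z / \<mu>))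
      = (LINT z|lborel. (norm \<mu>)\<^sup>2 *\<^sub>R ((V (\<mu> * z) / (norm (\<mu> * z))\<^sup>2) *\<^sub>R Gt (\<mu> * z / \<mu>)))"
    by (rule lborel_integral_complex_mult[OF nz]) measurable
  also have "\<dots> = (LINT z|lborel. (V (\<mu> * z) / (norm z)\<^sup>2) *\<^sub>R Gt z)"
    using nz by (intro Bochner_Integration.integral_cong) (auto simp: norm_mult power_mult_distrib)
  finally have "(LINT z|lborel. (V z / (norm z)\<^sup>2) *\<^sub>R Gt (z / \<mu>)) = \<dots>" .
  moreover have "(LINT z|lborel. ((V (\<mu> * z) - V z) / (norm z)\<^sup>2) *\<^sub>R Gt z)
    = (LINT z|lborel. (V (\<mu> * z) / (norm z)\<^sup>2) *\<^sub>R Gt z) - (LINT z|lborel. (V z / (norm z)\<^sup>2) *\<^sub>R Gt z)"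
    using Bochner_Integration.integral_diff[OF integrable_left[OF assms] integrable_left[OF c1]]
    by (simp add: diff_divide_distrib scaleR_diff_left)
  moreover have "(LINT z|lborel. (V z / (norm z)\<^sup>2) *\<^sub>R (Gt (z / \<mu>) - Gt z))
    = (LINT z|lborel. (V z / (norm z)\<^sup>2) *\<^sub>R Gt (z/\<mu>)) - (LINT z|lborel. (V z / (norm z)\<^sup>2) *\<^sub>R Gt z)"
    using Bochner_Integration.integral_diff[OF integrable_right[OF assms] integrable_left[OF c1]]
    by (simp add: scaleR_diff_right)
  ultimately show ?thesis by simp
qed

text \<open>The largest size of \<mu> - 1 that \<open>close_to_1\<close> admits.\<close>

definition \<epsilon> :: real where "\<epsilon> = min (1/2) ((\<kappa>' - 1) * \<rho> / (2 * R))"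

definition \<tau> :: "nat \<Rightarrow> real" where "\<tau> n = \<epsilon> / real (Suc n)"

lemma eps_pos: "\<epsilon> > 0" using kappa' rho_pos R_pos by (auto simp: \<epsilon>_def)

lemma tau_pos: "\<tau> n > 0" using eps_pos by (simp add: \<tau>_def)

lemma tau_le: "\<tau> n \<le> \<epsilon>" using eps_pos by (simp add: \<tau>_def divide_simps)

lemma tau_le_half: "\<tau> n \<le> 1/2" using tau_le[of n] by (simp add: \<epsilon>_def)

lemma tau_tendsto: "\<tau> \<longlonglongrightarrow> 0"
  unfolding \<tau>_def using tendsto_mult_left[OF LIMSEQ_inverse_real_of_nat, of \<epsilon>]
  by (simp add: divide_inverse)

lemma close_tau: "norm \<zeta> = 1 \<Longrightarrow> close_to_1 (1 + \<zeta> * of_real (\<tau> n))"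
proof -
  assume z: "norm \<zeta> = 1"
  have "2 * \<tau> n * R / \<rho> \<le> 2 * ((\<kappa>' - 1) * \<rho> / (2 * R)) * R / \<rho>"
    using tau_le[of n] R_pos rho_pos
    by (intro divide_right_mono mult_right_mono mult_left_mono) (auto simp: \<epsilon>_def)
  also have "\<dots> = \<kappa>' - 1" using R_pos rho_pos by simp
  finally show ?thesis using z tau_le_half[of n] tau_pos[of n]
    by (simp add: close_to_1_def norm_mult)
qed

text \<open>z G'(z) is the derivative of G along dilations; along rotations it becomes \<i> z G'(z).
  One complex number therefore governs both directions.\<close>

definition flux :: complex where
  "flux = (LINT z|lborel. (V z / (norm z)\<^sup>2) *\<^sub>R (indicator (sublevel \<kappa>) z *\<^sub>R (z * deriv G z)))"

text \<open>After \<open>substitution\<close> the quotient falls on G(z/\<mu>), whose derivative at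
  \<mu> = 1 in the direction \<zeta> is -\<zeta> z G'(z). The Lipschitz bound on \<open>K\<close>
  dominates the integrands by a multiple of 1/|z|.\<close>

lemma quotient_tendsto:
  assumes z: "norm \<zeta> = 1"
  shows "(\<lambda>n. LINT z|lborel. ((V ((1 + \<zeta> * of_real (\<tau> n)) * z) - V z) / \<tau> n / (norm z)\<^sup>2) *\<^sub>R Gt z)
      \<longlonglongrightarrow> - \<zeta> * flux"
proof -
  obtain L where L: "L \<ge> 0" "\<And>z w. closed_segment z w \<subseteq> K \<Longrightarrow> norm (Gt w - Gt z) \<le> L * norm (w - z)"
    using Gt_bound by blast
  define \<mu> where "\<mu> n = 1 + \<zeta> * of_real (\<tau> n)" for n
  have cl: "close_to_1 (\<mu> n)" for n unfolding \<mu>_def by (rule close_tau[OF z])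
  define f where "f n z = (V z / (norm z)\<^sup>2) *\<^sub>R ((1 / \<tau> n) *\<^sub>R (Gt (z / \<mu> n) - Gt z))" for n z
  define g where "g z = (V z / (norm z)\<^sup>2) *\<^sub>R (indicator (sublevel \<kappa>) z *\<^sub>R (- \<zeta> * (z * deriv G z)))" for z
  have dm: "(\<lambda>z. indicator (sublevel \<kappa>) z *\<^sub>R (c * (z * deriv G z))) \<in> borel_measurable borel" for c
    by (intro borel_measurable_continuous_on_indicator continuous_intros sublevel_measurable
        holomorphic_on_imp_continuous_on holomorphic_deriv holo' open_sublevel)
  have [measurable]: "g \<in> borel_measurable borel"
    unfolding g_def using dm[of "-\<zeta>"] by measurable
  have "(\<lambda>n. LINT z|lborel. f n z) \<longlonglongrightarrow> (LINT z|lborel. g z)"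
  proof (rule integral_dominated_convergence[where w="\<lambda>z. (2 * L) * (indicator ball_R z / norm z)"])
    show "integrable lborel (\<lambda>z. (2 * L) * (indicator ball_R z / norm z))" by (rule integrable_kernel)
    show "AE w in lborel. (\<lambda>n. f n w) \<longlonglongrightarrow> g w"
    proof (rule AE_I2)
      fix w
      show "(\<lambda>n. f n w) \<longlonglongrightarrow> g w"
      proof (cases "N w < 1")
        case False then show ?thesis by (simp add: f_def g_def V_eq_0)
      next
        case True
        then have wK: "w \<in> sublevel \<kappa>" using kappa by (simp add: sublevel_def)
        \<comment> \<open>The parameter t is complex here and \<zeta> comes out as a factor; the
          real sequence \<tau> is inserted afterwards.\<close>
        have "((\<lambda>t. G (w / (1 + \<zeta> * t))) has_field_derivative (deriv G (w / (1 + \<zeta> * 0)) * (- \<zeta> * w))) (at 0)"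
        proof (rule DERIV_chain2[where f=G and g="\<lambda>t. w / (1 + \<zeta> * t)"])
          show "(G has_field_derivative deriv G (w / (1 + \<zeta> * 0))) (at (w / (1 + \<zeta> * 0)))"
            using holomorphic_derivI[OF holo' open_sublevel wK] by simp
          show "((\<lambda>t. w / (1 + \<zeta> * t)) has_field_derivative - \<zeta> * w) (at 0)"
            by (auto intro!: derivative_eq_intros)
        qed
        then have "((\<lambda>t. (G (w / (1 + \<zeta> * t)) - G w) / t) \<longlongrightarrow> - \<zeta> * (w * deriv G w)) (at 0)"
          unfolding DERIV_def by (simp add: mult_ac)
        moreover have "filterlim (\<lambda>n. complex_of_real (\<tau> n)) (at 0) sequentially"
        proof -
          have "\<tau> n \<noteq> 0" for n using tau_pos[of n] by simp
          then show ?thesis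
            unfolding filterlim_at using tendsto_of_real[OF tau_tendsto, where 'a=complex] by simp
        qed
        ultimately have lim: "(\<lambda>n. (G (w / \<mu> n) - G w) / of_real (\<tau> n)) \<longlonglongrightarrow> - \<zeta> * (w * deriv G w)"
          unfolding \<mu>_def by (rule filterlim_compose)
        have eq: "(1 / \<tau> n) *\<^sub>R (Gt (w / \<mu> n) - Gt w) = (G (w / \<mu> n) - G w) / of_real (\<tau> n)" for n
        proof -
          have "w / \<mu> n \<in> K" using close_segment[OF cl, of w n] True by auto
          then have "w / \<mu> n \<in> sublevel \<kappa>" using K_sub by auto
          then show ?thesis using wK by (simp add: Gt_def scaleR_conv_of_real)
        qed
        have "(\<lambda>n. (V w / (norm w)\<^sup>2) *\<^sub>R ((G (w / \<mu> n) - G w) / of_real (\<tau> n)))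
            \<longlonglongrightarrow> (V w / (norm w)\<^sup>2) *\<^sub>R (- \<zeta> * (w * deriv G w))"
          by (rule tendsto_scaleR[OF tendsto_const lim])
        then show ?thesis unfolding f_def g_def eq using wK by simp
      qed
    qed
    fix n
    show "AE w in lborel. norm (f n w) \<le> (2 * L) * (indicator ball_R w / norm w)"
    proof (rule AE_I2)
      fix w
      show "norm (f n w) \<le> (2 * L) * (indicator ball_R w / norm w)"
      proof (cases "N w < 1 \<and> w \<noteq> 0")
        case False then show ?thesis using L by (auto simp: f_def V_eq_0)
      next
        case True
        then have "w \<in> ball_R" using one_in_K K_ball by auto
        have "norm (Gt (w / \<mu> n) - Gt w) \<le> L * norm (w / \<mu> n - w)"
          using close_segment[OF cl, of w n] True by (intro L(2)) auto
        also have "w / \<mu> n - w = (1 / \<mu> n - 1) * w" by (simp add: algebra_simps)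
        also have "L * norm \<dots> \<le> L * (2 * \<tau> n * norm w)"
          using close_inverse[OF cl[of n]] L(1) z tau_pos[of n]
          by (simp only: norm_mult) (intro mult_left_mono mult_right_mono, auto simp: \<mu>_def norm_mult)
        finally have "(1 / \<tau> n) * norm (Gt (w / \<mu> n) - Gt w) \<le> 2 * L * norm w"
          using tau_pos[of n] by (simp add: field_simps)
        then have "V w * ((1 / \<tau> n) * norm (Gt (w / \<mu> n) - Gt w)) \<le> 1 * (2 * L * norm w)"
          using V_bounds[of w] L tau_pos[of n] by (intro mult_mono[where a="V w" and b=1]) auto
        moreover have "norm (f n w) = V w * ((1 / \<tau> n) * norm (Gt (w / \<mu> n) - Gt w)) / (norm w)\<^sup>2"
          using V_bounds[of w] tau_pos[of n] by (simp add: f_def)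
        ultimately have "norm (f n w) \<le> 2 * L * norm w / (norm w)\<^sup>2"
          by (metis divide_right_mono mult_1 zero_le_power2)
        then show ?thesis using True \<open>w \<in> ball_R\<close> by (simp add: power2_eq_square)
      qed
    qed
    show "f n \<in> borel_measurable lborel" unfolding f_def by measurable
  qed simp
  also have "(LINT z|lborel. g z) = - \<zeta> * flux"
  proof -
    have "g z = - \<zeta> * ((V z / (norm z)\<^sup>2) *\<^sub>R (indicator (sublevel \<kappa>) z *\<^sub>R (z * deriv G z)))" for z
      unfolding g_def by (simp only: mult_scaleR_right)
    then show ?thesis unfolding flux_def by (simp only: integral_mult_right_zero)
  qed
  also have "(\<lambda>n. LINT z|lborel. f n z) =
     (\<lambda>n. LINT z|lborel. ((V (\<mu> n * z) - V z) / \<tau> n / (norm z)\<^sup>2) *\<^sub>R Gt z)"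
  proof
    fix n
    have "(LINT z|lborel. f n z) = (LINT z|lborel. (1 / \<tau> n) *\<^sub>R ((V z / (norm z)\<^sup>2) *\<^sub>R (Gt (z / \<mu> n) - Gt z)))"
      unfolding f_def by (intro Bochner_Integration.integral_cong) auto
    also have "\<dots> = (1 / \<tau> n) *\<^sub>R (LINT z|lborel. ((V (\<mu> n * z) - V z) / (norm z)\<^sup>2) *\<^sub>R Gt z)"
      using substitution[OF cl[of n]] by (simp only: integral_scaleR_right)
    also have "\<dots> = (LINT z|lborel. (1 / \<tau> n) *\<^sub>R (((V (\<mu> n * z) - V z) / (norm z)\<^sup>2) *\<^sub>R Gt z))"
      by (simp only: integral_scaleR_right)
    also have "\<dots> = (LINT z|lborel. ((V (\<mu> n * z) - V z) / \<tau> n / (norm z)\<^sup>2) *\<^sub>R Gt z)"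
      by (intro Bochner_Integration.integral_cong) (auto simp: field_simps)
    finally show "(LINT z|lborel. f n z) = \<dots>" .
  qed
  finally show ?thesis by (simp add: \<mu>_def)
qed

end

section \<open>Limits of the difference quotients along dilations and rotations\<close>

context star_flow
begin

definition M :: "complex \<Rightarrow> real" where "M z = N z / norm z"

definition quot :: "complex \<Rightarrow> nat \<Rightarrow> complex \<Rightarrow> real" where
  "quot \<zeta> n z = (V ((1 + \<zeta> * of_real (\<tau> n)) * z) - V z) / \<tau> n / (norm z)\<^sup>2"

lemma M_measurable [measurable]: "M \<in> borel_measurable borel"
  unfolding M_def by measurable

lemma quot_measurable [measurable]: "quot \<zeta> n \<in> borel_measurable borel"
  unfolding quot_def by measurable

lemma M_bounds: "0 \<le> M z" "M z \<le> 1 / \<rho>"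
  using N_upper[of z] rho_pos by (auto simp: M_def divide_simps mult.commute)

lemma V_diff_le: "\<bar>V w - V z\<bar> \<le> \<bar>N w - N z\<bar> * (2 * N z + \<bar>N w - N z\<bar>)"
proof -
  have "\<bar>V w - V z\<bar> \<le> \<bar>(N w)\<^sup>2 - (N z)\<^sup>2\<bar>" by (auto simp: V_def)
  also have "(N w)\<^sup>2 - (N z)\<^sup>2 = (N w - N z) * (N w + N z)" by (simp add: power2_eq_square algebra_simps)
  also have "\<bar>\<dots>\<bar> = \<bar>N w - N z\<bar> * (N w + N z)" by (simp add: abs_mult)
  also have "\<dots> \<le> \<bar>N w - N z\<bar> * (2 * N z + \<bar>N w - N z\<bar>)"
    by (intro mult_left_mono) auto
  finally show ?thesis .
qed

text \<open>Factoring the difference of squares separates the slope of \<open>N\<close> from a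
  second factor that tends to 2M.\<close>

lemma quot_le:
  assumes "z \<noteq> 0"
  shows "\<bar>quot \<zeta> n z\<bar> \<le> \<bar>N ((1 + \<zeta> * of_real (\<tau> n)) * z) - N z\<bar> / (\<tau> n * norm z)
    * (2 * M z + \<bar>N ((1 + \<zeta> * of_real (\<tau> n)) * z) - N z\<bar> / norm z)"
proof -
  let ?d = "\<bar>N ((1 + \<zeta> * of_real (\<tau> n)) * z) - N z\<bar>"
  have "\<bar>quot \<zeta> n z\<bar> = \<bar>V ((1 + \<zeta> * of_real (\<tau> n)) * z) - V z\<bar> / (\<tau> n * (norm z)\<^sup>2)"
    using tau_pos[of n] by (simp add: quot_def abs_mult)
  also have "\<dots> \<le> ?d * (2 * N z + ?d) / (\<tau> n * (norm z)\<^sup>2)"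
    using tau_pos[of n] by (intro divide_right_mono V_diff_le) auto
  also have "\<dots> = ?d / (\<tau> n * norm z) * (2 * M z + ?d / norm z)"
    using assms by (simp add: M_def power2_eq_square field_simps)
  finally show ?thesis .
qed

lemma N_mult_diff_le:
  assumes "norm \<zeta> = 1"
  shows "\<bar>N ((1 + \<zeta> * of_real (\<tau> n)) * z) - N z\<bar> \<le> \<tau> n * norm z / \<rho>"
proof -
  have "(1 + \<zeta> * of_real (\<tau> n)) * z - z = \<zeta> * of_real (\<tau> n) * z" by (simp add: algebra_simps)
  then show ?thesis
    using N_lipschitz[of "(1 + \<zeta> * of_real (\<tau> n)) * z" z] assms tau_pos[of n] by (simp add: norm_mult)
qed

text \<open>The first factor of \<open>quot_le\<close> is at most 1/\<rho>, the second at most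
  2/\<rho> + \<tau>/\<rho> with \<tau> \<le> 1. Off \<open>K\<close> both values of \<open>V\<close>
  are 0. This bound dominates all quotients at once.\<close>

lemma quot_bound:
  assumes "norm \<zeta> = 1"
  shows "\<bar>quot \<zeta> n z\<bar> \<le> 3 / \<rho>\<^sup>2 * indicator K z"
proof (cases "z \<in> K \<and> z \<noteq> 0")
  case False
  show ?thesis
  proof (cases "z = 0")
    case True then show ?thesis by (simp add: quot_def)
  next
    case False
    with \<open>\<not> (z \<in> K \<and> z \<noteq> 0)\<close> have "z \<notin> K" by simp
    then have "N z \<ge> 1" "N ((1 + \<zeta> * of_real (\<tau> n)) * z) \<ge> 1"
      using one_in_K[of z] N_mult_lt_1[OF close_tau[OF assms], of n z] by linarith+
    then show ?thesis using \<open>z \<notin> K\<close> by (simp add: quot_def V_eq_0)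
  qed
next
  case True
  let ?d = "\<bar>N ((1 + \<zeta> * of_real (\<tau> n)) * z) - N z\<bar>"
  have d: "?d \<le> \<tau> n * norm z / \<rho>" by (rule N_mult_diff_le[OF assms])
  have "\<tau> n \<le> 1" using tau_le_half[of n] by simp
  have 1: "?d / (\<tau> n * norm z) \<le> 1 / \<rho>"
    using d True tau_pos[of n] rho_pos by (simp add: field_simps)
  have "?d / norm z \<le> \<tau> n / \<rho>" using d True rho_pos by (simp add: field_simps)
  also have "\<dots> \<le> 1 / \<rho>" using \<open>\<tau> n \<le> 1\<close> rho_pos by (simp add: divide_right_mono)
  finally have 2: "2 * M z + ?d / norm z \<le> 3 / \<rho>" using M_bounds[of z] by simp
  have "\<bar>quot \<zeta> n z\<bar> \<le> ?d / (\<tau> n * norm z) * (2 * M z + ?d / norm z)"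
    using True by (intro quot_le) auto
  also have "\<dots> \<le> 1 / \<rho> * (3 / \<rho>)"
    using 1 2 M_bounds[of z] rho_pos by (intro mult_mono) auto
  finally show ?thesis using True by (simp add: power2_eq_square)
qed

lemma mult_tau_tendsto: "(\<lambda>n. (1 + \<zeta> * complex_of_real (\<tau> n)) * z) \<longlonglongrightarrow> z"
proof -
  have "(\<lambda>n. (1 + \<zeta> * complex_of_real (\<tau> n)) * z) \<longlonglongrightarrow> (1 + \<zeta> * of_real 0) * z"
    by (intro tendsto_intros tau_tendsto)
  then show ?thesis by simp
qed

lemma N_mult_tau_tendsto: "(\<lambda>n. N ((1 + \<zeta> * of_real (\<tau> n)) * z)) \<longlonglongrightarrow> N z"
  using continuous_on_tendsto_compose[OF continuous_N mult_tau_tendsto] by simp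

lemma quot_outside:
  assumes "N z > 1"
  shows "eventually (\<lambda>n. quot \<zeta> n z = 0) sequentially"
proof -
  have "eventually (\<lambda>n. N ((1 + \<zeta> * of_real (\<tau> n)) * z) > 1) sequentially"
    by (rule order_tendstoD(1)[OF N_mult_tau_tendsto assms])
  then show ?thesis
    by eventually_elim (use assms in \<open>simp add: quot_def V_eq_0\<close>)
qed

text \<open>Along a dilation homogeneity gives \<open>N\<close> exactly: inside, the quotient equals
  -(2 + \<tau>) M^2 for large n.\<close>

lemma radial_quot_tendsto:
  assumes "N z \<noteq> 1"
  shows "(\<lambda>n. quot 1 n z) \<longlonglongrightarrow> - 2 * (M z)\<^sup>2 * indicator (sublevel 1) z"
proof (cases "N z > 1")
  case True
  then show ?thesis
    using tendsto_eventually[OF quot_outside[OF True, of 1]] by (simp add: sublevel_def)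
next
  case False
  have "N z < 1" using False assms by simp
  have ev: "eventually (\<lambda>n. - ((2 + \<tau> n) * (M z)\<^sup>2) = quot 1 n z) sequentially"
    using order_tendstoD(2)[OF N_mult_tau_tendsto \<open>N z < 1\<close>, of 1]
  proof eventually_elim
    case (elim n)
    have "N ((1 + 1 * of_real (\<tau> n)) * z) = (1 + \<tau> n) * N z"
      using homogeneous[of "1 + \<tau> n" z] tau_pos[of n] by simp
    then have "quot 1 n z = ((N z)\<^sup>2 - ((1 + \<tau> n) * N z)\<^sup>2) / \<tau> n / (norm z)\<^sup>2"
      using elim \<open>N z < 1\<close> by (simp add: quot_def V_eq)
    also have "(N z)\<^sup>2 - ((1 + \<tau> n) * N z)\<^sup>2 = - ((2 + \<tau> n) * (N z)\<^sup>2) * \<tau> n"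
      by (simp add: power2_eq_square algebra_simps)
    finally show ?case using tau_pos[of n] by (simp add: M_def power_divide)
  qed
  have "(\<lambda>n. - ((2 + \<tau> n) * (M z)\<^sup>2)) \<longlonglongrightarrow> - ((2 + 0) * (M z)\<^sup>2)"
    by (intro tendsto_intros tau_tendsto)
  then show ?thesis
    using Lim_transform_eventually[OF _ ev] \<open>N z < 1\<close> by (simp add: sublevel_def)
qed

definition tangent :: "complex \<Rightarrow> real" where
  "tangent z = sqrt ((1 / \<rho>)\<^sup>2 - (M z)\<^sup>2)"

lemma tangent_nonneg: "0 \<le> tangent z" 
proof -
  have "(M z)\<^sup>2 \<le> (1 / \<rho>)\<^sup>2" by (intro power_mono M_bounds)
  then show ?thesis by (simp add: tangent_def)
qed

lemma tangent_le: "tangent z \<le> 1 / \<rho>"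
  unfolding tangent_def using rho_pos by (intro real_le_lsqrt) auto

lemma tangent_measurable [measurable]: "tangent \<in> borel_measurable borel"
  unfolding tangent_def by measurable

text \<open>The slope c is chosen for the given z and e, so the index from which the bound holds
  depends on z. The pointwise statement is enough for dominated convergence.\<close>

lemma angular_quot_le:
  assumes "N z \<noteq> 1" "e > 0"
  shows "eventually (\<lambda>n. \<bar>quot \<i> n z\<bar> \<le> 2 * M z * tangent z * indicator (sublevel 1) z + e) sequentially"
proof (cases "N z > 1 \<or> z = 0")
  case True
  have "eventually (\<lambda>n. quot \<i> n z = 0) sequentially"
    using True quot_outside by (auto simp: quot_def)
  then show ?thesis
    by eventually_elim (use assms M_bounds[of z] tangent_nonneg[of z] in auto)
next
  case False
  \<comment> \<open>The error of the slope is multiplied by 2M; the added 1 makes 2M e' strictly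
    smaller than e, also for M = 0.\<close>
  define e' where "e' = e / (2 * M z + 1)"
  have e': "e' > 0" using assms M_bounds[of z] by (simp add: e'_def)
  obtain c where c: "c \<ge> 0" "1 / \<rho> * sqrt (1 + c\<^sup>2) - c * M z \<le> tangent z + e'"
    using exists_tangent_slope[OF M_bounds e'] rho_pos unfolding tangent_def by auto
  define s where "s n = 1 / \<rho> * sqrt (1 + c\<^sup>2) - c * M z + 2 * c * \<tau> n / \<rho>" for n
  have "(\<lambda>n. s n * (2 * M z + \<tau> n / \<rho>)) \<longlonglongrightarrow> (1 / \<rho> * sqrt (1 + c\<^sup>2) - c * M z + 2 * c * 0 / \<rho>) * (2 * M z + 0 / \<rho>)"
    unfolding s_def using rho_pos by (intro tendsto_intros tau_tendsto) auto
  moreover have "(1 / \<rho> * sqrt (1 + c\<^sup>2) - c * M z + 2 * c * 0 / \<rho>) * (2 * M z + 0 / \<rho>) < 2 * M z * tangent z + e"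
  proof -
    have "(1 / \<rho> * sqrt (1 + c\<^sup>2) - c * M z) * (2 * M z) \<le> (tangent z + e') * (2 * M z)"
      using c M_bounds[of z] by (intro mult_right_mono) auto
    moreover have "e' * (2 * M z) < e"
      using assms M_bounds[of z] by (simp add: e'_def field_simps)
    ultimately show ?thesis by (simp add: algebra_simps)
  qed
  ultimately have ev1: "eventually (\<lambda>n. s n * (2 * M z + \<tau> n / \<rho>) < 2 * M z * tangent z + e) sequentially"
    by (rule order_tendstoD(2))
  have "(\<lambda>n. c * \<tau> n) \<longlonglongrightarrow> c * 0" by (intro tendsto_intros tau_tendsto)
  then have ev2: "eventually (\<lambda>n. c * \<tau> n < 1) sequentially"
    by (rule order_tendstoD(2)) auto
  from ev1 ev2 show ?thesis
  proof eventually_elim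
    case (elim n)
    let ?d = "\<bar>N ((1 + \<i> * of_real (\<tau> n)) * z) - N z\<bar>"
    have nz: "norm z > 0" using False by simp
    have "?d \<le> \<tau> n * (sqrt (1 + c\<^sup>2) * norm z / \<rho> - c * N z + 2 * c * \<tau> n * norm z / \<rho>)"
      using elim tau_pos[of n] by (intro rotation_estimate c) auto
    also have "\<dots> = s n * (\<tau> n * norm z)"
      using nz rho_pos by (simp add: s_def M_def field_simps)
    finally have d1: "?d / (\<tau> n * norm z) \<le> s n"
      using nz tau_pos[of n] by (simp add: divide_le_eq)
    have d2: "?d / norm z \<le> \<tau> n / \<rho>"
      using N_mult_diff_le[of \<i> n z] nz rho_pos by (simp add: field_simps)
    have "s n \<ge> 0" using d1 tau_pos[of n] nz by (meson abs_ge_zero divide_nonneg_pos mult_pos_pos order_trans)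
    have "\<bar>quot \<i> n z\<bar> \<le> ?d / (\<tau> n * norm z) * (2 * M z + ?d / norm z)"
      using False by (intro quot_le) auto
    also have "\<dots> \<le> s n * (2 * M z + \<tau> n / \<rho>)"
      using d1 d2 M_bounds[of z] \<open>s n \<ge> 0\<close> by (intro mult_mono) auto
    also have "\<dots> \<le> 2 * M z * tangent z + e" using elim by simp
    finally show ?case using False assms by (simp add: sublevel_def)
  qed
qed

lemma integrable_bounded_on_ball:
  fixes f :: "complex \<Rightarrow> 'b::{banach,second_countable_topology}"
  assumes [measurable]: "f \<in> borel_measurable borel" and "\<And>z. norm (f z) \<le> C * indicator K z"
  shows "integrable lborel f"
proof (rule Bochner_Integration.integrable_bound)
  show "integrable lborel (\<lambda>z. C * indicator K z)"
    using compact_K emeasure_compact_finite[OF compact_K]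
    by (intro integrable_mult_right integrable_real_indicator) (auto simp: compact_imp_closed)
  show "AE z in lborel. norm (f z) \<le> norm (C * indicator K z)"
    by (rule AE_I2) (metis abs_ge_self assms(2) order_trans real_norm_def)
qed measurable

lemma Gt_bounded: "\<exists>B\<ge>0. \<forall>z\<in>K. norm (Gt z) \<le> B"
proof -
  obtain L where L: "L \<ge> 0" "\<forall>z\<in>K. norm (Gt z) \<le> L * norm z" using Gt_bound by blast
  show ?thesis
  proof (intro exI[of _ "L * (R * \<kappa>')"] conjI ballI)
    show "L * (R * \<kappa>') \<ge> 0" using L R_pos kappa' by simp
    fix z assume "z \<in> K"
    then have "norm z \<le> R * \<kappa>'" using K_ball by (auto simp: ball_R_def)
    then have "L * norm z \<le> L * (R * \<kappa>')" using L by (intro mult_left_mono)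
    then show "norm (Gt z) \<le> L * (R * \<kappa>')" using L \<open>z \<in> K\<close> by fastforce
  qed
qed

lemma quot_limit: 
  assumes "norm \<zeta> = 1"
  shows "(\<lambda>n. LINT z|lborel. quot \<zeta> n z *\<^sub>R Gt z) \<longlonglongrightarrow> - \<zeta> * flux"
  using quotient_tendsto[OF assms] by (simp only: quot_def)

text \<open>The limit in the direction 1 is evaluated twice, once through the substitution and once
  pointwise.\<close>

lemma flux_eq: "flux = (LINT z|lborel. (2 * (M z)\<^sup>2 * indicator (sublevel 1) z) *\<^sub>R Gt z)"
proof -
  obtain B where B: "B \<ge> 0" "\<And>z. z \<in> K \<Longrightarrow> norm (Gt z) \<le> B" using Gt_bounded by blast
  have bd: "norm (quot 1 n z *\<^sub>R Gt z) \<le> (3 / \<rho>\<^sup>2 * B) * indicator K z" for n z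
  proof -
    have "\<bar>quot 1 n z\<bar> * norm (Gt z) \<le> (3 / \<rho>\<^sup>2 * indicator K z) * norm (Gt z)"
      using quot_bound[of 1 n z] by (intro mult_right_mono) auto
    also have "\<dots> \<le> (3 / \<rho>\<^sup>2 * B) * indicator K z"
      using B rho_pos by (auto simp: indicator_def intro!: divide_right_mono)
    finally show ?thesis by simp
  qed
  have "(\<lambda>n. LINT z|lborel. quot 1 n z *\<^sub>R Gt z)
     \<longlonglongrightarrow> (LINT z|lborel. (- 2 * (M z)\<^sup>2 * indicator (sublevel 1) z) *\<^sub>R Gt z)"
  proof (rule integral_dominated_convergence[where w="\<lambda>z. (3 / \<rho>\<^sup>2 * B) * indicator K z"])
    have [measurable]: "K \<in> sets borel" by (simp add: compact_K compact_imp_closed)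
    show "integrable lborel (\<lambda>z. (3 / \<rho>\<^sup>2 * B) * indicator K z)"
      using B by (intro integrable_bounded_on_ball[where C="3 / \<rho>\<^sup>2 * B"]) (auto simp: indicator_def)
    show "AE z in lborel. (\<lambda>n. quot 1 n z *\<^sub>R Gt z) \<longlonglongrightarrow> (- 2 * (M z)\<^sup>2 * indicator (sublevel 1) z) *\<^sub>R Gt z"
      using AE_N_neq[OF zero_less_one]
      by eventually_elim (intro tendsto_scaleR tendsto_const radial_quot_tendsto)
    show "AE z in lborel. norm (quot 1 n z *\<^sub>R Gt z) \<le> (3 / \<rho>\<^sup>2 * B) * indicator K z" for n
      using bd by (intro AE_I2)
  qed measurable
  from LIMSEQ_unique[OF this quot_limit] 
  have "- flux = (LINT z|lborel. - ((2 * (M z)\<^sup>2 * indicator (sublevel 1) z) *\<^sub>R Gt z))"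
    by simp
  then show ?thesis by simp
qed

text \<open>In the direction \<i> the integrals tend to -\<i> \<open>flux\<close>, and minus the
  imaginary part of this is Re \<open>flux\<close>. That is why only Im (Gt z) meets the angular
  quotient, for which an upper bound on the absolute value is all that is known.\<close>

lemma Re_flux_le:
  "Re flux \<le> (LINT z|lborel. (2 * M z * tangent z * indicator (sublevel 1) z) * \<bar>Im (Gt z)\<bar>)"
proof -
  obtain B where B: "B \<ge> 0" "\<And>z. z \<in> K \<Longrightarrow> norm (Gt z) \<le> B" using Gt_bounded by blast
  have [measurable]: "K \<in> sets borel" by (simp add: compact_K compact_imp_closed)
  define f where "f n z = - (quot \<i> n z * Im (Gt z))" for n z
  define b where "b z = (2 * M z * tangent z * indicator (sublevel 1) z) * \<bar>Im (Gt z)\<bar>" for z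
  have [measurable]: "f n \<in> borel_measurable borel" "b \<in> borel_measurable borel" for n
    unfolding f_def b_def by measurable
  have ImB: "\<bar>Im (Gt z)\<bar> \<le> B" if "z \<in> K" for z
    using B(2)[OF that] abs_Im_le_cmod order_trans by blast
  have bd1: "\<bar>f n z\<bar> \<le> (3 / \<rho>\<^sup>2 * B) * indicator K z" for n z
  proof -
    have "\<bar>f n z\<bar> \<le> (3 / \<rho>\<^sup>2 * indicator K z) * \<bar>Im (Gt z)\<bar>"
      unfolding f_def abs_minus_cancel abs_mult by (intro mult_right_mono quot_bound) auto
    also have "\<dots> \<le> (3 / \<rho>\<^sup>2 * B) * indicator K z"
      using ImB[of z] rho_pos by (auto simp: indicator_def intro!: divide_right_mono)
    finally show ?thesis .
  qed
  have bd2: "\<bar>b z\<bar> \<le> (3 / \<rho>\<^sup>2 * B) * indicator K z" for z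
  proof (cases "z \<in> sublevel 1")
    case True
    then have zK: "z \<in> K" using one_in_K by (auto simp: sublevel_def)
    have "M z * tangent z \<le> 1 / \<rho> * (1 / \<rho>)"
      using M_bounds[of z] tangent_nonneg[of z] tangent_le[of z] rho_pos by (intro mult_mono) auto
    then have "2 * M z * tangent z \<le> 3 / \<rho>\<^sup>2"
      using rho_pos by (simp add: power2_eq_square field_simps)
    then have "2 * M z * tangent z * \<bar>Im (Gt z)\<bar> \<le> 3 / \<rho>\<^sup>2 * B"
      using ImB[OF zK] B(1) rho_pos by (intro mult_mono) auto
    then show ?thesis using True zK M_bounds[of z] tangent_nonneg[of z] by (simp add: b_def abs_mult)
  next
    case False then show ?thesis using B(1) by (simp add: b_def)
  qed
  have int_K: "integrable lborel (\<lambda>z. (3 / \<rho>\<^sup>2 * B) * indicator K z)"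
    using B by (intro integrable_bounded_on_ball[where C="3 / \<rho>\<^sup>2 * B"]) (auto simp: indicator_def)
  have int_f: "integrable lborel (f n)" for n
    using bd1 by (intro integrable_bounded_on_ball[where C="3 / \<rho>\<^sup>2 * B"]) auto
  have int_max: "integrable lborel (\<lambda>z. max (f n z) (b z))" for n
    using bd1[of n] bd2 by (intro integrable_bounded_on_ball[where C="3 / \<rho>\<^sup>2 * B"]) (auto simp: max_def)
  have lim1: "(\<lambda>n. LINT z|lborel. f n z) \<longlonglongrightarrow> Re flux"
  proof -
    have "(\<lambda>n. - Im (LINT z|lborel. quot \<i> n z *\<^sub>R Gt z)) \<longlonglongrightarrow> - Im (- \<i> * flux)"
      by (intro tendsto_minus tendsto_Im quot_limit) auto
    moreover have "- Im (LINT z|lborel. quot \<i> n z *\<^sub>R Gt z) = (LINT z|lborel. f n z)" for n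
    proof -
      have "norm (quot \<i> n z *\<^sub>R Gt z) \<le> (3 / \<rho>\<^sup>2 * B) * indicator K z" for z
      proof -
        have "\<bar>quot \<i> n z\<bar> * norm (Gt z) \<le> (3 / \<rho>\<^sup>2 * indicator K z) * norm (Gt z)"
          using quot_bound[of \<i> n z] by (intro mult_right_mono) auto
        also have "\<dots> \<le> (3 / \<rho>\<^sup>2 * B) * indicator K z"
          using B rho_pos by (auto simp: indicator_def intro!: divide_right_mono)
        finally show ?thesis by simp
      qed
      then have "integrable lborel (\<lambda>z. quot \<i> n z *\<^sub>R Gt z)"
        by (intro integrable_bounded_on_ball[where C="3 / \<rho>\<^sup>2 * B"]) auto
      from integral_Im[OF this] show ?thesis by (simp add: f_def)
    qed
    ultimately show ?thesis by simp
  qed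
  \<comment> \<open>\<open>f n\<close> need not converge, but its maximum with the asymptotic bound
    \<open>b\<close> converges to \<open>b\<close>, is dominated, and lies above
    \<open>f n\<close>.\<close>
  have lim2: "(\<lambda>n. LINT z|lborel. max (f n z) (b z)) \<longlonglongrightarrow> (LINT z|lborel. b z)"
  proof (rule integral_dominated_convergence[OF _ _ int_K])
    show "AE z in lborel. norm (max (f n z) (b z)) \<le> (3 / \<rho>\<^sup>2 * B) * indicator K z" for n
      using bd1[of n] bd2 by (intro AE_I2) (auto simp: max_def)
    show "AE z in lborel. (\<lambda>n. max (f n z) (b z)) \<longlonglongrightarrow> b z"
      using AE_N_neq[OF zero_less_one]
    proof eventually_elim
      case (elim z)
      show ?case
      proof (rule LIMSEQ_I)
        fix r :: real assume "r > 0"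
        define e where "e = r / (\<bar>Im (Gt z)\<bar> + 1) / 2"
        have "e > 0" using \<open>r > 0\<close> by (simp add: e_def add_nonneg_pos)
        have er: "e * \<bar>Im (Gt z)\<bar> < r"
          using \<open>r > 0\<close> unfolding e_def by (simp add: divide_simps add_nonneg_pos)
        from angular_quot_le[OF elim \<open>e > 0\<close>] obtain n0 where n0:
          "\<And>n. n \<ge> n0 \<Longrightarrow> \<bar>quot \<i> n z\<bar> \<le> 2 * M z * tangent z * indicator (sublevel 1) z + e"
          by (auto simp: eventually_sequentially)
        have "norm (max (f n z) (b z) - b z) < r" if "n \<ge> n0" for n
        proof -
          have "f n z \<le> \<bar>quot \<i> n z\<bar> * \<bar>Im (Gt z)\<bar>" unfolding f_def by (metis abs_ge_self abs_minus_cancel abs_mult)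
          also have "\<dots> \<le> (2 * M z * tangent z * indicator (sublevel 1) z + e) * \<bar>Im (Gt z)\<bar>"
            using n0[OF that] by (intro mult_right_mono) auto
          also have "\<dots> = b z + e * \<bar>Im (Gt z)\<bar>" by (simp add: b_def algebra_simps)
          finally show ?thesis using er \<open>r > 0\<close> by (auto simp: max_def)
        qed
        then show "\<exists>no. \<forall>n\<ge>no. norm (max (f n z) (b z) - b z) < r" by blast
      qed
    qed
  qed measurable
  have "Re flux \<le> (LINT z|lborel. b z)"
  proof (rule LIMSEQ_le[OF lim1 lim2])
    show "\<exists>N. \<forall>n\<ge>N. (LINT z|lborel. f n z) \<le> (LINT z|lborel. max (f n z) (b z))"
      by (intro exI allI impI integral_mono int_f int_max) auto
  qed
  then show ?thesis by (simp add: b_def)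
qed

end

subsection \<open>Friedrichs' inequality for holomorphic functions\<close>

text \<open>For 0 < \<rho> \<le> R this is (R/\<rho> + sqrt (R^2/\<rho>^2 - 1))^2: it depends on the
  ratio only and equals 1 for \<rho> = R.\<close>

definition friedrichs_bound :: "real \<Rightarrow> real \<Rightarrow> real" where
  "friedrichs_bound \<rho> R = (1 + sqrt (1 - \<rho>\<^sup>2 / R\<^sup>2)) / (1 - sqrt (1 - \<rho>\<^sup>2 / R\<^sup>2))"

text \<open>
  The scaling \<open>\<alpha>\<close>, due to Horgan and Payne, is the one for which the discriminant
  condition reduces to \<open>1 / R\<^sup>2 \<le> M\<^sup>2\<close>.
\<close>

lemma friedrichs_quadratic_form:
  fixes \<rho> R M h g :: real
  defines "k \<equiv> sqrt (1 - \<rho>\<^sup>2 / R\<^sup>2)"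
  defines "\<alpha> \<equiv> 1 / (R\<^sup>2 * (1 + k))"
  assumes "0 < \<rho>" "\<rho> \<le> R" "1 / R \<le> M" "M \<le> 1 / \<rho>"
  shows "\<alpha> * (h\<^sup>2 - friedrichs_bound \<rho> R * g\<^sup>2)
     \<le> M\<^sup>2 * (h\<^sup>2 - g\<^sup>2) - 2 * M * sqrt ((1 / \<rho>)\<^sup>2 - M\<^sup>2) * \<bar>h * g\<bar>"
proof -
  have R: "R > 0" using assms by simp
  have M0: "M > 0" using assms R by (meson divide_pos_pos less_le_trans zero_less_one)
  have q1: "\<rho>\<^sup>2 / R\<^sup>2 \<le> 1" "\<rho>\<^sup>2 / R\<^sup>2 > 0"
    using assms R by (simp_all add: power_mono)
  have k: "0 \<le> k" "k < 1" "k\<^sup>2 = 1 - \<rho>\<^sup>2 / R\<^sup>2"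
    using q1 by (auto simp: k_def)
  define a where "a = 1 / R\<^sup>2"
  have a: "a > 0" using R by (simp add: a_def)
  have rho: "(1 / \<rho>)\<^sup>2 * ((1 + k) * (1 - k)) = a"
  proof -
    have "(1 + k) * (1 - k) = \<rho>\<^sup>2 / R\<^sup>2" using k(3) by (simp add: power2_eq_square algebra_simps)
    then show ?thesis using assms by (simp add: a_def power_divide)
  qed
  \<comment> \<open>The coefficient of g^2. As \<alpha> = (1 - k)/\<rho>^2 and \<beta> = (1 +
    k)/\<rho>^2, the two coefficients enclose M^2 and the square roots below have nonnegative
    arguments.\<close>
  define \<beta> where "\<beta> = a / (1 - k)"
  have al: "\<alpha> = a / (1 + k)" by (simp add: \<alpha>_def a_def)
  have be: "\<alpha> * friedrichs_bound \<rho> R = \<beta>"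
    using k by (simp add: al \<beta>_def friedrichs_bound_def k_def[symmetric])
  have M1: "a \<le> M\<^sup>2" using power_mono[OF assms(5), of 2] R by (simp add: a_def power_divide)
  have M2: "M\<^sup>2 \<le> (1 / \<rho>)\<^sup>2" using M0 assms(6) by (intro power_mono) auto
  have A: "\<alpha> \<le> M\<^sup>2"
  proof -
    have "\<alpha> \<le> a / 1" unfolding al using a k by (intro divide_left_mono) auto
    then show ?thesis using M1 by simp
  qed
  have C: "M\<^sup>2 \<le> \<beta>"
  proof -
    have "\<beta> = (1 / \<rho>)\<^sup>2 * (1 + k)" unfolding \<beta>_def rho[symmetric] using k by simp
    moreover have "(1 / \<rho>)\<^sup>2 * 1 \<le> (1 / \<rho>)\<^sup>2 * (1 + k)" using k by (intro mult_left_mono) auto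
    ultimately show ?thesis using M2 by simp
  qed
  \<comment> \<open>With \<alpha> + \<beta> = 2/\<rho>^2 and \<alpha>\<beta> = 1/(R^2 \<rho>^2) the
    right side minus the left side is (M^2 - 1/R^2)/\<rho>^2.\<close>
  have disc: "M\<^sup>2 * ((1 / \<rho>)\<^sup>2 - M\<^sup>2) \<le> (M\<^sup>2 - \<alpha>) * (\<beta> - M\<^sup>2)"
  proof -
    have s: "\<alpha> + \<beta> = 2 * (1 / \<rho>)\<^sup>2"
    proof -
      have "\<alpha> = (1 / \<rho>)\<^sup>2 * (1 - k)" "\<beta> = (1 / \<rho>)\<^sup>2 * (1 + k)"
        unfolding al \<beta>_def rho[symmetric] using k by simp_all
      then show ?thesis by (simp add: algebra_simps)
    qed
    have p: "\<alpha> * \<beta> = a * (1 / \<rho>)\<^sup>2"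
      unfolding al \<beta>_def by (subst (2) rho[symmetric]) (use k in simp)
    have "a * (1 / \<rho>)\<^sup>2 \<le> M\<^sup>2 * (1 / \<rho>)\<^sup>2" using M1 by (intro mult_right_mono) auto
    moreover have "(M\<^sup>2 - \<alpha>) * (\<beta> - M\<^sup>2) = M\<^sup>2 * (\<alpha> + \<beta>) - \<alpha> * \<beta> - M\<^sup>2 * M\<^sup>2" by (simp add: algebra_simps)
    ultimately show ?thesis unfolding s p by (simp add: algebra_simps)
  qed
  have "M * sqrt ((1 / \<rho>)\<^sup>2 - M\<^sup>2) = sqrt (M\<^sup>2 * ((1 / \<rho>)\<^sup>2 - M\<^sup>2))"
    using M0 by (simp add: real_sqrt_mult)
  also have "\<dots> \<le> sqrt (M\<^sup>2 - \<alpha>) * sqrt (\<beta> - M\<^sup>2)"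
    using disc by (simp add: real_sqrt_mult[symmetric])
  finally have B: "M * sqrt ((1 / \<rho>)\<^sup>2 - M\<^sup>2) \<le> sqrt (M\<^sup>2 - \<alpha>) * sqrt (\<beta> - M\<^sup>2)" .
  have "2 * (M * sqrt ((1 / \<rho>)\<^sup>2 - M\<^sup>2)) * \<bar>h * g\<bar> \<le> 2 * (sqrt (M\<^sup>2 - \<alpha>) * sqrt (\<beta> - M\<^sup>2)) * \<bar>h * g\<bar>"
    using B by (intro mult_right_mono mult_left_mono) auto
  also have "\<dots> \<le> (M\<^sup>2 - \<alpha>) * h\<^sup>2 + (\<beta> - M\<^sup>2) * g\<^sup>2"
  proof -
    have "0 \<le> (sqrt (M\<^sup>2 - \<alpha>) * \<bar>h\<bar> - sqrt (\<beta> - M\<^sup>2) * \<bar>g\<bar>)\<^sup>2" by simp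
    also have "\<dots> = (sqrt (M\<^sup>2 - \<alpha>))\<^sup>2 * h\<^sup>2 + (sqrt (\<beta> - M\<^sup>2))\<^sup>2 * g\<^sup>2
        - 2 * (sqrt (M\<^sup>2 - \<alpha>) * sqrt (\<beta> - M\<^sup>2)) * \<bar>h * g\<bar>"
      by (simp add: power2_diff power_mult_distrib abs_mult)
    finally show ?thesis using A C by simp
  qed
  finally have le: "2 * (M * sqrt ((1 / \<rho>)\<^sup>2 - M\<^sup>2)) * \<bar>h * g\<bar> \<le> (M\<^sup>2 - \<alpha>) * h\<^sup>2 + (\<beta> - M\<^sup>2) * g\<^sup>2" .
  have eq: "\<alpha> * (h\<^sup>2 - friedrichs_bound \<rho> R * g\<^sup>2) = \<alpha> * h\<^sup>2 - \<beta> * g\<^sup>2"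
    by (simp add: be[symmetric] algebra_simps)
  show ?thesis unfolding eq using le by (simp add: algebra_simps)
qed

section \<open>Friedrichs' inequality on the unit sublevel set\<close>

context gauge_function
begin

lemma friedrichs_bound_pos: "friedrichs_bound \<rho> R > 0"
proof -
  have "\<rho>\<^sup>2 / R\<^sup>2 \<le> 1" "\<rho>\<^sup>2 / R\<^sup>2 > 0"
    using rho_pos rho_le_R R_pos by (simp_all add: power_mono)
  then have "0 \<le> sqrt (1 - \<rho>\<^sup>2 / R\<^sup>2)" "sqrt (1 - \<rho>\<^sup>2 / R\<^sup>2) < 1" by auto
  then show ?thesis unfolding friedrichs_bound_def by (intro divide_pos_pos) linarith+
qed

text \<open>The two evaluations of the flux bound an integral of M^2 (h^2 - g^2) by one of M |hg|
  times the tangential root. The quadratic form estimate under the integral sign turns this into an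
  inequality between the plain squared norms.\<close>

theorem friedrichs_holomorphic:
  assumes "\<kappa> > 1" and holF: "F holomorphic_on {z. N z < \<kappa>}"
  shows "(LINT z|lborel. indicator (sublevel 1) z * (Re (F z) - Re (F 0))\<^sup>2)
      \<le> friedrichs_bound \<rho> R * (LINT z|lborel. indicator (sublevel 1) z * (Im (F z))\<^sup>2)"
proof -
  \<comment> \<open>Only the real constant Re F(0) is removed, which normalises h(0) = 0. Then G(0)
    = -(Im F(0))^2 is real and nonpositive.\<close>
  define G where "G z = (F z - of_real (Re (F 0)))\<^sup>2" for z
  have holG: "G holomorphic_on {z. N z < \<kappa>}"
    unfolding G_def by (intro holomorphic_intros holF)
  interpret star_flow N \<rho> R G \<kappa>
    by unfold_locales (use assms holG in auto)
  have [measurable]: "K \<in> sets borel" by (simp add: compact_K compact_imp_closed)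
  define h where "h z = Re (F z) - Re (F 0)" for z
  define g where "g z = Im (F z)" for z
  define \<alpha> where "\<alpha> = 1 / (R\<^sup>2 * (1 + sqrt (1 - \<rho>\<^sup>2 / R\<^sup>2)))"
  have alpha: "\<alpha> > 0"
  proof -
    have "\<rho>\<^sup>2 / R\<^sup>2 \<le> 1" using rho_pos rho_le_R R_pos by (simp add: power_mono)
    then show ?thesis using R_pos unfolding \<alpha>_def by (intro divide_pos_pos mult_pos_pos add_pos_nonneg) auto
  qed
  have contF: "continuous_on (sublevel \<kappa>) F"
    using holF by (simp add: holomorphic_on_imp_continuous_on sublevel_def)
  have sub: "sublevel 1 \<subseteq> sublevel \<kappa>" using \<open>\<kappa> > 1\<close> by (auto simp: sublevel_def)
  have subK: "sublevel 1 \<subseteq> K" using one_in_K by (auto simp: sublevel_def)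
  have conth: "continuous_on (sublevel \<kappa>) h" and contg: "continuous_on (sublevel \<kappa>) g"
    unfolding h_def g_def by (intro continuous_intros contF)+
  have bdd: "\<exists>B. \<forall>z\<in>K. \<bar>f z\<bar> \<le> B" if "continuous_on (sublevel \<kappa>) f" for f :: "complex \<Rightarrow> real"
  proof -
    have "compact (f ` K)"
      using compact_K continuous_on_subset[OF that K_sub] by (rule compact_continuous_image[rotated])
    then show ?thesis using compact_imp_bounded[of "f ` K"] unfolding bounded_iff by auto
  qed
  have int: "integrable lborel (\<lambda>z. indicator (sublevel 1) z * f z)" 
    if c: "continuous_on (sublevel \<kappa>) f" for f :: "complex \<Rightarrow> real"
  proof -
    obtain B where B: "\<forall>z\<in>K. \<bar>f z\<bar> \<le> B" using bdd[OF c] by blast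
    have "B \<ge> 0" using B one_in_K[of 0] by force
    have m: "(\<lambda>z. indicator (sublevel 1) z *\<^sub>R f z) \<in> borel_measurable borel"
      by (intro borel_measurable_continuous_on_indicator continuous_on_subset[OF c sub]) measurable
    show ?thesis
    proof (rule integrable_bounded_on_ball[where C=B])
      show "(\<lambda>z. indicator (sublevel 1) z * f z) \<in> borel_measurable borel" using m by simp
      show "norm (indicator (sublevel 1) z * f z) \<le> B * indicator K z" for z
        using B subK \<open>B \<ge> 0\<close> by (auto simp: indicator_def)
    qed
  qed
  have ih: "integrable lborel (\<lambda>z. indicator (sublevel 1) z * (h z)\<^sup>2)"
    and ig: "integrable lborel (\<lambda>z. indicator (sublevel 1) z * (g z)\<^sup>2)"
    by (intro int continuous_intros conth contg)+
  have Gt: "Re (Gt z) = (h z)\<^sup>2 - (g z)\<^sup>2 + (g 0)\<^sup>2" "Im (Gt z) = 2 * (h z * g z)" if "z \<in> sublevel 1" for z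
    using that sub by (auto simp: Gt_def G_def h_def g_def power2_eq_square algebra_simps)
  obtain B where B: "B \<ge> 0" "\<forall>z\<in>K. norm (Gt z) \<le> B" using Gt_bounded by blast
  have mk: "norm (c *\<^sub>R Gt z) \<le> (2 / \<rho>\<^sup>2 * B) * indicator K z"
    if "\<bar>c\<bar> \<le> 2 * (1 / \<rho> * (1 / \<rho>)) * indicator (sublevel 1) z" for c z
  proof (cases "z \<in> sublevel 1")
    case True
    then have "\<bar>c\<bar> * norm (Gt z) \<le> (2 / \<rho>\<^sup>2) * B"
      using that B subK rho_pos by (intro mult_mono) (auto simp: power2_eq_square)
    then show ?thesis using True subK by auto
  qed (use that B in auto)
  define c1 where "c1 z = 2 * (M z)\<^sup>2 * indicator (sublevel 1) z" for z
  define c2 where "c2 z = 2 * M z * tangent z * indicator (sublevel 1) z" for z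
  have [measurable]: "c1 \<in> borel_measurable borel" "c2 \<in> borel_measurable borel"
    unfolding c1_def c2_def by measurable
  have b1: "\<bar>c1 z\<bar> \<le> 2 * (1 / \<rho> * (1 / \<rho>)) * indicator (sublevel 1) z" for z
  proof -
    have "M z * M z \<le> 1 / \<rho> * (1 / \<rho>)" using M_bounds[of z] rho_pos by (intro mult_mono) auto
    then show ?thesis using M_bounds[of z] by (auto simp: c1_def indicator_def power2_eq_square)
  qed
  have b2: "\<bar>c2 z\<bar> \<le> 2 * (1 / \<rho> * (1 / \<rho>)) * indicator (sublevel 1) z" for z
  proof -
    have "M z * tangent z \<le> 1 / \<rho> * (1 / \<rho>)"
      using M_bounds[of z] tangent_nonneg[of z] tangent_le[of z] rho_pos by (intro mult_mono) auto
    then show ?thesis using M_bounds[of z] tangent_nonneg[of z] by (auto simp: c2_def indicator_def)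
  qed
  have i1: "integrable lborel (\<lambda>z. c1 z *\<^sub>R Gt z)" "integrable lborel (\<lambda>z. c2 z *\<^sub>R Gt z)"
    using mk[OF b1] mk[OF b2] by (auto intro!: integrable_bounded_on_ball[where C="2 / \<rho>\<^sup>2 * B"])
  have iR: "integrable lborel (\<lambda>z. c1 z * Re (Gt z))"
    using integrable_Re[OF i1(1)] by simp
  have iI: "integrable lborel (\<lambda>z. c2 z * \<bar>Im (Gt z)\<bar>)"
  proof -
    have "integrable lborel (\<lambda>z. \<bar>c2 z * Im (Gt z)\<bar>)"
      using integrable_Im[OF i1(2)] by (intro integrable_abs) simp
    moreover have "\<bar>c2 z * Im (Gt z)\<bar> = c2 z * \<bar>Im (Gt z)\<bar>" for z
      using M_bounds[of z] tangent_nonneg[of z] by (simp add: abs_mult c2_def)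
    ultimately show ?thesis by simp
  qed
  have "(LINT z|lborel. c1 z * Re (Gt z)) = Re flux"
    unfolding flux_eq c1_def[symmetric] using integral_Re[OF i1(1)] by simp
  also have "\<dots> \<le> (LINT z|lborel. c2 z * \<bar>Im (Gt z)\<bar>)"
    using Re_flux_le by (simp add: c2_def)
  finally have "0 \<le> (LINT z|lborel. c2 z * \<bar>Im (Gt z)\<bar> - c1 z * Re (Gt z))"
    using iR iI by simp
  also have "\<dots> \<le> (LINT z|lborel. 2 * \<alpha> * (friedrichs_bound \<rho> R * (indicator (sublevel 1) z * (g z)\<^sup>2)
       - indicator (sublevel 1) z * (h z)\<^sup>2))"
  proof (rule integral_mono_AE)
    show "AE z in lborel. c2 z * \<bar>Im (Gt z)\<bar> - c1 z * Re (Gt z)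
       \<le> 2 * \<alpha> * (friedrichs_bound \<rho> R * (indicator (sublevel 1) z * (g z)\<^sup>2) - indicator (sublevel 1) z * (h z)\<^sup>2)"
      using AE_lborel_singleton[of 0]
    proof eventually_elim
      case (elim z)
      show ?case
      proof (cases "z \<in> sublevel 1")
        case True
        have "1 / R \<le> M z" using N_lower[of z] elim R_pos by (simp add: M_def field_simps)
        then have "\<alpha> * ((h z)\<^sup>2 - friedrichs_bound \<rho> R * (g z)\<^sup>2)
           \<le> (M z)\<^sup>2 * ((h z)\<^sup>2 - (g z)\<^sup>2) - 2 * M z * sqrt ((1 / \<rho>)\<^sup>2 - (M z)\<^sup>2) * \<bar>h z * g z\<bar>"
          unfolding \<alpha>_def by (intro friedrichs_quadratic_form rho_pos rho_le_R M_bounds)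
        \<comment> \<open>Subtracting G(0) has added (g 0)^2 to the real part of \<open>Gt\<close>;
          being nonnegative, it only enlarges this side.\<close>
        also have "\<dots> \<le> (M z)\<^sup>2 * ((h z)\<^sup>2 - (g z)\<^sup>2 + (g 0)\<^sup>2) - 2 * M z * tangent z * \<bar>h z * g z\<bar>"
          unfolding tangent_def by (intro diff_right_mono mult_left_mono) auto
        finally have "2 * (2 * M z * tangent z * \<bar>h z * g z\<bar> - (M z)\<^sup>2 * ((h z)\<^sup>2 - (g z)\<^sup>2 + (g 0)\<^sup>2))
          \<le> 2 * (\<alpha> * (friedrichs_bound \<rho> R * (g z)\<^sup>2 - (h z)\<^sup>2))"
          by (simp add: algebra_simps)
        then show ?thesis
          unfolding Gt[OF True] using True by (simp add: c1_def c2_def abs_mult algebra_simps)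
      qed (simp add: c1_def c2_def)
    qed
  qed (use ih ig iR iI in auto)
  also have "\<dots> = 2 * \<alpha> * (friedrichs_bound \<rho> R * (LINT z|lborel. indicator (sublevel 1) z * (g z)\<^sup>2)
     - (LINT z|lborel. indicator (sublevel 1) z * (h z)\<^sup>2))"
    using ih ig by simp
  finally show ?thesis using alpha by (simp add: zero_le_mult_iff h_def g_def)
qed

end

subsection \<open>Projections in spaces of square integrable functions\<close>

text \<open>Values in a Euclidean space let one theory serve scalar functions and the 2 by 2 matrix
  fields of gradients. The elements are functions, not classes, so null sets are dealt with where
  they occur.\<close>

definition square_integrable :: "'a measure \<Rightarrow> ('a \<Rightarrow> 'b::euclidean_space) \<Rightarrow> bool" where
  "square_integrable M f \<longleftrightarrow> f \<in> borel_measurable M \<and> integrable M (\<lambda>x. (norm (f x))\<^sup>2)"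

definition sq_norm :: "'a measure \<Rightarrow> ('a \<Rightarrow> 'b::euclidean_space) \<Rightarrow> real" where
  "sq_norm M f = (LINT x|M. (norm (f x))\<^sup>2)"

definition sq_inner :: "'a measure \<Rightarrow> ('a \<Rightarrow> 'b::euclidean_space) \<Rightarrow> ('a \<Rightarrow> 'b) \<Rightarrow> real" where
  "sq_inner M f g = (LINT x|M. f x \<bullet> g x)"

lemma square_integrable_inner:
  assumes "square_integrable M f" "square_integrable M g"
  shows "integrable M (\<lambda>x. f x \<bullet> g x)"
proof (rule Bochner_Integration.integrable_bound)
  show "integrable M (\<lambda>x. (norm (f x))\<^sup>2 + (norm (g x))\<^sup>2)"
    using assms by (simp add: square_integrable_def)
  show "(\<lambda>x. f x \<bullet> g x) \<in> borel_measurable M" using assms by (auto simp: square_integrable_def)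
  show "AE x in M. norm (f x \<bullet> g x) \<le> norm ((norm (f x))\<^sup>2 + (norm (g x))\<^sup>2)"
  proof (rule AE_I2)
    fix x
    have "\<bar>f x \<bullet> g x\<bar> \<le> norm (f x) * norm (g x)" by (rule Cauchy_Schwarz_ineq2)
    also have "\<dots> \<le> (norm (f x))\<^sup>2 + (norm (g x))\<^sup>2"
      using sum_squares_bound[of "norm (f x)" "norm (g x)"]
        mult_nonneg_nonneg[OF norm_ge_zero norm_ge_zero, of "f x" "g x"] by linarith
    finally show "norm (f x \<bullet> g x) \<le> norm ((norm (f x))\<^sup>2 + (norm (g x))\<^sup>2)" by simp
  qed
qed

lemma square_integrable_add:
  assumes "square_integrable M f" "square_integrable M g"
  shows "square_integrable M (\<lambda>x. f x + g x)"
proof -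
  have "(norm (f x + g x))\<^sup>2 = (norm (f x))\<^sup>2 + (norm (g x))\<^sup>2 + 2 * (f x \<bullet> g x)" for x
    by (simp add: power2_norm_eq_inner inner_add inner_commute)
  then show ?thesis using assms square_integrable_inner[OF assms]
    by (auto simp: square_integrable_def intro: borel_measurable_add)
qed

lemma square_integrable_scale:
  "square_integrable M f \<Longrightarrow> square_integrable M (\<lambda>x. c *\<^sub>R f x)"
  by (auto simp: square_integrable_def power_mult_distrib intro: borel_measurable_scaleR)

lemma square_integrable_diff:
  assumes "square_integrable M f" "square_integrable M g"
  shows "square_integrable M (\<lambda>x. f x - g x)"
  using square_integrable_add[OF assms(1) square_integrable_scale[OF assms(2), of "-1"]] by simp

lemma sq_norm_nonneg [simp]: "0 \<le> sq_norm M f"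
  by (simp add: sq_norm_def)

lemma sq_norm_add:
  assumes "square_integrable M f" "square_integrable M g"
  shows "sq_norm M (\<lambda>x. f x + g x) = sq_norm M f + 2 * sq_inner M f g + sq_norm M g"
proof -
  have "(norm (f x + g x))\<^sup>2 = (norm (f x))\<^sup>2 + 2 * (f x \<bullet> g x) + (norm (g x))\<^sup>2" for x
    by (simp add: power2_norm_eq_inner inner_add inner_commute)
  then show ?thesis using assms square_integrable_inner[OF assms]
    by (simp add: square_integrable_def sq_norm_def sq_inner_def)
qed

lemma sq_norm_scale: "sq_norm M (\<lambda>x. c *\<^sub>R f x) = c\<^sup>2 * sq_norm M f"
  by (simp add: sq_norm_def power_mult_distrib)

lemma sq_norm_minus_commute: "sq_norm M (\<lambda>x. f x - g x) = sq_norm M (\<lambda>x. g x - f x)"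
  by (simp add: sq_norm_def norm_minus_commute)

lemma sq_inner_commute: "sq_inner M f g = sq_inner M g f"
  by (simp add: sq_inner_def inner_commute)

lemma sq_inner_scale: "sq_inner M f (\<lambda>x. c *\<^sub>R g x) = c * sq_inner M f g"
  by (simp add: sq_inner_def)

lemma sq_inner_self: "sq_inner M f f = sq_norm M f"
  by (simp add: sq_inner_def sq_norm_def power2_norm_eq_inner)

lemma sq_inner_diff_left:
  assumes "square_integrable M f" "square_integrable M g" "square_integrable M h"
  shows "sq_inner M (\<lambda>x. f x - g x) h = sq_inner M f h - sq_inner M g h"
  using square_integrable_inner[OF assms(1,3)] square_integrable_inner[OF assms(2,3)]
  by (simp add: sq_inner_def inner_diff_left)

lemma sq_norm_diff:
  assumes "square_integrable M f" "square_integrable M g"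
  shows "sq_norm M (\<lambda>x. f x - g x) = sq_norm M f - 2 * sq_inner M f g + sq_norm M g"
  using sq_norm_add[OF assms(1) square_integrable_scale[OF assms(2), of "-1"]]
  using sq_inner_scale[of M f "-1" g] sq_norm_scale[of M "-1" g] by simp

text \<open>The general case is behind Cauchy-Schwarz; the case A = 0 forces I = 0 and is the
  orthogonality criterion in \<open>square_integrable_projection\<close>.\<close>

lemma discriminant_le:
  fixes A B I :: real
  assumes nonneg: "\<And>t. 0 \<le> A + 2 * t * I + t\<^sup>2 * B"
  shows "I\<^sup>2 \<le> A * B"
proof (cases "B = 0")
  case True
  have "I = 0"
  proof (rule ccontr)
    assume "I \<noteq> 0"
    then have "2 * (- (A + 1) / (2 * I)) * I = - (A + 1)" by simp
    moreover have "0 \<le> A + 2 * (- (A + 1) / (2 * I)) * I"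
      using nonneg[of "- (A + 1) / (2 * I)"] by (simp only: True mult_zero_right add_0_right)
    ultimately show False by linarith
  qed
  then show ?thesis using True by simp
next
  case False
  show ?thesis
  proof (cases "B > 0")
    case True
    have "0 \<le> (A + 2 * (- I / B) * I + (- I / B)\<^sup>2 * B) * B"
      by (rule mult_nonneg_nonneg[OF nonneg]) (use True in simp)
    also have "\<dots> = A * B - I\<^sup>2" using True by (simp add: field_simps power2_eq_square)
    finally show ?thesis by simp
  next
    case neg: False
    with False have B: "B < 0" by simp
    \<comment> \<open>A negative leading coefficient contradicts the hypothesis: the values at s and
      -s add up to 2 (A - |A| + B) < 0.\<close>
    define s where "s = sqrt (\<bar>A\<bar> / (-B) + 1)"
    have s: "s\<^sup>2 = \<bar>A\<bar> / (-B) + 1" unfolding s_def using B by (intro real_sqrt_pow2) (simp add: divide_nonneg_pos)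
    have "s\<^sup>2 * B = - \<bar>A\<bar> + B" unfolding s using B by (simp add: field_simps)
    then have "2 * (A - \<bar>A\<bar> + B) \<ge> 0" using nonneg[of s] nonneg[of "-s"] by simp
    then show ?thesis using B by simp
  qed
qed

lemma sq_inner_Cauchy_Schwarz:
  assumes "square_integrable M f" "square_integrable M g"
  shows "\<bar>sq_inner M f g\<bar> \<le> sqrt (sq_norm M f) * sqrt (sq_norm M g)"
proof -
  have "(sq_inner M f g)\<^sup>2 \<le> sq_norm M f * sq_norm M g"
  proof (rule discriminant_le)
    fix t
    have "0 \<le> sq_norm M (\<lambda>x. f x + t *\<^sub>R g x)" by simp
    also have "\<dots> = sq_norm M f + 2 * t * sq_inner M f g + t\<^sup>2 * sq_norm M g"
      using sq_norm_add[OF assms(1) square_integrable_scale[OF assms(2)]]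
      by (simp add: sq_inner_scale sq_norm_scale)
    finally show "0 \<le> \<dots>" .
  qed
  then show ?thesis by (metis real_sqrt_abs real_sqrt_le_iff real_sqrt_mult)
qed

lemma sqrt_sq_norm_triangle:
  assumes "square_integrable M f" "square_integrable M g"
  shows "sqrt (sq_norm M (\<lambda>x. f x + g x)) \<le> sqrt (sq_norm M f) + sqrt (sq_norm M g)"
proof (rule real_le_lsqrt)
  show "sq_norm M (\<lambda>x. f x + g x) \<le> (sqrt (sq_norm M f) + sqrt (sq_norm M g))\<^sup>2"
    using sq_inner_Cauchy_Schwarz[OF assms] unfolding sq_norm_add[OF assms] power2_sum by simp
qed auto

lemma nn_integral_sq_norm:
  "square_integrable M f \<Longrightarrow> (\<integral>\<^sup>+x. ennreal ((norm (f x))\<^sup>2) \<partial>M) = ennreal (sq_norm M f)"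
  unfolding sq_norm_def by (rule nn_integral_eq_integral) (auto simp: square_integrable_def)

lemma square_integrableI_nn_integral:
  assumes "f \<in> borel_measurable M" "(\<integral>\<^sup>+x. ennreal ((norm (f x))\<^sup>2) \<partial>M) < \<infinity>"
  shows "square_integrable M f"
  using assms unfolding square_integrable_def by (auto intro!: integrableI_bounded)

text \<open>Riesz-Fischer. A subsequence with rapidly decreasing increments converges almost
  everywhere, and Fatou's lemma carries the Cauchy estimate of the whole sequence over to that
  limit.\<close>

theorem square_integrable_complete:
  fixes f :: "nat \<Rightarrow> 'a \<Rightarrow> 'b::euclidean_space"
  assumes f: "\<And>n. square_integrable M (f n)"
    and Cauchy: "\<And>e. e > 0 \<Longrightarrow> \<exists>N. \<forall>m\<ge>N. \<forall>n\<ge>N. sq_norm M (\<lambda>x. f m x - f n x) < e"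
  shows "\<exists>g. square_integrable M g \<and> (\<lambda>n. sq_norm M (\<lambda>x. f n x - g x)) \<longlonglongrightarrow> 0"
proof -
  have "\<exists>N. \<forall>n. \<forall>m\<ge>N n. \<forall>k\<ge>N n. sq_norm M (\<lambda>x. f m x - f k x) < (1/8)^n"
    using Cauchy by (intro choice) auto
  then obtain N where N: "\<And>n m k. m \<ge> N n \<Longrightarrow> k \<ge> N n \<Longrightarrow> sq_norm M (\<lambda>x. f m x - f k x) < (1/8)^n"
    by blast
  \<comment> \<open>Partial sums make \<open>r\<close> monotone and at least \<open>N j\<close> from
    index j on.\<close>
  define r where "r n = (\<Sum>i\<le>n. N i)" for n
  have r: "j \<le> n \<Longrightarrow> r n \<ge> N j" for j n
    unfolding r_def by (rule member_le_sum) auto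
  have r8: "sq_norm M (\<lambda>x. f m x - f k x) < (1/8)^j" if "m \<ge> N j" "k \<ge> N j" for m k j
    by (rule N[OF that])
  have fm [measurable]: "f n \<in> borel_measurable M" for n using f by (simp add: square_integrable_def)
  define d where "d n x = norm (f (r (Suc n)) x - f (r n) x)" for n x
  have [measurable]: "d n \<in> borel_measurable M" for n unfolding d_def by measurable
  \<comment> \<open>The squared increments have integral below 8^(-n), so the weight 4^n leaves a
    summable series. Its finiteness at x bounds the n-th increment by a multiple of 2^(-n).\<close>
  have "(\<integral>\<^sup>+x. (\<Sum>n. ennreal (4^n * (d n x)\<^sup>2)) \<partial>M) = (\<Sum>n. \<integral>\<^sup>+x. ennreal (4^n * (d n x)\<^sup>2) \<partial>M)"
    by (rule nn_integral_suminf) measurable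
  also have "\<dots> = (\<Sum>n. ennreal (4^n * sq_norm M (\<lambda>x. f (r (Suc n)) x - f (r n) x)))"
  proof (rule suminf_cong)
    fix n
    have "(\<integral>\<^sup>+x. ennreal (4^n * (d n x)\<^sup>2) \<partial>M) = ennreal (4^n) * (\<integral>\<^sup>+x. ennreal ((d n x)\<^sup>2) \<partial>M)"
      by (subst nn_integral_cmult[symmetric]) (auto simp: ennreal_mult)
    also have "(\<integral>\<^sup>+x. ennreal ((d n x)\<^sup>2) \<partial>M) = ennreal (sq_norm M (\<lambda>x. f (r (Suc n)) x - f (r n) x))"
      unfolding d_def by (rule nn_integral_sq_norm[OF square_integrable_diff[OF f f]])
    finally show "(\<integral>\<^sup>+x. ennreal (4^n * (d n x)\<^sup>2) \<partial>M) = ennreal (4^n * sq_norm M (\<lambda>x. f (r (Suc n)) x - f (r n) x))"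
      by (simp add: ennreal_mult)
  qed
  also have "\<dots> \<le> (\<Sum>n. ennreal ((1/2)^n))"
  proof (intro suminf_le ennreal_leI)
    fix n
    have "4^n * sq_norm M (\<lambda>x. f (r (Suc n)) x - f (r n) x) \<le> 4^n * (1/8)^n"
      using r8[of n "r (Suc n)" "r n"] r[of n n] r[of n "Suc n"] by (intro mult_left_mono) auto
    also have "\<dots> = (1/2::real)^n" by (simp add: power_mult_distrib[symmetric])
    finally show "4^n * sq_norm M (\<lambda>x. f (r (Suc n)) x - f (r n) x) \<le> (1/2)^n" .
  qed auto
  also have "\<dots> < \<infinity>" by (subst suminf_ennreal2) (auto intro: summable_geometric)
  finally have "AE x in M. (\<Sum>n. ennreal (4^n * (d n x)\<^sup>2)) \<noteq> \<infinity>"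
    by (intro nn_integral_PInf_AE) auto
  then have conv: "AE x in M. convergent (\<lambda>n. f (r n) x)"
  proof eventually_elim
    case (elim x)
    have "summable (\<lambda>n. 4^n * (d n x)\<^sup>2)"
      using elim by (intro summable_suminf_not_top) auto
    then have "Bseq (\<lambda>n. 4^n * (d n x)\<^sup>2)"
      by (intro convergent_imp_Bseq convergentI[OF summable_LIMSEQ_zero])
    then obtain C where C: "C > 0" "\<And>n. 4^n * (d n x)\<^sup>2 \<le> C" unfolding Bseq_def by auto
    have "norm (d n x) \<le> sqrt C * (1/2)^n" for n
    proof -
      have "(2^n * d n x)\<^sup>2 \<le> C"
      proof -
        have "((2::real)^n)\<^sup>2 = 4^n" by (simp add: power2_eq_square flip: power_mult_distrib)
        then show ?thesis using C(2)[of n] by (simp only: power_mult_distrib)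
      qed
      then have "2^n * d n x \<le> sqrt C" by (rule real_le_rsqrt)
      then show ?thesis by (simp add: d_def power_one_over field_simps)
    qed
    then have "summable (\<lambda>n. norm (d n x))"
      by (intro summable_comparison_test[OF _ summable_mult[OF summable_geometric[of "1/2::real"]]]) (auto intro: exI[of _ 0])
    then have "summable (\<lambda>n. norm (f (r (Suc n)) x - f (r n) x))" by (simp add: d_def)
    then have "summable (\<lambda>n. f (r (Suc n)) x - f (r n) x)" by (rule summable_norm_cancel)
    then have "convergent (\<lambda>m. \<Sum>n<m. f (r (Suc n)) x - f (r n) x)" by (simp add: summable_iff_convergent)
    then have "convergent (\<lambda>m. f (r m) x - f (r 0) x)" by (simp only: sum_lessThan_telescope[of "\<lambda>n. f (r n) x"])
    then show ?case using convergent_add[OF _ convergent_const[of "f (r 0) x"]] by fastforce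
  qed
  define g where "g x = lim (\<lambda>n. f (r n) x)" for x
  have [measurable]: "g \<in> borel_measurable M" unfolding g_def by measurable
  have lim: "AE x in M. (\<lambda>n. f (r n) x) \<longlonglongrightarrow> g x"
    using conv by eventually_elim (simp add: g_def convergent_LIMSEQ_iff)
  have Fatou: "(\<integral>\<^sup>+x. ennreal ((norm (f m x - g x))\<^sup>2) \<partial>M) \<le> ennreal ((1/8)^j)" if "m \<ge> N j" for m j
  proof -
    have "(\<integral>\<^sup>+x. ennreal ((norm (f m x - g x))\<^sup>2) \<partial>M)
       = (\<integral>\<^sup>+x. liminf (\<lambda>n. ennreal ((norm (f m x - f (r n) x))\<^sup>2)) \<partial>M)"
    proof (rule nn_integral_cong_AE)
      show "AE x in M. ennreal ((norm (f m x - g x))\<^sup>2) = liminf (\<lambda>n. ennreal ((norm (f m x - f (r n) x))\<^sup>2))"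
        using lim
      proof eventually_elim
        case (elim x)
        have "(\<lambda>n. ennreal ((norm (f m x - f (r n) x))\<^sup>2)) \<longlonglongrightarrow> ennreal ((norm (f m x - g x))\<^sup>2)"
          by (intro tendsto_intros tendsto_ennrealI elim)
        then show ?case using lim_imp_Liminf by (metis sequentially_bot)
      qed
    qed
    also have "\<dots> \<le> liminf (\<lambda>n. \<integral>\<^sup>+x. ennreal ((norm (f m x - f (r n) x))\<^sup>2) \<partial>M)"
      by (rule nn_integral_liminf) measurable
    also have "\<dots> \<le> ennreal ((1/8)^j)"
    proof (rule Liminf_le)
      show "\<forall>\<^sub>F n in sequentially. (\<integral>\<^sup>+x. ennreal ((norm (f m x - f (r n) x))\<^sup>2) \<partial>M) \<le> ennreal ((1/8)^j)"
        using eventually_ge_at_top[of j]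
      proof eventually_elim
        case (elim n)
        then show ?case
          using r8[OF that r[OF elim]] nn_integral_sq_norm[OF square_integrable_diff[OF f f], of m "r n"]
          by (simp add: ennreal_leI)
      qed
    qed simp
    finally show ?thesis .
  qed
  have diff: "square_integrable M (\<lambda>x. f m x - g x)" if "m \<ge> N j" for m j
    using Fatou[OF that] by (intro square_integrableI_nn_integral) (auto intro: le_less_trans)
  have g: "square_integrable M g"
    using square_integrable_diff[OF f diff[of 0 "N 0"], of "N 0"] by simp
  have le: "sq_norm M (\<lambda>x. f m x - g x) \<le> (1/8)^j" if "m \<ge> N j" for m j
    using Fatou[OF that] nn_integral_sq_norm[OF diff[OF that]] by (simp add: ennreal_le_iff)
  have "(\<lambda>n. sq_norm M (\<lambda>x. f n x - g x)) \<longlonglongrightarrow> 0"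
  proof (rule LIMSEQ_I)
    fix e :: real assume "e > 0"
    then obtain j where "(1/8)^j < e" using real_arch_pow_inv[of e "1/8"] by auto
    then have "norm (sq_norm M (\<lambda>x. f n x - g x) - 0) < e" if "n \<ge> N j" for n
      using le[OF that] by simp
    then show "\<exists>no. \<forall>n\<ge>no. norm (sq_norm M (\<lambda>x. f n x - g x) - 0) < e" by blast
  qed
  with g show ?thesis by blast
qed

lemma sq_inner_tendsto:
  assumes f: "\<And>n. square_integrable M (f n)" "square_integrable M g" "square_integrable M h"
    and lim: "(\<lambda>n. sq_norm M (\<lambda>x. f n x - g x)) \<longlonglongrightarrow> 0"
  shows "(\<lambda>n. sq_inner M (f n) h) \<longlonglongrightarrow> sq_inner M g h"
proof -
  have "(\<lambda>n. sq_inner M (f n) h - sq_inner M g h) \<longlonglongrightarrow> 0"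
  proof (rule Lim_null_comparison)
    show "\<forall>\<^sub>F n in sequentially. norm (sq_inner M (f n) h - sq_inner M g h)
       \<le> sqrt (sq_norm M (\<lambda>x. f n x - g x)) * sqrt (sq_norm M h)"
      using sq_inner_Cauchy_Schwarz[OF square_integrable_diff[OF f(1,2)] f(3)]
      by (simp add: sq_inner_diff_left f)
    have "(\<lambda>n. sqrt (sq_norm M (\<lambda>x. f n x - g x)) * sqrt (sq_norm M h)) \<longlonglongrightarrow> sqrt 0 * sqrt (sq_norm M h)"
      by (intro tendsto_intros lim)
    then show "(\<lambda>n. sqrt (sq_norm M (\<lambda>x. f n x - g x)) * sqrt (sq_norm M h)) \<longlonglongrightarrow> 0" by simp
  qed
  then show ?thesis by (rule LIM_zero_cancel)
qed

lemma sq_norm_tendsto: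
  assumes f: "\<And>n. square_integrable M (f n)" "square_integrable M g"
    and lim: "(\<lambda>n. sq_norm M (\<lambda>x. f n x - g x)) \<longlonglongrightarrow> 0"
  shows "(\<lambda>n. sq_norm M (f n)) \<longlonglongrightarrow> sq_norm M g"
proof -
  have "(\<lambda>n. sq_norm M (\<lambda>x. f n x - g x) + 2 * sq_inner M (f n) g - sq_norm M g) \<longlonglongrightarrow> 0 + 2 * sq_inner M g g - sq_norm M g"
    by (intro tendsto_intros lim sq_inner_tendsto f)
  then show ?thesis by (simp add: sq_norm_diff f sq_inner_self)
qed

text \<open>\<open>Y\<close> is a linear space that need not be closed, so the projection is a limit
  of members of \<open>Y\<close>. The approximating sequence is part of the conclusion because its
  members become the test fields.\<close>

theorem square_integrable_projection:
  fixes f :: "'a \<Rightarrow> 'b::euclidean_space"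
  assumes f: "square_integrable M f" and Y: "\<And>y. y \<in> Y \<Longrightarrow> square_integrable M y" and "Y \<noteq> {}"
    and lincomb: "\<And>y z a b. y \<in> Y \<Longrightarrow> z \<in> Y \<Longrightarrow> (\<lambda>x. a *\<^sub>R y x + b *\<^sub>R z x) \<in> Y"
  shows "\<exists>g y. square_integrable M g \<and> (\<forall>n. y n \<in> Y) \<and> (\<lambda>n. sq_norm M (\<lambda>x. y n x - g x)) \<longlonglongrightarrow> 0
     \<and> (\<forall>z\<in>Y. sq_inner M (\<lambda>x. f x - g x) z = 0)"
proof -
  define dst where "dst y = sq_norm M (\<lambda>x. f x - y x)" for y
  define \<delta> where "\<delta> = Inf (dst ` Y)"
  have bdd: "bdd_below (dst ` Y)" by (rule bdd_belowI[of _ 0]) (auto simp: dst_def)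
  have \<delta>_le: "\<delta> \<le> dst y" if "y \<in> Y" for y
    unfolding \<delta>_def using bdd that by (intro cInf_lower) auto
  have "\<exists>y\<in>Y. dst y < \<delta> + 1 / real (Suc n)" for n
    using cInf_lessD[of "dst ` Y" "\<delta> + 1 / real (Suc n)"] \<open>Y \<noteq> {}\<close> by (auto simp: \<delta>_def)
  then obtain y where y: "\<And>n. y n \<in> Y" "\<And>n. dst (y n) < \<delta> + 1 / real (Suc n)" by metis
  have sy: "square_integrable M (y n)" for n using y Y by blast
  have sfy: "square_integrable M (\<lambda>x. f x - y n x)" for n by (intro square_integrable_diff f sy)
  have diff_le: "sq_norm M (\<lambda>x. y m x - y n x) \<le> 2 / real (Suc n) + 2 / real (Suc m)" for m n
  proof -
    \<comment> \<open>Parallelogram law: the midpoint is no nearer to f than \<delta>, which forces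
      the members of a minimising sequence together.\<close>
    define z where "z = (\<lambda>x. (1/2) *\<^sub>R y n x + (1/2) *\<^sub>R y m x)"
    have "z \<in> Y" unfolding z_def by (intro lincomb y)
    have "sq_norm M (\<lambda>x. (f x - y n x) + (f x - y m x)) = 4 * dst z"
    proof -
      have "(\<lambda>x. (f x - y n x) + (f x - y m x)) = (\<lambda>x. 2 *\<^sub>R (f x - z x))"
        by (simp add: z_def fun_eq_iff algebra_simps scaleR_2)
      then show ?thesis by (simp only: sq_norm_scale dst_def) simp
    qed
    moreover have "sq_norm M (\<lambda>x. (f x - y n x) - (f x - y m x)) = sq_norm M (\<lambda>x. y m x - y n x)"
      by (simp add: sq_norm_def)
    ultimately have "sq_norm M (\<lambda>x. y m x - y n x) = 2 * dst (y n) + 2 * dst (y m) - 4 * dst z"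
      using sq_norm_add[OF sfy sfy, of n m] sq_norm_diff[OF sfy sfy, of n m] by (simp add: dst_def)
    then show ?thesis using y(2)[of n] y(2)[of m] \<delta>_le[OF \<open>z \<in> Y\<close>] by simp
  qed
  have "\<exists>g. square_integrable M g \<and> (\<lambda>n. sq_norm M (\<lambda>x. y n x - g x)) \<longlonglongrightarrow> 0"
  proof (rule square_integrable_complete[OF sy])
    fix e :: real assume "e > 0"
    then obtain N where N: "1 / real (Suc N) < e / 4" using nat_approx_posE[of "e / 4"] by auto
    have "sq_norm M (\<lambda>x. y m x - y n x) < e" if "m \<ge> N" "n \<ge> N" for m n
    proof -
      have "1 / real (Suc n) \<le> 1 / real (Suc N)" "1 / real (Suc m) \<le> 1 / real (Suc N)"
        using that by (simp_all add: divide_simps)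
      then show ?thesis using diff_le[of m n] N by simp
    qed
    then show "\<exists>N. \<forall>m\<ge>N. \<forall>n\<ge>N. sq_norm M (\<lambda>x. y m x - y n x) < e" by blast
  qed
  then obtain g where g: "square_integrable M g" "(\<lambda>n. sq_norm M (\<lambda>x. y n x - g x)) \<longlonglongrightarrow> 0" by blast
  have "sq_inner M (\<lambda>x. f x - g x) z = 0" if z: "z \<in> Y" for z
  proof -
    have sz: "square_integrable M z" using z Y by blast
    have lim: "(\<lambda>n. sq_inner M (\<lambda>x. f x - y n x) z) \<longlonglongrightarrow> sq_inner M (\<lambda>x. f x - g x) z"
    proof -
      have "(\<lambda>n. sq_inner M f z - sq_inner M (y n) z) \<longlonglongrightarrow> sq_inner M f z - sq_inner M g z"
        by (intro tendsto_intros sq_inner_tendsto sy g sz)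
      then show ?thesis by (simp add: sq_inner_diff_left f sy g sz)
    qed
    \<comment> \<open>The minimising sequence is perturbed by multiples of \<open>z\<close>. In the
      limit the quadratic polynomial in t is nonnegative with constant term 0.\<close>
    have "(sq_inner M (\<lambda>x. f x - g x) z)\<^sup>2 \<le> 0 * sq_norm M z"
    proof (rule discriminant_le)
      fix t :: real
      have ge: "0 \<le> 1 / real (Suc n) + 2 * t * sq_inner M (\<lambda>x. f x - y n x) z + t\<^sup>2 * sq_norm M z" for n
      proof -
        have "(\<lambda>x. 1 *\<^sub>R y n x + (- t) *\<^sub>R z x) \<in> Y" by (intro lincomb y z)
        from \<delta>_le[OF this] have "\<delta> \<le> sq_norm M (\<lambda>x. (f x - y n x) + t *\<^sub>R z x)"
          by (simp add: dst_def algebra_simps)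
        also have "\<dots> = dst (y n) + 2 * t * sq_inner M (\<lambda>x. f x - y n x) z + t\<^sup>2 * sq_norm M z"
          using sq_norm_add[OF sfy[of n] square_integrable_scale[OF sz, of t]]
          by (simp add: sq_inner_scale sq_norm_scale dst_def)
        finally show ?thesis using y(2)[of n] by simp
      qed
      have "(\<lambda>n. 1 / real (Suc n) + 2 * t * sq_inner M (\<lambda>x. f x - y n x) z + t\<^sup>2 * sq_norm M z)
        \<longlonglongrightarrow> 0 + 2 * t * sq_inner M (\<lambda>x. f x - g x) z + t\<^sup>2 * sq_norm M z"
        using LIMSEQ_inverse_real_of_nat by (intro tendsto_intros lim) (simp add: inverse_eq_divide)
      then show "0 \<le> 0 + 2 * t * sq_inner M (\<lambda>x. f x - g x) z + t\<^sup>2 * sq_norm M z"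
        using ge by (intro LIMSEQ_le_const) auto
    qed
    then show ?thesis by simp
  qed
  then show ?thesis using g y(1) by blast
qed

subsection \<open>Test functions and the fundamental lemma\<close>

text \<open>The powers in the denominator make the family closed under differentiation, up to linear combinations.\<close>

definition flat_exp :: "nat \<Rightarrow> real \<Rightarrow> real" where
  "flat_exp k x = (if x > 0 then exp (- (1 / x)) / x ^ k else 0)"

lemma flat_exp_nonneg [simp]: "0 \<le> flat_exp k x"
  by (simp add: flat_exp_def)

lemma flat_exp_0_le_1: "flat_exp 0 x \<le> 1"
  by (simp add: flat_exp_def)

text \<open>One Taylor term of exp (1/h), that of degree k + 2, beats the pole of order k with two
  powers of h to spare. A quadratic bound gives derivative 0 at the origin.\<close>

lemma flat_exp_le: "\<bar>flat_exp k h\<bar> \<le> fact (k + 2) * h\<^sup>2"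
proof (cases "h > 0")
  case True
  have "(1 / h) ^ (k + 2) / fact (k + 2) \<le> (\<Sum>n. (1 / h) ^ n /\<^sub>R fact n)"
    using sum_le_suminf[OF summable_exp_generic, of "{k + 2}" "1 / h"] True
    by (simp add: field_simps del: fact_Suc)
  then have "(1 / h) ^ (k + 2) / fact (k + 2) \<le> exp (1 / h)"
    by (simp add: exp_def)
  then have "exp (- (1 / h)) \<le> fact (k + 2) * h ^ (k + 2)"
    using True by (simp add: exp_minus power_one_over field_simps del: fact_Suc)
  then have "exp (- (1 / h)) / h ^ k \<le> fact (k + 2) * h\<^sup>2"
    using True by (simp add: field_simps power_add power2_eq_square del: fact_Suc)
  then show ?thesis using True by (simp add: flat_exp_def del: fact_Suc)
qed (simp add: flat_exp_def)

lemma DERIV_flat_exp: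
  "(flat_exp k has_real_derivative (flat_exp (k + 2) x - real k * flat_exp (k + 1) x)) (at x)"
proof -
  consider "x > 0" | "x < 0" | "x = 0" by linarith
  then show ?thesis
  proof cases
    case 1
    have "((\<lambda>x. exp (- (1 / x)) / x ^ k) has_real_derivative (flat_exp (k + 2) x - real k * flat_exp (k + 1) x)) (at x)"
    proof (cases k)
      case 0
      then show ?thesis
        using 1 by (auto intro!: derivative_eq_intros simp: flat_exp_def power2_eq_square field_simps)
    next
      case (Suc m)
      then show ?thesis
        using 1 by (auto intro!: derivative_eq_intros simp: flat_exp_def power2_eq_square field_simps)
          (metis One_nat_def power_eq_if)
    qed
    then show ?thesis
      by (rule has_field_derivative_transform_within_open[where S="{0<..}"]) (use 1 in \<open>auto simp: flat_exp_def\<close>)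
  next
    case 2
    have "((\<lambda>x. 0) has_real_derivative (flat_exp (k + 2) x - real k * flat_exp (k + 1) x)) (at x)"
      using 2 by (simp add: flat_exp_def)
    then show ?thesis
      by (rule has_field_derivative_transform_within_open[where S="{..<0}"]) (use 2 in \<open>auto simp: flat_exp_def\<close>)
  next
    case 3
    have "((\<lambda>h. (flat_exp k (0 + h) - flat_exp k 0) / h) \<longlongrightarrow> 0) (at 0)"
    proof (rule Lim_null_comparison)
      show "\<forall>\<^sub>F h in at 0. norm ((flat_exp k (0 + h) - flat_exp k 0) / h) \<le> fact (k + 2) * \<bar>h\<bar>"
      proof (rule eventuallyI)
        fix h :: real
        show "norm ((flat_exp k (0 + h) - flat_exp k 0) / h) \<le> fact (k + 2) * \<bar>h\<bar>"
        proof (cases "h = 0")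
          case False
          have "\<bar>flat_exp k h\<bar> / \<bar>h\<bar> \<le> fact (k + 2) * h\<^sup>2 / \<bar>h\<bar>"
            by (intro divide_right_mono flat_exp_le) auto
          also have "\<dots> = fact (k + 2) * \<bar>h\<bar>"
            using False by (simp add: power2_eq_square abs_if del: fact_Suc)
          finally show ?thesis by (simp add: flat_exp_def[of k 0] del: fact_Suc)
        qed simp
      qed
      have "((\<lambda>h. fact (k + 2) * \<bar>h\<bar>) \<longlongrightarrow> fact (k + 2) * \<bar>0\<bar>) (at (0::real))"
        by (intro tendsto_intros)
      then show "((\<lambda>h. fact (k + 2) * \<bar>h\<bar>) \<longlongrightarrow> 0) (at (0::real))" by simp
    qed
    then show ?thesis using 3 by (simp add: DERIV_def flat_exp_def[of _ 0])
  qed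
qed

lemma flat_exp_0_tendsto: 
  assumes "x > 0"
  shows "(\<lambda>n. flat_exp 0 (real (Suc n) * x)) \<longlonglongrightarrow> 1"
proof -
  have "(\<lambda>n. - (1 / x) * inverse (real (Suc n))) \<longlonglongrightarrow> - (1 / x) * 0"
    by (intro tendsto_mult_left LIMSEQ_inverse_real_of_nat)
  then have "(\<lambda>n. exp (- (1 / x) * inverse (real (Suc n)))) \<longlonglongrightarrow> exp (- (1 / x) * 0)"
    by (rule tendsto_exp)
  then have "(\<lambda>n. exp (- (1 / (real (Suc n) * x)))) \<longlonglongrightarrow> 1"
    by (simp add: divide_inverse mult.commute)
  then show ?thesis using assms by (simp add: flat_exp_def)
qed

lemma partial_deriv_eqI: "(f has_derivative f') (at x) \<Longrightarrow> partial_deriv j f x = f' (axis j 1)"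
  unfolding partial_deriv_def using frechet_derivative_at by metis

text \<open>The class is closed under partial derivatives, so differentiability of its members
  yields \<open>C_k\<close> for every k by induction on k, without formulas for higher
  derivatives.\<close>

inductive_set bump_algebra :: "(real^'n \<Rightarrow> real) set" where
  bump: "(\<lambda>x. flat_exp k (a + b * x $ j)) \<in> bump_algebra"
| const: "(\<lambda>x. c) \<in> bump_algebra"
| add: "f \<in> bump_algebra \<Longrightarrow> g \<in> bump_algebra \<Longrightarrow> (\<lambda>x. f x + g x) \<in> bump_algebra"
| mult: "f \<in> bump_algebra \<Longrightarrow> g \<in> bump_algebra \<Longrightarrow> (\<lambda>x. f x * g x) \<in> bump_algebra"

lemma bump_algebra_deriv:
  assumes "f \<in> bump_algebra"
  shows "f differentiable_on UNIV \<and> (\<forall>j. partial_deriv j f \<in> bump_algebra)"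
  using assms
proof induction
  case (bump k a b i)
  have *: "((\<lambda>x. flat_exp k (a + b * x $ i)) has_derivative
      (\<lambda>h. (flat_exp (k + 2) (a + b * x $ i) - real k * flat_exp (k + 1) (a + b * x $ i)) * (b * h $ i))) (at x)" for x
  proof -
    have "((\<lambda>x. a + b * x $ i) has_derivative (\<lambda>h. b * h $ i)) (at x)"
      by (auto intro!: derivative_eq_intros bounded_linear.has_derivative[OF bounded_linear_vec_nth])
    then show ?thesis
      by (rule has_derivative_compose[OF _ DERIV_flat_exp[unfolded has_field_derivative_def]])
  qed
  have "partial_deriv j (\<lambda>x. flat_exp k (a + b * x $ i)) =
     (\<lambda>x. (b * axis j 1 $ i) * (flat_exp (k + 2) (a + b * x $ i) + (- real k) * flat_exp (k + 1) (a + b * x $ i)))" for j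
    using partial_deriv_eqI[OF *] by (auto simp: fun_eq_iff)
  moreover have "(\<lambda>x. (b * axis j 1 $ i) * (flat_exp (k + 2) (a + b * x $ i)
      + (- real k) * flat_exp (k + 1) (a + b * x $ i))) \<in> bump_algebra" for j :: 'a
    by (intro bump_algebra.intros)
  ultimately show ?case
    using * by (auto simp: differentiable_on_def differentiable_def intro: has_derivative_at_withinI)
next
  case (const c)
  have "partial_deriv j (\<lambda>x. c) = (\<lambda>x. 0)" for j :: 'a
    using partial_deriv_eqI[OF has_derivative_const] by auto
  then show ?case by (auto intro: bump_algebra.const)
next
  case (add f g)
  have d: "f differentiable (at x)" "g differentiable (at x)" for x
    using add by (auto simp: differentiable_on_def)
  have "partial_deriv j (\<lambda>x. f x + g x) x = partial_deriv j f x + partial_deriv j g x" for j x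
    unfolding partial_deriv_def[of _ f] partial_deriv_def[of _ g]
    by (subst partial_deriv_eqI[OF has_derivative_add[OF d[unfolded frechet_derivative_works]]]) simp
  then have "partial_deriv j (\<lambda>x. f x + g x) = (\<lambda>x. partial_deriv j f x + partial_deriv j g x)" for j by auto
  then show ?case using add by (auto intro: bump_algebra.add differentiable_on_add)
next
  case (mult f g)
  have d: "f differentiable (at x)" "g differentiable (at x)" for x
    using mult by (auto simp: differentiable_on_def)
  have "partial_deriv j (\<lambda>x. f x * g x) x = f x * partial_deriv j g x + partial_deriv j f x * g x" for j x
    unfolding partial_deriv_def[of _ f] partial_deriv_def[of _ g]
    by (subst partial_deriv_eqI[OF has_derivative_mult[OF d[unfolded frechet_derivative_works]]]) simp
  then have "partial_deriv j (\<lambda>x. f x * g x) = (\<lambda>x. f x * partial_deriv j g x + partial_deriv j f x * g x)" for j by auto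
  then show ?case using mult by (auto intro!: bump_algebra.add bump_algebra.mult differentiable_on_mult)
qed

lemma bump_algebra_C_k: "f \<in> bump_algebra \<Longrightarrow> C_k k f"
proof (induction k arbitrary: f)
  case 0
  then show ?case using bump_algebra_deriv differentiable_imp_continuous_on by auto
next
  case (Suc k)
  then show ?case using bump_algebra_deriv[of f] by auto
qed

lemma bump_algebra_prod:
  "finite A \<Longrightarrow> (\<And>i. i \<in> A \<Longrightarrow> f i \<in> bump_algebra) \<Longrightarrow> (\<lambda>x. \<Prod>i\<in>A. f i x) \<in> bump_algebra"
proof (induction A rule: finite_induct)
  case empty
  then show ?case by (simp add: bump_algebra.const)
next
  case (insert i A)
  then show ?case by (simp add: bump_algebra.mult)
qed

text \<open>For s > 0 a smooth function positive exactly on the open box; as s grows it tends to the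
  indicator of the box.\<close>

definition box_bump :: "real \<Rightarrow> real^'n \<Rightarrow> real^'n \<Rightarrow> real^'n \<Rightarrow> real" where
  "box_bump s a b x = (\<Prod>j\<in>UNIV. flat_exp 0 (s * (x $ j - a $ j)) * flat_exp 0 (s * (b $ j - x $ j)))"

lemma box_bump_algebra: "box_bump s a b \<in> bump_algebra"
proof -
  have "(\<lambda>x. flat_exp 0 (s * (x $ j - a $ j)) * flat_exp 0 (s * (b $ j - x $ j))) \<in> bump_algebra" for j
    using bump_algebra.mult[OF bump_algebra.bump[of 0 "- s * a $ j" s j] bump_algebra.bump[of 0 "s * b $ j" "-s" j]]
    by (simp add: algebra_simps)
  then show ?thesis unfolding box_bump_def[abs_def] by (intro bump_algebra_prod) auto
qed

lemma box_bump_bounds: "0 \<le> box_bump s a b x" "box_bump s a b x \<le> 1"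
  unfolding box_bump_def
  by (auto intro!: prod_nonneg prod_le_1 mult_le_one flat_exp_0_le_1)

lemma box_bump_nonzero_iff:
  assumes "s > 0"
  shows "box_bump s a b x \<noteq> 0 \<longleftrightarrow> x \<in> box a b"
proof -
  have "flat_exp 0 t \<noteq> 0 \<longleftrightarrow> t > 0" for t by (simp add: flat_exp_def)
  then show ?thesis
    using assms by (auto simp: box_bump_def mem_box_cart zero_less_mult_iff)
qed

lemma box_bump_tendsto: "(\<lambda>n. box_bump (real (Suc n)) a b x) \<longlonglongrightarrow> indicator (box a b) x"
proof (cases "x \<in> box a b")
  case True
  have "(\<lambda>n. box_bump (real (Suc n)) a b x) \<longlonglongrightarrow> (\<Prod>j\<in>(UNIV::'a set). 1 * 1)"
    unfolding box_bump_def
    by (intro tendsto_prod tendsto_mult flat_exp_0_tendsto) (use True in \<open>auto simp: mem_box_cart\<close>)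
  then show ?thesis using True by simp
next
  case False
  then have "box_bump (real (Suc n)) a b x = 0" for n using box_bump_nonzero_iff[of "real (Suc n)" a b x] by auto
  then show ?thesis using False by simp
qed

lemma box_bump_support: "s > 0 \<Longrightarrow> closure {x. box_bump s a b x \<noteq> 0} \<subseteq> cbox a b"
  by (simp add: box_bump_nonzero_iff) (rule closure_minimal[OF box_subset_cbox closed_cbox])

lemma box_bump_test:
  assumes "s > 0" "cbox a b \<subseteq> \<Omega>"
  shows "box_bump s a b \<in> test_functions \<Omega>"
proof -
  have sub: "closure {x. box_bump s a b x \<noteq> 0} \<subseteq> cbox a b" by (rule box_bump_support[OF assms(1)])
  then have "compact (closure {x. box_bump s a b x \<noteq> 0})"
    by (meson bounded_cbox bounded_subset closed_closure compact_eq_bounded_closed)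
  moreover have "C_k k (box_bump s a b)" for k by (rule bump_algebra_C_k[OF box_bump_algebra])
  ultimately show ?thesis using sub assms(2) by (auto simp: test_functions_def)
qed

text \<open>Bumps with growing s show that g has integral 0 over every open box whose closed box
  lies in \<Omega>. Boxes generate the Borel sets and are stable under intersection, so g vanishes
  almost everywhere in each such box, and countably many of them cover \<Omega>.\<close>

lemma fundamental_lemma:
  fixes g :: "real^'n \<Rightarrow> real"
  assumes "open \<Omega>" and g: "integrable lborel g"
    and ortho: "\<And>\<phi>. \<phi> \<in> test_functions \<Omega> \<Longrightarrow> \<phi> \<in> bump_algebra \<Longrightarrow> (LINT x|lborel. g x * \<phi> x) = 0"
  shows "AE x in lborel. x \<in> \<Omega> \<longrightarrow> g x = 0"
proof -
  have gm [measurable]: "g \<in> borel_measurable borel" using g by (simp add: borel_measurable_integrable)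
  have box0: "(LINT x|lborel. g x * indicator (box a b) x) = 0" if "cbox a b \<subseteq> \<Omega>" for a b
  proof -
    have "(\<lambda>n. LINT x|lborel. g x * box_bump (real (Suc n)) a b x) \<longlonglongrightarrow> (LINT x|lborel. g x * indicator (box a b) x)"
    proof (rule integral_dominated_convergence[where w="\<lambda>x. norm (g x)"])
      show "integrable lborel (\<lambda>x. norm (g x))" using g by simp
      show "AE x in lborel. (\<lambda>n. g x * box_bump (real (Suc n)) a b x) \<longlonglongrightarrow> g x * indicator (box a b) x"
        by (intro AE_I2 tendsto_intros box_bump_tendsto)
      fix n
      have "continuous_on UNIV (box_bump (real (Suc n)) a b)"
        using bump_algebra_C_k[OF box_bump_algebra, of 0] by simp
      then have [measurable]: "box_bump (real (Suc n)) a b \<in> borel_measurable borel"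
        by (rule borel_measurable_continuous_onI)
      show "(\<lambda>x. g x * box_bump (real (Suc n)) a b x) \<in> borel_measurable lborel" by measurable
      show "AE x in lborel. norm (g x * box_bump (real (Suc n)) a b x) \<le> norm (g x)"
        using box_bump_bounds[of "real (Suc n)" a b] by (intro AE_I2) (simp add: abs_mult mult_left_le)
    qed measurable
    moreover have "(LINT x|lborel. g x * box_bump (real (Suc n)) a b x) = 0" for n
      using that by (intro ortho box_bump_test box_bump_algebra) auto
    ultimately show ?thesis by (simp add: LIMSEQ_const_iff)
  qed
  have AE_box: "AE x in lborel. g x * indicator (box c d) x = 0" if cd: "cbox c d \<subseteq> \<Omega>" for c d
  proof -
    \<comment> \<open>After the cutoff to one box, the whole space has integral 0 as well, which the
      complements in the induction require, and the intersections with arbitrary boxes stay within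
      reach of \<open>box0\<close>.\<close>
    define f where "f x = g x * indicator (box c d) x" for x
    have f: "integrable lborel f"
      unfolding f_def using integrable_mult_indicator[OF _ g, of "box c d"] by (simp add: mult.commute)
    have fA: "integrable lborel (\<lambda>x. f x * indicator A x)" if "A \<in> sets borel" for A
      using integrable_mult_indicator[OF _ f, of A] that by (simp add: mult.commute)
    have fbox: "(LINT x|lborel. f x * indicator (box a b) x) = 0" for a b
    proof -
      obtain a' b' where ab: "box c d \<inter> box a b = box a' b'"
        by (rule that[OF box_Int_box])
      have "(LINT x|lborel. g x * indicator (box a' b') x) = 0"
      proof (cases "box a' b' = {}")
        case False
        then have "cbox a' b' = closure (box a' b')" by (simp add: closure_box)
        also have "\<dots> \<subseteq> cbox c d" using ab by (intro closure_minimal) (use box_subset_cbox in blast)+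
        finally show ?thesis using cd by (intro box0) auto
      qed simp
      moreover have "f x * indicator (box a b) x = g x * indicator (box a' b') x" for x
        unfolding f_def ab[symmetric] by (simp add: indicator_inter_arith mult.assoc)
      ultimately show ?thesis by simp
    qed
    have f0: "(LINT x|lborel. f x) = 0"
    proof -
      have "f x * indicator (box c d) x = f x" for x by (simp add: f_def indicator_def)
      then show ?thesis using fbox[of c d] by (simp only:)
    qed
    let ?E = "range (\<lambda>(a, b). box a b :: (real^'n) set)"
    have all0: "(LINT x|lborel. f x * indicator A x) = 0" if "A \<in> sets borel" for A
    proof -
      have "Int_stable ?E" "?E \<subseteq> Pow UNIV" by (auto simp: Int_stable_def box_Int_box)
      have sets_eq: "sets (borel :: (real^'n) measure) = sigma_sets UNIV ?E" by (simp add: borel_eq_box)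
      from \<open>Int_stable ?E\<close> \<open>?E \<subseteq> Pow UNIV\<close> that[unfolded sets_eq] show ?thesis
      proof (induction rule: sigma_sets_induct_disjoint)
        case (basic A)
        then show ?case using fbox by auto
      next
        case empty
        show ?case by simp
      next
        case (compl A)
        have "A \<in> sets borel" unfolding sets_eq by (rule compl(1))
        have "(LINT x|lborel. f x * indicator (UNIV - A) x) = (LINT x|lborel. f x - f x * indicator A x)"
          by (intro Bochner_Integration.integral_cong) (auto simp: indicator_def)
        then show ?case using compl f0 f fA[OF \<open>A \<in> sets borel\<close>] by simp
      next
        case (union A)
        have Am: "A i \<in> sets borel" for i using union(2) unfolding sets_eq by auto
        have "(\<lambda>n. LINT x|lborel. f x * indicator (\<Union>i<n. A i) x) \<longlonglongrightarrow> (LINT x|lborel. f x * indicator (\<Union>i. A i) x)"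
        proof (rule integral_dominated_convergence[where w="\<lambda>x. norm (f x)"])
          show "AE x in lborel. (\<lambda>n. f x * indicator (\<Union>i<n. A i) x) \<longlonglongrightarrow> f x * indicator (\<Union>i. A i) x"
            by (intro AE_I2 tendsto_mult tendsto_const LIMSEQ_indicator_UN)
          show "(\<lambda>x. f x * indicator (\<Union>i. A i) x) \<in> borel_measurable lborel"
            by (rule borel_measurable_integrable[OF fA]) (use Am in blast)
          show "(\<lambda>x. f x * indicator (\<Union>i<n. A i) x) \<in> borel_measurable lborel" for n
            by (rule borel_measurable_integrable[OF fA]) (use Am in blast)
          show "integrable lborel (\<lambda>x. norm (f x))" using f by simp
          show "AE x in lborel. norm (f x * indicator (\<Union>i<n. A i) x) \<le> norm (f x)" for n
            by (rule AE_I2) (simp add: indicator_def)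
        qed
        moreover have "(LINT x|lborel. f x * indicator (\<Union>i<n. A i) x) = 0" for n
        proof -
          have eq: "f x * indicator (\<Union>i<n. A i) x = (\<Sum>i<n. f x * indicator (A i) x)" for x
          proof -
            have "(indicator (\<Union>i<n. A i) x :: real) = (\<Sum>i<n. indicator (A i) x)"
              using union(1) by (intro indicator_UN_disjoint) (auto simp: disjoint_family_on_def)
            then show ?thesis by (simp only: sum_distrib_left)
          qed
          show ?thesis unfolding eq by (subst Bochner_Integration.integral_sum[OF fA[OF Am]]) (simp only: union(3) sum.neutral_const)
        qed
        ultimately show ?case by (simp add: LIMSEQ_const_iff)
      qed
    qed
    have "AE x in lborel. f x = 0"
      using f all0 by (intro density_unique_real[of _ f "\<lambda>x. 0", simplified])
        (auto simp: set_lebesgue_integral_def mult.commute)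
    then show ?thesis by (simp add: f_def)
  qed
  define F where "F = {X. \<exists>a b. X = box a b \<and> cbox a b \<subseteq> \<Omega>}"
  have "\<Union>F = \<Omega>"
  proof
    show "\<Union>F \<subseteq> \<Omega>" using box_subset_cbox by (fastforce simp: F_def)
    show "\<Omega> \<subseteq> \<Union>F"
    proof
      fix x assume "x \<in> \<Omega>"
      then obtain a b where "x \<in> box a b" "cbox a b \<subseteq> \<Omega>"
        using \<open>open \<Omega>\<close> open_contains_cbox by metis
      then show "x \<in> \<Union>F" by (auto simp: F_def)
    qed
  qed
  obtain \<D> where "\<D> \<subseteq> F" and D: "countable \<D>" "\<Union>\<D> = \<Omega>"
  proof (rule Lindelof[of F])
    show "open X" if "X \<in> F" for X using that by (auto simp: F_def open_box)
  qed (use \<open>\<Union>F = \<Omega>\<close> that in auto)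
  have "AE x in lborel. \<forall>X\<in>\<D>. x \<in> X \<longrightarrow> g x = 0"
  proof (subst AE_ball_countable[OF D(1)], intro ballI)
    fix X assume "X \<in> \<D>"
    then obtain a b where X: "X = box a b" "cbox a b \<subseteq> \<Omega>" using \<open>\<D> \<subseteq> F\<close> by (auto simp: F_def)
    from AE_box[OF X(2)] show "AE x in lborel. x \<in> X \<longrightarrow> g x = 0"
      by eventually_elim (auto simp: X(1))
  qed
  then show ?thesis by eventually_elim (use D(2) in blast)
qed

subsection \<open>Integration by parts and convolution\<close>

definition continuous_compact :: "(real^'n \<Rightarrow> real) \<Rightarrow> bool" where
  "continuous_compact f \<longleftrightarrow> continuous_on UNIV f \<and> bounded {x. f x \<noteq> 0}"

definition C1_compact :: "(real^'n \<Rightarrow> real) \<Rightarrow> bool" where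
  "C1_compact f \<longleftrightarrow> (\<forall>x. f differentiable (at x)) \<and> (\<forall>j. continuous_on UNIV (partial_deriv j f))
     \<and> bounded {x. f x \<noteq> 0}"

lemma test_function_C1_compact: "\<phi> \<in> test_functions \<Omega> \<Longrightarrow> C1_compact \<phi>"
proof -
  assume "\<phi> \<in> test_functions \<Omega>"
  then have "C_k (Suc 0) \<phi>" "bounded (closure {x. \<phi> x \<noteq> 0})"
    by (auto simp: test_functions_def compact_imp_bounded)
  then show ?thesis
    using bounded_subset[OF _ closure_subset] by (auto simp: C1_compact_def differentiable_on_def)
qed

lemma C1_compact_has_derivative:
  assumes "C1_compact f"
  shows "(f has_derivative (\<lambda>k. \<Sum>j\<in>UNIV. k $ j * partial_deriv j f x)) (at x)"
proof -
  have d: "(f has_derivative frechet_derivative f (at x)) (at x)"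
    using assms by (simp add: C1_compact_def flip: frechet_derivative_works)
  then have l: "linear (frechet_derivative f (at x))" by (rule has_derivative_linear)
  have "frechet_derivative f (at x) k = (\<Sum>j\<in>UNIV. k $ j * partial_deriv j f x)" for k
  proof -
    have "k = (\<Sum>j\<in>UNIV. k $ j *\<^sub>R axis j 1)"
      by (simp add: vec_eq_iff axis_def if_distrib cong: if_cong)
    then have "frechet_derivative f (at x) k = frechet_derivative f (at x) (\<Sum>j\<in>UNIV. k $ j *\<^sub>R axis j 1)" by metis
    then show ?thesis by (simp add: linear_sum[OF l] linear_scale[OF l] partial_deriv_def)
  qed
  then show ?thesis using d by (metis (no_types, lifting) ext)
qed

lemma partial_deriv_eq_0:
  assumes "C1_compact f" "{x. f x \<noteq> 0} \<subseteq> cball 0 B" "norm x > B"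
  shows "partial_deriv j f x = 0"
proof -
  have "((\<lambda>x. 0) has_derivative (\<lambda>k. 0)) (at x)" by simp
  then have "(f has_derivative (\<lambda>k. 0)) (at x)"
  proof (rule has_derivative_transform_within_open[where s="- cball 0 B"])
    show "open (- cball (0::real^'a) B)" by (simp add: open_Compl)
  qed (use assms in auto)
  then show ?thesis by (simp add: partial_deriv_eqI)
qed

lemma C1_compact_imp_continuous_compact:
  assumes "C1_compact f"
  shows "continuous_compact f" "continuous_compact (partial_deriv j f)"
proof -
  have "continuous_on UNIV f"
    using assms differentiable_imp_continuous_within continuous_at_imp_continuous_on
    unfolding C1_compact_def by blast
  then show "continuous_compact f" using assms by (simp add: continuous_compact_def C1_compact_def)
  obtain B where "\<forall>x\<in>{x. f x \<noteq> 0}. norm x \<le> B"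
    using assms unfolding C1_compact_def bounded_iff by blast
  then have B: "{x. f x \<noteq> 0} \<subseteq> cball 0 B" by auto
  then have "{x. partial_deriv j f x \<noteq> 0} \<subseteq> cball 0 B"
    using partial_deriv_eq_0[OF assms B] by (force simp: not_le)
  then show "continuous_compact (partial_deriv j f)"
    using assms bounded_subset[OF bounded_cball] by (auto simp: continuous_compact_def C1_compact_def)
qed

lemma continuous_compact_support:
  assumes "continuous_compact f" shows "\<exists>B>0. \<forall>x. norm x > B \<longrightarrow> f x = 0"
proof -
  obtain B where "B > 0" "\<And>x. f x \<noteq> 0 \<Longrightarrow> norm x \<le> B"
    using assms unfolding continuous_compact_def bounded_pos by auto
  then show ?thesis by force
qed

lemma continuous_compact_bounded:
  assumes "continuous_compact f" shows "\<exists>C\<ge>0. \<forall>x. \<bar>f x\<bar> \<le> C"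
proof -
  obtain B where B: "B > 0" "\<And>x. norm x > B \<Longrightarrow> f x = 0" using continuous_compact_support[OF assms] by blast
  have "compact (f ` cball 0 B)"
    using assms by (intro compact_continuous_image) (auto simp: continuous_compact_def intro: continuous_on_subset)
  then have "\<exists>C. \<forall>x\<in>cball 0 B. \<bar>f x\<bar> \<le> C"
    using compact_imp_bounded[of "f ` cball 0 B"] unfolding bounded_iff by auto
  then obtain C where C: "\<forall>x\<in>cball 0 B. \<bar>f x\<bar> \<le> C" by blast
  have "\<bar>f x\<bar> \<le> max C 0" for x
  proof (cases "norm x > B")
    case False
    then have "\<bar>f x\<bar> \<le> C" using C by auto
    then show ?thesis by simp
  qed (use B in auto)
  then show ?thesis by (intro exI[of _ "max C 0"]) auto
qed

lemma continuous_compact_uniform: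
  assumes f: "continuous_compact f" and "e > 0"
  shows "\<exists>d>0. \<forall>x y. norm (y - x) < d \<longrightarrow> \<bar>f y - f x\<bar> < e"
proof -
  obtain B where B: "B > 0" "\<And>x. norm x > B \<Longrightarrow> f x = 0" using continuous_compact_support[OF f] by blast
  \<comment> \<open>The margin 1 is for pairs with a point outside the larger ball: at distance
    below 1 both points then lie off the support.\<close>
  have "uniformly_continuous_on (cball 0 (B + 1)) f"
    using f by (intro compact_uniformly_continuous) (auto simp: continuous_compact_def intro: continuous_on_subset)
  then obtain d where d: "d > 0" "\<forall>x\<in>cball 0 (B+1). \<forall>y\<in>cball 0 (B+1). dist y x < d \<longrightarrow> dist (f y) (f x) < e"
    using \<open>e > 0\<close> unfolding uniformly_continuous_on_def by blast
  have "\<bar>f y - f x\<bar> < e" if "norm (y - x) < min d 1" for x y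
  proof (cases "norm x \<le> B + 1 \<and> norm y \<le> B + 1")
    case True then show ?thesis using d(2) that by (simp add: dist_norm dist_real_def)
  next
    case False
    moreover have "\<bar>norm y - norm x\<bar> \<le> norm (y - x)" by (rule norm_triangle_ineq3)
    ultimately have "norm x > B" "norm y > B" using that by auto
    then show ?thesis using B \<open>e > 0\<close> by simp
  qed
  then show ?thesis using d(1) by (intro exI[of _ "min d 1"]) auto
qed

lemma continuous_compact_measurable: "continuous_compact f \<Longrightarrow> f \<in> borel_measurable borel"
  unfolding continuous_compact_def by (auto intro: borel_measurable_continuous_onI)

lemma continuous_compact_integrable: 
  fixes f :: "real^'n \<Rightarrow> real"
  assumes "continuous_compact f" shows "integrable lborel f"
proof -
  obtain B where B: "B > 0" "\<And>x. norm x > B \<Longrightarrow> f x = 0" using continuous_compact_support[OF assms] by blast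
  obtain C where C: "C \<ge> 0" "\<And>x. \<bar>f x\<bar> \<le> C" using continuous_compact_bounded[OF assms] by blast
  show ?thesis
  proof (rule Bochner_Integration.integrable_bound)
    show "integrable lborel (\<lambda>x. C * indicator (cball (0::real^'n) B) x :: real)"
      using emeasure_compact_finite[of "cball (0::real^'n) B"]
      by (intro integrable_mult_right integrable_real_indicator) auto
    show "AE x in lborel. norm (f x) \<le> norm (C * indicator (cball 0 B) x :: real)"
      using B C by (intro AE_I2) (auto simp: indicator_def not_le)
  qed (use continuous_compact_measurable[OF assms] in simp)
qed

lemma continuous_compact_mult:
  assumes "continuous_compact f" "continuous_on UNIV g" shows "continuous_compact (\<lambda>x. f x * g x)"
  using assms bounded_subset[of "{x. f x \<noteq> 0}" "{x. f x * g x \<noteq> 0}"]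
  by (auto simp: continuous_compact_def intro!: continuous_on_mult)

lemma continuous_compact_integrable_mult:
  assumes f: "continuous_compact f" and u: "integrable lborel u"
  shows "integrable lborel (\<lambda>x. f x * u x)"
proof -
  obtain C where C: "C \<ge> 0" "\<And>x. \<bar>f x\<bar> \<le> C" using continuous_compact_bounded[OF f] by blast
  show ?thesis
  proof (rule Bochner_Integration.integrable_bound)
    show "integrable lborel (\<lambda>x. C * u x)" using u by simp
    show "AE x in lborel. norm (f x * u x) \<le> norm (C * u x)"
      using C by (intro AE_I2) (auto simp: abs_mult intro!: mult_right_mono)
    show "(\<lambda>x. f x * u x) \<in> borel_measurable lborel"
      using continuous_compact_measurable[OF f] borel_measurable_integrable[OF u] by simp
  qed
qed

lemma bounded_shift_support:
  fixes f :: "real^'n \<Rightarrow> real"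
  assumes "bounded {x. f x \<noteq> 0}" shows "bounded {x. f (x + a) \<noteq> 0}"
proof -
  have "{x. f (x + a) \<noteq> 0} = (\<lambda>x. x - a) ` {x. f x \<noteq> 0}"
    by (force simp: image_iff intro: exI[of _ "_ + a"])
  then show ?thesis using assms by (simp add: bounded_translation_minus)
qed

lemma continuous_compact_shift:
  assumes "continuous_compact f" shows "continuous_compact (\<lambda>x. f (x + a))"
proof -
  have "continuous_on UNIV (\<lambda>x. x + a)" by (intro continuous_intros)
  then show ?thesis
    using assms bounded_shift_support[of f a] continuous_on_compose2[of UNIV f UNIV "\<lambda>x. x + a"]
    by (simp add: continuous_compact_def)
qed

text \<open>The mean value inequality for f minus its linearisation at x, with uniformly continuous
  partial derivatives. Uniformity in x is what allows differentiation under an integral against a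
  merely integrable function.\<close>

lemma C1_compact_uniform_linear:
  assumes f: "C1_compact f" and "e > 0"
  shows "\<exists>d>0. \<forall>x k. norm k < d \<longrightarrow> \<bar>f (x + k) - f x - (\<Sum>j\<in>UNIV. k $ j * partial_deriv j f x)\<bar> \<le> e * norm k"
proof -
  define n where "n = real CARD('a)"
  have n: "n > 0" by (simp add: n_def)
  have "\<exists>d>0. \<forall>x y. norm (y - x) < d \<longrightarrow> \<bar>partial_deriv j f y - partial_deriv j f x\<bar> < e / n" for j
    using C1_compact_imp_continuous_compact(2)[OF f] n \<open>e > 0\<close> by (intro continuous_compact_uniform) auto
  then obtain d where d: "\<And>j. d j > 0"
    "\<And>j x y. norm (y - x) < d j \<Longrightarrow> \<bar>partial_deriv j f y - partial_deriv j f x\<bar> < e / n" by metis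
  define D where "D = Min (range d)"
  have D: "D > 0" "\<And>j. D \<le> d j" using d(1) by (auto simp: D_def)
  have "\<bar>f (x + k) - f x - (\<Sum>j\<in>UNIV. k $ j * partial_deriv j f x)\<bar> \<le> e * norm k" if k: "norm k < D" for x k
  proof -
    define g where "g y = f y - (\<Sum>j\<in>UNIV. (y - x) $ j * partial_deriv j f x)" for y
    have "norm (g (x + k) - g x) \<le> e * norm ((x + k) - x)"
    proof (rule differentiable_bound[of "ball x D" g
          "\<lambda>y h. (\<Sum>j\<in>UNIV. h $ j * (partial_deriv j f y - partial_deriv j f x))"])
      fix y assume y: "y \<in> ball x D"
      have "(g has_derivative (\<lambda>h. (\<Sum>j\<in>UNIV. h $ j * partial_deriv j f y) - (\<Sum>j\<in>UNIV. h $ j * partial_deriv j f x))) (at y)"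
        unfolding g_def
        by (intro has_derivative_diff C1_compact_has_derivative[OF f])
           (auto intro!: derivative_eq_intros bounded_linear.has_derivative[OF bounded_linear_vec_nth] simp: vector_minus_component)
      then show "(g has_derivative (\<lambda>h. (\<Sum>j\<in>UNIV. h $ j * (partial_deriv j f y - partial_deriv j f x)))) (at y within ball x D)"
        unfolding right_diff_distrib sum_subtractf by (rule has_derivative_at_withinI)
      show "onorm (\<lambda>h. (\<Sum>j\<in>UNIV. h $ j * (partial_deriv j f y - partial_deriv j f x))) \<le> e"
      proof (rule onorm_bound)
        fix h :: "real^'a"
        have "norm (\<Sum>j\<in>UNIV. h $ j * (partial_deriv j f y - partial_deriv j f x))
           \<le> (\<Sum>j\<in>(UNIV::'a set). norm h * (e / n))"
        proof (intro sum_norm_le)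
          fix j
          have "norm (y - x) < d j" using y D(2)[of j] by (simp add: dist_norm norm_minus_commute)
          then have "\<bar>partial_deriv j f y - partial_deriv j f x\<bar> \<le> e / n" using d(2)[of y x j] by simp
          then show "norm (h $ j * (partial_deriv j f y - partial_deriv j f x)) \<le> norm h * (e / n)"
            unfolding norm_mult using component_le_norm_cart[of h j] by (intro mult_mono) auto
        qed
        also have "\<dots> = e * norm h" using n by (simp add: n_def)
        finally show "norm (\<Sum>j\<in>UNIV. h $ j * (partial_deriv j f y - partial_deriv j f x)) \<le> e * norm h" .
      qed (use \<open>e > 0\<close> in simp)
    qed (use k D in \<open>auto simp: dist_norm\<close>)
    then show ?thesis by (simp add: g_def)
  qed
  then show ?thesis using D(1) by blast
qed

lemma lborel_integral_shift:
  fixes f :: "'a::euclidean_space \<Rightarrow> real"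
  assumes [measurable]: "f \<in> borel_measurable borel"
  shows "(LINT x|lborel. f (x + a)) = (LINT x|lborel. f x)"
proof -
  have "(LINT x|lborel. f x) = (LINT x|distr lborel borel ((+) a). f x)" by (simp add: lborel_distr_plus)
  also have "\<dots> = (LINT x|lborel. f (a + x))" by (subst integral_distr) auto
  finally show ?thesis by (simp add: add.commute)
qed

definition diff_quot :: "'n \<Rightarrow> real \<Rightarrow> (real^'n \<Rightarrow> real) \<Rightarrow> real^'n \<Rightarrow> real" where
  "diff_quot j s f x = (f (x + s *\<^sub>R axis j 1) - f x) / s"

lemma continuous_compact_diff_quot:
  assumes "continuous_compact f" shows "continuous_compact (diff_quot j s f)"
proof -
  let ?S = "{x. f (x + s *\<^sub>R axis j 1) \<noteq> 0} \<union> {x. f x \<noteq> 0}"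
  have "bounded ?S"
    using continuous_compact_shift[OF assms, of "s *\<^sub>R axis j 1"] assms by (simp add: continuous_compact_def)
  moreover have "{x. diff_quot j s f x \<noteq> 0} \<subseteq> ?S" by (auto simp: diff_quot_def)
  ultimately have "bounded {x. diff_quot j s f x \<noteq> 0}" by (rule bounded_subset)
  moreover have "continuous_on UNIV (diff_quot j s f)"
    unfolding diff_quot_def[abs_def] divide_inverse
    using continuous_compact_shift[OF assms, of "s *\<^sub>R axis j 1"] assms
    by (intro continuous_intros) (auto simp: continuous_compact_def)
  ultimately show ?thesis by (simp add: continuous_compact_def)
qed

text \<open>Integration by parts for difference quotients is translation invariance of the integral;
  moving the shift to the other factor reverses its sign.\<close>

lemma integral_diff_quot_swap:
  assumes f: "continuous_compact f" and g: "continuous_compact g"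
  shows "(LINT x|lborel. diff_quot j s f x * g x) = - (LINT x|lborel. f x * diff_quot j (- s) g x)"
proof -
  let ?a = "s *\<^sub>R axis j 1"
  have cg: "continuous_on UNIV g" using g by (simp add: continuous_compact_def)
  have i1: "integrable lborel (\<lambda>x. f (x + ?a) * g x)" "integrable lborel (\<lambda>x. f x * g x)"
    by (intro continuous_compact_integrable continuous_compact_mult continuous_compact_shift f cg)+
  have i2: "integrable lborel (\<lambda>x. f x * g (x - ?a))"
    using continuous_compact_shift[OF g, of "- ?a"]
    by (intro continuous_compact_integrable continuous_compact_mult f) (simp add: continuous_compact_def)
  have "(LINT x|lborel. f (x + ?a) * g x) = (LINT x|lborel. f x * g (x - ?a))"
    using lborel_integral_shift[of "\<lambda>x. f x * g (x - ?a)" ?a] borel_measurable_integrable[OF i2] by simp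
  then have "(LINT x|lborel. f (x + ?a) * g x - f x * g x) = (LINT x|lborel. f x * g (x - ?a) - f x * g x)"
    using i1 i2 by simp
  then have "(LINT x|lborel. f (x + ?a) * g x - f x * g x) / s = (LINT x|lborel. f x * g (x - ?a) - f x * g x) / s"
    by simp
  then show ?thesis
    unfolding integral_divide_zero[symmetric]
    by (simp add: diff_quot_def diff_divide_distrib left_diff_distrib right_diff_distrib flip: Bochner_Integration.integral_minus)
qed

text \<open>The quotients converge uniformly, so the integral of |u| controls the error.\<close>

lemma diff_quot_tendsto:
  assumes f: "C1_compact f" and u: "integrable lborel u"
    and s: "s \<longlonglongrightarrow> 0" "\<And>n. s n \<noteq> 0"
  shows "(\<lambda>n. LINT x|lborel. diff_quot j (s n) f x * u x) \<longlonglongrightarrow> (LINT x|lborel. partial_deriv j f x * u x)"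
proof (rule LIMSEQ_I)
  fix r :: real assume "r > 0"
  define c where "c = (LINT x|lborel. \<bar>u x\<bar>)"
  have c: "c \<ge> 0" by (simp add: c_def)
  define e where "e = r / (c + 1) / 2"
  have e: "e > 0" using \<open>r > 0\<close> c by (simp add: e_def)
  have ec: "e * c < r" using \<open>r > 0\<close> c by (simp add: e_def field_simps add_nonneg_pos)
  note cc = C1_compact_imp_continuous_compact[OF f]
  obtain d where d: "d > 0" "\<And>x k. norm k < d \<Longrightarrow> \<bar>f (x + k) - f x - (\<Sum>j\<in>UNIV. k $ j * partial_deriv j f x)\<bar> \<le> e * norm k"
    using C1_compact_uniform_linear[OF f e] by blast
  obtain n0 where n0: "\<And>n. n \<ge> n0 \<Longrightarrow> \<bar>s n\<bar> < d"
    using LIMSEQ_D[OF s(1) d(1)] by auto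
  have "norm ((LINT x|lborel. diff_quot j (s n) f x * u x) - (LINT x|lborel. partial_deriv j f x * u x)) < r" if n: "n \<ge> n0" for n
  proof -
    have pt: "\<bar>diff_quot j (s n) f x - partial_deriv j f x\<bar> \<le> e" for x
    proof -
      have "(\<Sum>i\<in>UNIV. (s n *\<^sub>R axis j 1) $ i * partial_deriv i f x) = s n * partial_deriv j f x"
        by (simp add: axis_def if_distrib[of "\<lambda>y. _ * y"] if_distrib[of "\<lambda>y. y * _"] cong: if_cong)
      then have "\<bar>f (x + s n *\<^sub>R axis j 1) - f x - s n * partial_deriv j f x\<bar> \<le> e * \<bar>s n\<bar>"
        using d(2)[of "s n *\<^sub>R axis j 1" x] n0[OF n] by simp
      moreover have "diff_quot j (s n) f x - partial_deriv j f x = (f (x + s n *\<^sub>R axis j 1) - f x - s n * partial_deriv j f x) / s n"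
        using s(2)[of n] by (simp add: diff_quot_def diff_divide_distrib)
      ultimately show ?thesis using s(2)[of n] by (simp add: divide_le_eq)
    qed
    have i: "integrable lborel (\<lambda>x. diff_quot j (s n) f x * u x)" "integrable lborel (\<lambda>x. partial_deriv j f x * u x)"
      by (intro continuous_compact_integrable_mult continuous_compact_diff_quot cc u)+
    have "(LINT x|lborel. diff_quot j (s n) f x * u x) - (LINT x|lborel. partial_deriv j f x * u x)
        = (LINT x|lborel. (diff_quot j (s n) f x - partial_deriv j f x) * u x)"
      using i by (simp add: left_diff_distrib)
    also have "norm \<dots> \<le> (LINT x|lborel. norm ((diff_quot j (s n) f x - partial_deriv j f x) * u x))"
      by (rule integral_norm_bound)
    also have "\<dots> \<le> (LINT x|lborel. e * \<bar>u x\<bar>)"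
    proof (rule integral_mono)
      show "integrable lborel (\<lambda>x. norm ((diff_quot j (s n) f x - partial_deriv j f x) * u x))"
        using Bochner_Integration.integrable_diff[OF i] by (intro integrable_norm) (simp add: left_diff_distrib)
      show "integrable lborel (\<lambda>x. e * \<bar>u x\<bar>)" using u by simp
      show "norm ((diff_quot j (s n) f x - partial_deriv j f x) * u x) \<le> e * \<bar>u x\<bar>" for x
        using pt[of x] by (simp add: abs_mult mult_right_mono)
    qed
    also have "\<dots> = e * c" by (simp add: c_def)
    finally show ?thesis using ec by simp
  qed
  then show "\<exists>no. \<forall>n\<ge>no. norm ((LINT x|lborel. diff_quot j (s n) f x * u x) - (LINT x|lborel. partial_deriv j f x * u x)) < r"
    by blast
qed

lemma inverse_Suc_tendsto: "(\<lambda>n. 1 / real (Suc n)) \<longlonglongrightarrow> 0" "(\<lambda>n. - (1 / real (Suc n))) \<longlonglongrightarrow> 0"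
  using LIMSEQ_inverse_real_of_nat tendsto_minus[OF LIMSEQ_inverse_real_of_nat]
  by (simp_all add: inverse_eq_divide)

text \<open>The limit of \<open>integral_diff_quot_swap\<close> along the steps 1/(n+1), which
  reappear as -1/(n+1) on the other factor.\<close>

theorem integral_by_parts:
  assumes f: "C1_compact f" and g: "C1_compact g"
  shows "(LINT x|lborel. partial_deriv j f x * g x) = - (LINT x|lborel. f x * partial_deriv j g x)"
proof -
  note cf = C1_compact_imp_continuous_compact(1)[OF f] and cg = C1_compact_imp_continuous_compact(1)[OF g]
  have "(\<lambda>n. LINT x|lborel. diff_quot j (1 / real (Suc n)) f x * g x) \<longlonglongrightarrow> (LINT x|lborel. partial_deriv j f x * g x)"
    by (intro diff_quot_tendsto f continuous_compact_integrable cg inverse_Suc_tendsto) auto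
  moreover have "(\<lambda>n. - (LINT x|lborel. diff_quot j (- (1 / real (Suc n))) g x * f x)) \<longlonglongrightarrow> - (LINT x|lborel. partial_deriv j g x * f x)"
    by (intro tendsto_minus diff_quot_tendsto g continuous_compact_integrable cf inverse_Suc_tendsto) auto
  ultimately show ?thesis
    using integral_diff_quot_swap[OF cf cg] by (simp add: LIMSEQ_unique mult.commute)
qed

lemma integral_partial_deriv_0:
  fixes f :: "real^'n \<Rightarrow> real"
  assumes f: "C1_compact f"
  shows "(LINT x|lborel. partial_deriv j f x) = 0"
proof -
  note cf = C1_compact_imp_continuous_compact[OF f]
  obtain B where B: "{x. f x \<noteq> 0} \<subseteq> cball 0 B"
    using continuous_compact_support[OF cf(1)] by (force simp: not_less[symmetric])
  \<comment> \<open>The radius B + 1 covers the support and its shifts by at most 1, so the cutoff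
    leaves the difference quotients unchanged while providing an integrable partner.\<close>
  define u :: "real^'n \<Rightarrow> real" where "u = indicator (cball 0 (B + 1))"
  have u: "integrable lborel u"
    using emeasure_compact_finite[of "cball (0::real^'n) (B + 1)"]
    unfolding u_def by (intro integrable_real_indicator) auto
  have "(\<lambda>n. LINT x|lborel. diff_quot j (1 / real (Suc n)) f x * u x) \<longlonglongrightarrow> (LINT x|lborel. partial_deriv j f x * u x)"
    by (intro diff_quot_tendsto f u inverse_Suc_tendsto) auto
  moreover have "partial_deriv j f x * u x = partial_deriv j f x" for x
    using partial_deriv_eq_0[OF f B, of x j] by (auto simp: u_def indicator_def)
  moreover have "(LINT x|lborel. diff_quot j (1 / real (Suc n)) f x * u x) = 0" for n
  proof -
    let ?a = "(1 / real (Suc n)) *\<^sub>R axis j (1::real)"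
    have eq: "diff_quot j (1 / real (Suc n)) f x * u x = diff_quot j (1 / real (Suc n)) f x" for x
    proof (cases "norm x \<le> B + 1")
      case False
      have "norm ?a \<le> 1" by (simp add: norm_axis_1)
      moreover have "norm x - norm ?a \<le> norm (x + ?a)"
        using norm_triangle_ineq2[of x "- ?a"] by (simp only: diff_minus_eq_add norm_minus_cancel)
      ultimately have "norm (x + ?a) > B" using False by linarith
      then have "f (x + ?a) = 0" "f x = 0" using B False by force+
      then show ?thesis by (simp add: diff_quot_def)
    qed (simp add: u_def)
    have "(LINT x|lborel. diff_quot j (1 / real (Suc n)) f x * u x) = (LINT x|lborel. diff_quot j (1 / real (Suc n)) f x)"
      by (simp only: eq)
    also have "\<dots> = ((LINT x|lborel. f (x + ?a)) - (LINT x|lborel. f x)) / (1 / real (Suc n))"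
      unfolding diff_quot_def integral_divide_zero
      using continuous_compact_integrable[OF cf(1)] continuous_compact_integrable[OF continuous_compact_shift[OF cf(1), of ?a]]
      by (subst Bochner_Integration.integral_diff) auto
    also have "\<dots> = 0"
      using lborel_integral_shift[OF continuous_compact_measurable[OF cf(1)], of ?a] by simp
    finally show ?thesis .
  qed
  ultimately show ?thesis by (simp add: LIMSEQ_const_iff)
qed

lemma C1_compact_diff_quot:
  assumes f: "C1_compact f"
  shows "C1_compact (diff_quot j s f)" "partial_deriv i (diff_quot j s f) = diff_quot j s (partial_deriv i f)"
proof -
  have hd: "(diff_quot j s f has_derivative (\<lambda>k. ((\<Sum>j\<in>UNIV. k $ j * partial_deriv j f (x + s *\<^sub>R axis j' 1)) 
       - (\<Sum>j\<in>UNIV. k $ j * partial_deriv j f x)) / s)) (at x)" if "j' = j" for x j'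
    unfolding that diff_quot_def[abs_def] divide_inverse
    by (intro has_derivative_mult_left has_derivative_diff C1_compact_has_derivative[OF f]
        has_derivative_compose[OF _ C1_compact_has_derivative[OF f], where f="\<lambda>x. x + s *\<^sub>R axis j 1", simplified])
      (auto intro!: derivative_eq_intros)
  show eq: "partial_deriv i (diff_quot j s f) = diff_quot j s (partial_deriv i f)" for i
  proof
    fix x
    have ax: "(\<Sum>j\<in>UNIV. axis i 1 $ j * partial_deriv j f y) = partial_deriv i f y" for y
      by (simp add: axis_def if_distrib[of "\<lambda>y. y * _"] cong: if_cong)
    show "partial_deriv i (diff_quot j s f) x = diff_quot j s (partial_deriv i f) x"
      using partial_deriv_eqI[OF hd[OF refl], of i x] by (simp only: ax diff_quot_def)
  qed
  show "C1_compact (diff_quot j s f)"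
    unfolding C1_compact_def eq
    using hd continuous_compact_diff_quot[OF C1_compact_imp_continuous_compact(1)[OF f], of j s]
      continuous_compact_diff_quot[OF C1_compact_imp_continuous_compact(2)[OF f], of j s]
    by (auto simp: continuous_compact_def differentiable_def)
qed

text \<open>Formally two integrations by parts exchange the indices. Both functions are only C^1, so
  a difference quotient stands in for one derivative until the limit.\<close>

theorem integral_partial_deriv_swap:
  assumes v: "C1_compact v" and \<phi>: "C1_compact \<phi>"
  shows "(LINT x|lborel. partial_deriv i v x * partial_deriv j \<phi> x) = (LINT x|lborel. partial_deriv j v x * partial_deriv i \<phi> x)"
proof -
  note cv = C1_compact_imp_continuous_compact[OF v] and cp = C1_compact_imp_continuous_compact[OF \<phi>]
  define s where "s n = 1 / real (Suc n)" for n
  have l1: "(\<lambda>n. LINT x|lborel. diff_quot j (s n) \<phi> x * partial_deriv i v x) \<longlonglongrightarrow> (LINT x|lborel. partial_deriv j \<phi> x * partial_deriv i v x)"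
    unfolding s_def by (intro diff_quot_tendsto \<phi> continuous_compact_integrable cv inverse_Suc_tendsto) auto
  have l2: "(\<lambda>n. LINT x|lborel. diff_quot j (- s n) v x * partial_deriv i \<phi> x) \<longlonglongrightarrow> (LINT x|lborel. partial_deriv j v x * partial_deriv i \<phi> x)"
    unfolding s_def by (intro diff_quot_tendsto v continuous_compact_integrable cp inverse_Suc_tendsto) auto
  have "(LINT x|lborel. diff_quot j (s n) \<phi> x * partial_deriv i v x) = (LINT x|lborel. diff_quot j (- s n) v x * partial_deriv i \<phi> x)" for n
  proof -
    have "(LINT x|lborel. diff_quot j (s n) \<phi> x * partial_deriv i v x) = (LINT x|lborel. partial_deriv i v x * diff_quot j (s n) \<phi> x)"
      by (simp add: mult.commute)
    also have "\<dots> = - (LINT x|lborel. v x * diff_quot j (s n) (partial_deriv i \<phi>) x)"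
      using integral_by_parts[OF v C1_compact_diff_quot(1)[OF \<phi>]] by (simp only: C1_compact_diff_quot(2)[OF \<phi>])
    also have "\<dots> = (LINT x|lborel. diff_quot j (- s n) v x * partial_deriv i \<phi> x)"
      using integral_diff_quot_swap[OF cv(1) cp(2), of j "- s n" i] by simp
    finally show ?thesis .
  qed
  with l1 l2 show ?thesis by (simp add: LIMSEQ_unique mult.commute)
qed

section \<open>Convolution with continuously differentiable kernels of bounded support\<close>

definition convolve :: "(real^'n \<Rightarrow> real) \<Rightarrow> (real^'n \<Rightarrow> real) \<Rightarrow> real^'n \<Rightarrow> real" where
  "convolve \<eta> h x = (LINT y|lborel. \<eta> (x - y) * h y)"

lemma continuous_compact_reflect:
  assumes "continuous_compact f" shows "continuous_compact (\<lambda>y. f (x - y))"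
proof -
  have "{y. f (x - y) \<noteq> 0} = (\<lambda>z. x - z) ` {z. f z \<noteq> 0}"
    by (force simp: image_iff intro: exI[of _ "x - _"])
  moreover have "bounded ((\<lambda>z. x - z) ` {z. f z \<noteq> 0})"
  proof -
    have "(\<lambda>z. x - z) ` {z. f z \<noteq> 0} = (\<lambda>z. x + z) ` uminus ` {z. f z \<noteq> 0}" by (auto simp: image_image)
    then show ?thesis using assms by (simp add: continuous_compact_def bounded_translation)
  qed
  moreover have "continuous_on UNIV (\<lambda>y. x - y)" by (intro continuous_intros)
  ultimately show ?thesis
    using assms continuous_on_compose2[of UNIV f UNIV "\<lambda>y. x - y"]
    by (simp add: continuous_compact_def)
qed

text \<open>The kernel takes the derivative and h is only integrable: the uniform linearisation
  error of the kernel is integrated against |h|.\<close>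

theorem convolve_has_derivative:
  assumes \<eta>: "C1_compact \<eta>" and h: "integrable lborel h"
  shows "(convolve \<eta> h has_derivative (\<lambda>k. \<Sum>j\<in>UNIV. k $ j * convolve (partial_deriv j \<eta>) h x)) (at x)"
proof -
  note c = C1_compact_imp_continuous_compact[OF \<eta>]
  have i: "integrable lborel (\<lambda>y. \<eta> (x - y) * h y)" "integrable lborel (\<lambda>y. partial_deriv j \<eta> (x - y) * h y)" for x j
    by (intro continuous_compact_integrable_mult continuous_compact_reflect c h)+
  show ?thesis
    unfolding has_derivative_at_alt
  proof (intro conjI allI impI)
    show "bounded_linear (\<lambda>k. \<Sum>j\<in>UNIV. k $ j * convolve (partial_deriv j \<eta>) h x)"
      by (intro bounded_linear_sum bounded_linear_mult_const bounded_linear_vec_nth)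
    fix e :: real assume "e > 0"
    define N where "N = (LINT y|lborel. \<bar>h y\<bar>)"
    have N: "N \<ge> 0" by (simp add: N_def)
    define e' where "e' = e / (N + 1)"
    have e': "e' > 0" "e' * N \<le> e" using \<open>e > 0\<close> N by (auto simp: e'_def field_simps)
    obtain d where d: "d > 0" "\<And>x k. norm k < d \<Longrightarrow> \<bar>\<eta> (x + k) - \<eta> x - (\<Sum>j\<in>UNIV. k $ j * partial_deriv j \<eta> x)\<bar> \<le> e' * norm k"
      using C1_compact_uniform_linear[OF \<eta> e'(1)] by blast
    have "norm (convolve \<eta> h z - convolve \<eta> h x - (\<Sum>j\<in>UNIV. (z - x) $ j * convolve (partial_deriv j \<eta>) h x)) \<le> e * norm (z - x)"
      if z: "norm (z - x) < d" for z
    proof -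
      define k where "k = z - x"
      define E where "E y = \<eta> (z - y) * h y - \<eta> (x - y) * h y - (\<Sum>j\<in>UNIV. k $ j * (partial_deriv j \<eta> (x - y) * h y))" for y
      have iE: "integrable lborel E" unfolding E_def by (intro Bochner_Integration.integrable_diff Bochner_Integration.integrable_sum integrable_mult_right i)
      have "convolve \<eta> h z - convolve \<eta> h x - (\<Sum>j\<in>UNIV. k $ j * convolve (partial_deriv j \<eta>) h x) = (LINT y|lborel. E y)"
        unfolding E_def convolve_def
        by (subst Bochner_Integration.integral_diff Bochner_Integration.integral_sum
            | intro i Bochner_Integration.integrable_diff Bochner_Integration.integrable_sum integrable_mult_right)+ simp
      also have "norm \<dots> \<le> (LINT y|lborel. norm (E y))" by (rule integral_norm_bound)
      also have "\<dots> \<le> (LINT y|lborel. (e' * norm k) * \<bar>h y\<bar>)"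
      proof (rule integral_mono)
        show "norm (E y) \<le> (e' * norm k) * \<bar>h y\<bar>" for y
        proof -
          have "E y = (\<eta> ((x - y) + k) - \<eta> (x - y) - (\<Sum>j\<in>UNIV. k $ j * partial_deriv j \<eta> (x - y))) * h y"
          proof -
            have zk: "(x - y) + k = z - y" by (simp add: k_def)
            show ?thesis unfolding zk unfolding E_def left_diff_distrib sum_distrib_right by (simp only: mult.assoc)
          qed
          then show ?thesis using d(2)[of k "x - y"] z by (simp add: abs_mult k_def mult_right_mono)
        qed
      qed (use iE h in auto)
      also have "\<dots> = (e' * N) * norm k" by (simp add: N_def)
      also have "\<dots> \<le> e * norm k" using e' by (intro mult_right_mono) auto
      finally show ?thesis by (simp add: k_def)
    qed
    then show "\<exists>d>0. \<forall>y. norm (y - x) < d \<longrightarrow> norm (convolve \<eta> h y - convolve \<eta> h x - (\<Sum>j\<in>UNIV. (y - x) $ j * convolve (partial_deriv j \<eta>) h x)) \<le> e * norm (y - x)"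
      using d(1) by blast
  qed
qed

subsection \<open>Mollification\<close>

text \<open>Membership in \<open>bump_algebra\<close> settles the smoothness of linear combinations,
  so only their supports have to be followed.\<close>

definition bump_tests :: "(real^'n) set \<Rightarrow> (real^'n \<Rightarrow> real) set" where
  "bump_tests \<Omega> = test_functions \<Omega> \<inter> bump_algebra"

lemma bump_tests_lincomb:
  assumes "\<phi> \<in> bump_tests \<Omega>" "\<psi> \<in> bump_tests \<Omega>"
  shows "(\<lambda>x. a * \<phi> x + b * \<psi> x) \<in> bump_tests \<Omega>"
proof -
  have alg: "(\<lambda>x. a * \<phi> x + b * \<psi> x) \<in> bump_algebra"
    using assms by (intro bump_algebra.intros) (auto simp: bump_tests_def)
  let ?S = "closure {x. \<phi> x \<noteq> 0} \<union> closure {x. \<psi> x \<noteq> 0}"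
  have cS: "compact ?S" "?S \<subseteq> \<Omega>" using assms by (auto simp: bump_tests_def test_functions_def)
  have "{x. a * \<phi> x + b * \<psi> x \<noteq> 0} \<subseteq> {x. \<phi> x \<noteq> 0} \<union> {x. \<psi> x \<noteq> 0}" by auto
  also have "\<dots> \<subseteq> ?S" by (intro Un_mono closure_subset)
  finally have sub: "closure {x. a * \<phi> x + b * \<psi> x \<noteq> 0} \<subseteq> ?S"
    by (intro closure_minimal) (auto simp: compact_imp_closed cS)
  have "compact (closure {x. a * \<phi> x + b * \<psi> x \<noteq> 0})"
    using cS(1) sub by (meson bounded_subset closed_closure compact_eq_bounded_closed)
  then show ?thesis
    using alg sub cS(2) bump_algebra_C_k[OF alg] by (auto simp: bump_tests_def test_functions_def)
qed

lemma box_bump_bump_tests: "s > 0 \<Longrightarrow> cbox a b \<subseteq> \<Omega> \<Longrightarrow> box_bump s a b \<in> bump_tests \<Omega>"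
  by (simp add: bump_tests_def box_bump_test box_bump_algebra)

lemma zero_bump_tests: "(\<lambda>x. 0) \<in> bump_tests \<Omega>"
  using bump_algebra_C_k[OF bump_algebra.const]
  by (auto simp: bump_tests_def test_functions_def intro: bump_algebra.const)

lemma bump_tests_C1_compact: "\<phi> \<in> bump_tests \<Omega> \<Longrightarrow> C1_compact \<phi>"
  by (auto simp: bump_tests_def intro: test_function_C1_compact)

lemma continuous_compact_square_integrable:
  assumes f: "continuous_compact f" shows "square_integrable lborel f"
proof -
  have "continuous_compact (\<lambda>x. f x * f x)"
    using f by (intro continuous_compact_mult) (auto simp: continuous_compact_def)
  from continuous_compact_integrable[OF this] show ?thesis
    using continuous_compact_measurable[OF f] by (simp add: square_integrable_def power2_eq_square)
qed

lemma square_integrable_imp_integrable: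
  fixes f :: "'a::euclidean_space \<Rightarrow> real"
  assumes f: "square_integrable lborel f" and "bounded \<Omega>" "\<And>x. x \<notin> \<Omega> \<Longrightarrow> f x = 0"
  shows "integrable lborel f"
proof -
  obtain B where "\<forall>x\<in>\<Omega>. norm x \<le> B" using \<open>bounded \<Omega>\<close> unfolding bounded_iff by blast
  then have B: "\<Omega> \<subseteq> cball 0 B" by auto
  show ?thesis
  proof (rule Bochner_Integration.integrable_bound)
    have "integrable lborel (indicator (cball (0::'a) B) :: 'a \<Rightarrow> real)"
      using emeasure_compact_finite[of "cball (0::'a) B"] by (intro integrable_real_indicator) auto
    then show "integrable lborel (\<lambda>x. indicator (cball 0 B) x + (f x)\<^sup>2)"
      using f by (simp add: square_integrable_def)
    show "f \<in> borel_measurable lborel" using f by (simp add: square_integrable_def)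
    show "AE x in lborel. norm (f x) \<le> norm (indicator (cball 0 B) x + (f x)\<^sup>2)"
    proof (rule AE_I2)
      fix x
      have "\<bar>f x\<bar> \<le> 1 + (f x)\<^sup>2"
        using sum_squares_bound[of "1" "\<bar>f x\<bar>"] by simp
      then show "norm (f x) \<le> norm (indicator (cball 0 B) x + (f x)\<^sup>2)"
        using B assms(3)[of x] by (cases "x \<in> \<Omega>") (auto simp: indicator_def)
    qed
  qed
qed

text \<open>Density from orthogonality: what is left of h after projecting on the tests is
  orthogonal to all of them, so it vanishes almost everywhere in \<Omega> by the fundamental lemma.
  Mollification cannot be the argument here, since \<open>convolve_tendsto\<close> rests on this
  theorem.\<close>

theorem bump_tests_dense:
  fixes h :: "real^'n \<Rightarrow> real"
  assumes "open \<Omega>" "bounded \<Omega>" and h: "square_integrable lborel h" "\<And>x. x \<notin> \<Omega> \<Longrightarrow> h x = 0" and "e > 0"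
  shows "\<exists>\<phi>\<in>bump_tests \<Omega>. sq_norm lborel (\<lambda>x. h x - \<phi> x) < e"
proof -
  have sq: "square_integrable lborel y" if "y \<in> bump_tests \<Omega>" for y
    using that by (intro continuous_compact_square_integrable C1_compact_imp_continuous_compact bump_tests_C1_compact)
  have "\<exists>g y. square_integrable lborel g \<and> (\<forall>n. y n \<in> bump_tests \<Omega>) \<and> (\<lambda>n. sq_norm lborel (\<lambda>x. y n x - g x)) \<longlonglongrightarrow> 0
     \<and> (\<forall>z\<in>bump_tests \<Omega>. sq_inner lborel (\<lambda>x. h x - g x) z = 0)"
  proof (rule square_integrable_projection[OF h(1) sq])
    show "bump_tests \<Omega> \<noteq> {}" using zero_bump_tests by blast
    show "(\<lambda>x. a *\<^sub>R y x + b *\<^sub>R z x) \<in> bump_tests \<Omega>" if "y \<in> bump_tests \<Omega>" "z \<in> bump_tests \<Omega>" for y z a b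
      using bump_tests_lincomb[OF that] by simp
  qed
  then obtain g y where g: "square_integrable lborel g" "\<And>n. y n \<in> bump_tests \<Omega>"
    "(\<lambda>n. sq_norm lborel (\<lambda>x. y n x - g x)) \<longlonglongrightarrow> 0" "\<And>z. z \<in> bump_tests \<Omega> \<Longrightarrow> sq_inner lborel (\<lambda>x. h x - g x) z = 0"
    by blast
  have [measurable]: "\<Omega> \<in> sets borel" using \<open>open \<Omega>\<close> by auto
  define d where "d x = indicator \<Omega> x * (h x - g x)" for x
  have [measurable]: "h \<in> borel_measurable borel" "g \<in> borel_measurable borel"
    using h g by (auto simp: square_integrable_def)
  have [measurable]: "d \<in> borel_measurable borel" unfolding d_def[abs_def] by measurable
  have hg: "square_integrable lborel (\<lambda>x. h x - g x)" by (intro square_integrable_diff h g)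
  have "square_integrable lborel d"
  proof -
    have "integrable lborel (\<lambda>x. indicator \<Omega> x *\<^sub>R (h x - g x)\<^sup>2)"
      using hg by (intro integrable_mult_indicator) (auto simp: square_integrable_def)
    moreover have "(d x)\<^sup>2 = indicator \<Omega> x *\<^sub>R (h x - g x)\<^sup>2" for x by (simp add: d_def indicator_def)
    ultimately show ?thesis by (simp add: square_integrable_def)
  qed
  then have "integrable lborel d"
    by (rule square_integrable_imp_integrable[OF _ \<open>bounded \<Omega>\<close>]) (simp add: d_def)
  then have "AE x in lborel. x \<in> \<Omega> \<longrightarrow> d x = 0"
  proof (rule fundamental_lemma[OF \<open>open \<Omega>\<close>])
    fix \<phi> assume "\<phi> \<in> test_functions \<Omega>" "\<phi> \<in> bump_algebra"
    then have \<phi>: "\<phi> \<in> bump_tests \<Omega>" by (simp add: bump_tests_def)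
    have "\<phi> x = 0" if "x \<notin> \<Omega>" for x
      using \<phi> that closure_subset[of "{x. \<phi> x \<noteq> 0}"] by (auto simp: bump_tests_def test_functions_def)
    then have eq: "d x * \<phi> x = (h x - g x) \<bullet> \<phi> x" for x by (auto simp: d_def indicator_def)
    show "(LINT x|lborel. d x * \<phi> x) = 0" using g(4)[OF \<phi>] by (simp only: sq_inner_def eq)
  qed
  then have hgO: "AE x in lborel. x \<in> \<Omega> \<longrightarrow> h x = g x" by eventually_elim (auto simp: d_def)
  \<comment> \<open>The limit g is not known to vanish off \<Omega>, whereas h and
    \<open>y n\<close> do; hence an inequality and not an equality.\<close>
  have "sq_norm lborel (\<lambda>x. h x - y n x) \<le> sq_norm lborel (\<lambda>x. y n x - g x)" for n
    unfolding sq_norm_def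
  proof (rule integral_mono_AE)
    show "integrable lborel (\<lambda>x. (norm (h x - y n x))\<^sup>2)" "integrable lborel (\<lambda>x. (norm (y n x - g x))\<^sup>2)"
      using square_integrable_diff[OF h(1) sq[OF g(2)[of n]]] square_integrable_diff[OF sq[OF g(2)[of n]] g(1)]
      by (auto simp: square_integrable_def)
    show "AE x in lborel. (norm (h x - y n x))\<^sup>2 \<le> (norm (y n x - g x))\<^sup>2"
      using hgO
    proof eventually_elim
      case (elim x)
      have "y n x = 0" if "x \<notin> \<Omega>"
        using g(2)[of n] that closure_subset[of "{x. y n x \<noteq> 0}"] by (auto simp: bump_tests_def test_functions_def)
      then show ?case using elim h(2)[of x] by (cases "x \<in> \<Omega>") (auto simp: power2_commute)
    qed
  qed
  moreover obtain n where "sq_norm lborel (\<lambda>x. y n x - g x) < e"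
    using LIMSEQ_D[OF g(3) \<open>e > 0\<close>] by auto
  ultimately show ?thesis using g(2) by (meson le_less_trans)
qed

lemma lborel_integral_reflect:
  fixes f :: "'a::euclidean_space \<Rightarrow> real"
  assumes [measurable]: "f \<in> borel_measurable borel"
  shows "(LINT x|lborel. f (a - x)) = (LINT x|lborel. f x)"
proof -
  have eq: "distr lborel borel (\<lambda>x. a - x) = lborel"
    using lborel_affine[of "-1" a] by (simp add: density_1)
  have "(LINT x|lborel. f x) = (LINT x|distr lborel borel (\<lambda>x. a - x). f x)" by (simp only: eq)
  also have "\<dots> = (LINT x|lborel. f (a - x))" by (subst integral_distr) auto
  finally show ?thesis by simp
qed

definition averaging_kernel :: "(real^'n \<Rightarrow> real) \<Rightarrow> bool" where
  "averaging_kernel \<eta> \<longleftrightarrow> C1_compact \<eta> \<and> (\<forall>x. \<eta> x \<ge> 0) \<and> (LINT x|lborel. \<eta> x) = 1"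

lemma convolve_measurable:
  assumes "C1_compact \<eta>" "integrable lborel h"
  shows "convolve \<eta> h \<in> borel_measurable borel"
proof -
  have "continuous_on UNIV (convolve \<eta> h)"
    by (intro continuous_at_imp_continuous_on ballI has_derivative_continuous[OF convolve_has_derivative[OF assms]])
  then show ?thesis by (rule borel_measurable_continuous_onI)
qed

text \<open>Jensen's inequality is the nonnegativity of the variance of h for the weight \<eta> (x -
  y). Integrating it over x and exchanging the order of integration gives the contraction.\<close>

theorem convolve_square_integrable:
  fixes h :: "real^'n \<Rightarrow> real"
  assumes \<eta>: "averaging_kernel \<eta>" and h: "square_integrable lborel h" "integrable lborel h"
  shows "square_integrable lborel (convolve \<eta> h)" "sq_norm lborel (convolve \<eta> h) \<le> sq_norm lborel h"
proof -
  have C1: "C1_compact \<eta>" and \<eta>0: "\<And>x. \<eta> x \<ge> 0" and \<eta>1: "(LINT x|lborel. \<eta> x) = 1"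
    using \<eta> by (auto simp: averaging_kernel_def)
  note cc = C1_compact_imp_continuous_compact(1)[OF C1]
  have [measurable]: "\<eta> \<in> borel_measurable borel" by (rule continuous_compact_measurable[OF cc])
  have [measurable]: "h \<in> borel_measurable borel" using h by (simp add: square_integrable_def)
  have [measurable]: "convolve \<eta> h \<in> borel_measurable borel" by (rule convolve_measurable[OF C1 h(2)])
  have h2: "integrable lborel (\<lambda>y. (h y)\<^sup>2)" using h(1) by (simp add: square_integrable_def)
  have i: "integrable lborel (\<lambda>y. \<eta> (x - y) * h y)" "integrable lborel (\<lambda>y. \<eta> (x - y) * (h y)\<^sup>2)"
    "integrable lborel (\<lambda>y. \<eta> (x - y))" for x
    by (intro continuous_compact_integrable_mult continuous_compact_integrable continuous_compact_reflect cc h h2)+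
  have mass: "(LINT y|lborel. \<eta> (x - y)) = 1" for x using lborel_integral_reflect[of \<eta> x] \<eta>1 by simp
  have Jensen: "(convolve \<eta> h x)\<^sup>2 \<le> (LINT y|lborel. \<eta> (x - y) * (h y)\<^sup>2)" for x
  proof -
    define m where "m = convolve \<eta> h x"
    have "0 \<le> (LINT y|lborel. \<eta> (x - y) * (h y - m)\<^sup>2)" using \<eta>0 by (intro integral_nonneg_AE AE_I2) auto
    also have "\<dots> = (LINT y|lborel. \<eta> (x - y) * (h y)\<^sup>2 - 2 * m * (\<eta> (x - y) * h y) + m\<^sup>2 * \<eta> (x - y))"
      by (intro Bochner_Integration.integral_cong) (auto simp: power2_eq_square algebra_simps)
    also have "\<dots> = (LINT y|lborel. \<eta> (x - y) * (h y)\<^sup>2) - 2 * m * m + m\<^sup>2"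
      using i mass[of x] by (simp add: m_def convolve_def)
    finally show ?thesis by (simp add: m_def power2_eq_square)
  qed
  have "(\<integral>\<^sup>+x. ennreal ((norm (convolve \<eta> h x))\<^sup>2) \<partial>lborel) \<le> (\<integral>\<^sup>+x. (\<integral>\<^sup>+y. ennreal (\<eta> (x - y) * (h y)\<^sup>2) \<partial>lborel) \<partial>lborel)"
  proof (rule nn_integral_mono)
    fix x
    have "(\<integral>\<^sup>+y. ennreal (\<eta> (x - y) * (h y)\<^sup>2) \<partial>lborel) = ennreal (LINT y|lborel. \<eta> (x - y) * (h y)\<^sup>2)"
      using i \<eta>0 by (intro nn_integral_eq_integral) auto
    then show "ennreal ((norm (convolve \<eta> h x))\<^sup>2) \<le> (\<integral>\<^sup>+y. ennreal (\<eta> (x - y) * (h y)\<^sup>2) \<partial>lborel)"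
      using Jensen[of x] by (simp add: ennreal_leI)
  qed
  also have "\<dots> = (\<integral>\<^sup>+y. (\<integral>\<^sup>+x. ennreal (\<eta> (x - y) * (h y)\<^sup>2) \<partial>lborel) \<partial>lborel)"
    by (rule lborel_pair.Fubini'[symmetric]) measurable
  also have "\<dots> = (\<integral>\<^sup>+y. ennreal ((h y)\<^sup>2) \<partial>lborel)"
  proof (rule nn_integral_cong)
    fix y
    have "(\<integral>\<^sup>+x. ennreal (\<eta> (x - y) * (h y)\<^sup>2) \<partial>lborel) = (\<integral>\<^sup>+x. ennreal (\<eta> (x - y)) \<partial>lborel) * ennreal ((h y)\<^sup>2)"
      using \<eta>0 by (subst nn_integral_multc[symmetric]) (auto simp: ennreal_mult)
    also have "(\<integral>\<^sup>+x. ennreal (\<eta> (x - y)) \<partial>lborel) = ennreal (LINT x|lborel. \<eta> (x - y))"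
      using \<eta>0 continuous_compact_integrable[OF continuous_compact_shift[OF cc, of "-y"]]
      by (intro nn_integral_eq_integral) auto
    also have "(LINT x|lborel. \<eta> (x - y)) = 1" using lborel_integral_shift[of \<eta> "-y"] \<eta>1 by simp
    finally show "(\<integral>\<^sup>+x. ennreal (\<eta> (x - y) * (h y)\<^sup>2) \<partial>lborel) = ennreal ((h y)\<^sup>2)" by simp
  qed
  also have "\<dots> = ennreal (sq_norm lborel h)" using nn_integral_sq_norm[OF h(1)] by simp
  finally have le: "(\<integral>\<^sup>+x. ennreal ((norm (convolve \<eta> h x))\<^sup>2) \<partial>lborel) \<le> ennreal (sq_norm lborel h)" .
  then show s: "square_integrable lborel (convolve \<eta> h)"
    by (intro square_integrableI_nn_integral) (auto intro: le_less_trans)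
  show "sq_norm lborel (convolve \<eta> h) \<le> sq_norm lborel h"
    using le nn_integral_sq_norm[OF s] by (simp add: ennreal_le_iff)
qed

lemma convolve_diff:
  assumes "C1_compact \<eta>" "integrable lborel f" "integrable lborel g"
  shows "convolve \<eta> (\<lambda>y. f y - g y) x = convolve \<eta> f x - convolve \<eta> g x"
proof -
  note cc = C1_compact_imp_continuous_compact(1)[OF assms(1)]
  have "integrable lborel (\<lambda>y. \<eta> (x - y) * f y)" "integrable lborel (\<lambda>y. \<eta> (x - y) * g y)"
    by (intro continuous_compact_integrable_mult continuous_compact_reflect cc assms)+
  then show ?thesis by (simp add: convolve_def right_diff_distrib)
qed

lemma convolve_approx:
  assumes \<phi>: "continuous_compact \<phi>" and \<eta>: "averaging_kernel \<eta>"
    and d: "\<And>x. \<eta> x \<noteq> 0 \<Longrightarrow> norm x < d" "\<And>x y. norm (y - x) < d \<Longrightarrow> \<bar>\<phi> y - \<phi> x\<bar> < e"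
  shows "\<bar>convolve \<eta> \<phi> x - \<phi> x\<bar> \<le> e"
proof -
  have C1: "C1_compact \<eta>" and \<eta>0: "\<And>x. \<eta> x \<ge> 0" and \<eta>1: "(LINT x|lborel. \<eta> x) = 1"
    using \<eta> by (auto simp: averaging_kernel_def)
  note cc = C1_compact_imp_continuous_compact(1)[OF C1]
  have [measurable]: "\<eta> \<in> borel_measurable borel" by (rule continuous_compact_measurable[OF cc])
  have i: "integrable lborel (\<lambda>y. \<eta> (x - y) * \<phi> y)" "integrable lborel (\<lambda>y. \<eta> (x - y))"
    by (intro continuous_compact_integrable_mult continuous_compact_integrable continuous_compact_reflect cc \<phi>)+
  have mass: "(LINT y|lborel. \<eta> (x - y)) = 1" using lborel_integral_reflect[of \<eta> x] \<eta>1 by simp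
  have "convolve \<eta> \<phi> x - \<phi> x = (LINT y|lborel. \<eta> (x - y) * \<phi> y - \<phi> x * \<eta> (x - y))"
    using i mass by (simp add: convolve_def)
  also have "norm \<dots> \<le> (LINT y|lborel. norm (\<eta> (x - y) * \<phi> y - \<phi> x * \<eta> (x - y)))"
    by (rule integral_norm_bound)
  also have "\<dots> \<le> (LINT y|lborel. e * \<eta> (x - y))"
  proof (rule integral_mono)
    show "integrable lborel (\<lambda>y. norm (\<eta> (x - y) * \<phi> y - \<phi> x * \<eta> (x - y)))" using i by (intro integrable_norm) auto
    show "integrable lborel (\<lambda>y. e * \<eta> (x - y))" using i by auto
    fix y
    have "norm (\<eta> (x - y) * \<phi> y - \<phi> x * \<eta> (x - y)) = \<eta> (x - y) * \<bar>\<phi> y - \<phi> x\<bar>"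
    proof -
      have "\<eta> (x - y) * \<phi> y - \<phi> x * \<eta> (x - y) = \<eta> (x - y) * (\<phi> y - \<phi> x)" by (simp add: algebra_simps)
      then show ?thesis using \<eta>0[of "x - y"] by (simp only: real_norm_def abs_mult abs_of_nonneg)
    qed
    also have "\<dots> \<le> \<eta> (x - y) * e"
    proof (cases "\<eta> (x - y) = 0")
      case False
      then have "norm (y - x) < d" using d(1)[of "x - y"] by (simp add: norm_minus_commute)
      then show ?thesis using d(2)[of y x] \<eta>0[of "x - y"] by (intro mult_left_mono) auto
    qed simp
    finally show "norm (\<eta> (x - y) * \<phi> y - \<phi> x * \<eta> (x - y)) \<le> e * \<eta> (x - y)" by (simp add: mult.commute)
  qed
  also have "\<dots> = e" using mass by simp
  finally show ?thesis by simp
qed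

lemma square_integrable_indicator:
  fixes f :: "'a::euclidean_space \<Rightarrow> real"
  assumes f: "square_integrable lborel f" and A [measurable]: "A \<in> sets borel"
  shows "square_integrable lborel (\<lambda>x. indicator A x * f x)" "sq_norm lborel (\<lambda>x. indicator A x * f x) \<le> sq_norm lborel f"
proof -
  have [measurable]: "f \<in> borel_measurable borel" using f by (simp add: square_integrable_def)
  have "integrable lborel (\<lambda>x. indicator A x *\<^sub>R (f x)\<^sup>2)"
    using f by (intro integrable_mult_indicator) (auto simp: square_integrable_def)
  moreover have "(indicator A x * f x)\<^sup>2 = indicator A x *\<^sub>R (f x)\<^sup>2" for x by (simp add: indicator_def)
  ultimately show s: "square_integrable lborel (\<lambda>x. indicator A x * f x)" by (simp add: square_integrable_def)
  show "sq_norm lborel (\<lambda>x. indicator A x * f x) \<le> sq_norm lborel f"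
    unfolding sq_norm_def using s f by (intro integral_mono) (auto simp: square_integrable_def indicator_def)
qed

text \<open>h is compared with a test function \<phi>: convolution contracts h - \<phi>, and \<phi>
  is uniformly continuous. On \<Omega>, of finite measure, a uniform bound is also a bound in the
  norm, hence the indicator.\<close>

theorem convolve_tendsto:
  fixes h :: "real^'n \<Rightarrow> real"
  assumes \<Omega>: "open \<Omega>" "bounded \<Omega>" and h: "square_integrable lborel h" "\<And>x. x \<notin> \<Omega> \<Longrightarrow> h x = 0" and "e > 0"
  shows "\<exists>d>0. \<forall>\<eta>. averaging_kernel \<eta> \<longrightarrow> (\<forall>x. \<eta> x \<noteq> 0 \<longrightarrow> norm x < d) \<longrightarrow>
     sqrt (sq_norm lborel (\<lambda>x. indicator \<Omega> x * (convolve \<eta> h x - h x))) \<le> e"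
proof -
  have [measurable]: "\<Omega> \<in> sets borel" using \<Omega> by auto
  have hi: "integrable lborel h" by (rule square_integrable_imp_integrable[OF h(1) \<Omega>(2) h(2)])
  \<comment> \<open>The error is shared out as e/4 for h - \<phi>, e/4 for its convolution and e/2
    for \<phi>.\<close>
  define e1 where "e1 = (e / 4)\<^sup>2"
  have "e1 > 0" using \<open>e > 0\<close> by (simp add: e1_def)
  then obtain \<phi> where \<phi>: "\<phi> \<in> bump_tests \<Omega>" "sq_norm lborel (\<lambda>x. h x - \<phi> x) < e1"
    using bump_tests_dense[OF \<Omega> h] by blast
  have small: "sqrt (sq_norm lborel (\<lambda>x. h x - \<phi> x)) \<le> e / 4"
    using \<phi>(2) \<open>e > 0\<close> by (intro real_le_lsqrt) (auto simp: e1_def)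
  have cc: "continuous_compact \<phi>" by (intro C1_compact_imp_continuous_compact bump_tests_C1_compact[OF \<phi>(1)])
  note \<phi>s = continuous_compact_square_integrable[OF cc] and \<phi>i = continuous_compact_integrable[OF cc]
  define v where "v = measure lborel \<Omega>"
  have finO: "emeasure lborel \<Omega> < \<infinity>" using emeasure_bounded_finite[OF \<Omega>(2)] by simp
  define e2 where "e2 = e / (2 * (sqrt v + 1))"
  define w where "w = sqrt v"
  have w: "w \<ge> 0" by (simp add: w_def v_def)
  have e2: "e2 > 0" "e2 * sqrt v \<le> e / 2"
    using \<open>e > 0\<close> w unfolding e2_def w_def[symmetric] by (auto simp: field_simps add_nonneg_pos)
  obtain d where d: "d > 0" "\<forall>x y. norm (y - x) < d \<longrightarrow> \<bar>\<phi> y - \<phi> x\<bar> < e2"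
    using continuous_compact_uniform[OF cc e2(1)] by blast
  have "sqrt (sq_norm lborel (\<lambda>x. indicator \<Omega> x * (convolve \<eta> h x - h x))) \<le> e"
    if \<eta>: "averaging_kernel \<eta>" and supp: "\<forall>x. \<eta> x \<noteq> 0 \<longrightarrow> norm x < d" for \<eta>
  proof -
    have C1: "C1_compact \<eta>" using \<eta> by (simp add: averaging_kernel_def)
    have hp: "square_integrable lborel (\<lambda>x. h x - \<phi> x)" "integrable lborel (\<lambda>x. h x - \<phi> x)"
      using h(1) hi \<phi>s \<phi>i by (auto intro: square_integrable_diff)
    define A where "A x = indicator \<Omega> x * convolve \<eta> (\<lambda>x. h x - \<phi> x) x" for x
    define B where "B x = indicator \<Omega> x * (convolve \<eta> \<phi> x - \<phi> x)" for x
    define C where "C x = indicator \<Omega> x * (\<phi> x - h x)" for x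
    have sA: "square_integrable lborel A" "sq_norm lborel A \<le> sq_norm lborel (\<lambda>x. h x - \<phi> x)"
      unfolding A_def using square_integrable_indicator[OF convolve_square_integrable(1)[OF \<eta> hp], of \<Omega>]
        convolve_square_integrable(2)[OF \<eta> hp] by auto
    have sB: "square_integrable lborel B"
      unfolding B_def by (intro square_integrable_indicator square_integrable_diff convolve_square_integrable \<eta> \<phi>s \<phi>i) auto
    have "sq_norm lborel B \<le> (LINT x|lborel. e2\<^sup>2 * indicator \<Omega> x)"
      unfolding sq_norm_def
    proof (rule integral_mono)
      show "integrable lborel (\<lambda>x. (norm (B x))\<^sup>2)" using sB by (simp add: square_integrable_def)
      show "integrable lborel (\<lambda>x. e2\<^sup>2 * indicator \<Omega> x :: real)"
        using finO by (intro integrable_mult_right integrable_real_indicator) auto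
      fix x
      have "\<bar>convolve \<eta> \<phi> x - \<phi> x\<bar> \<le> e2" using convolve_approx[OF cc \<eta>, of d e2] supp d(2) by blast
      then have "\<bar>convolve \<eta> \<phi> x - \<phi> x\<bar>\<^sup>2 \<le> e2\<^sup>2" by (intro power_mono) auto
      then show "(norm (B x))\<^sup>2 \<le> e2\<^sup>2 * indicator \<Omega> x" by (auto simp: B_def indicator_def)
    qed
    also have "\<dots> = e2\<^sup>2 * v" by (simp add: v_def)
    finally have "sqrt (sq_norm lborel B) \<le> sqrt (e2\<^sup>2 * v)" by simp
    also have "\<dots> = e2 * sqrt v" using e2 by (simp add: real_sqrt_mult)
    finally have nB: "sqrt (sq_norm lborel B) \<le> e / 2" using e2 by simp
    have sC: "square_integrable lborel C" "sq_norm lborel C \<le> sq_norm lborel (\<lambda>x. h x - \<phi> x)"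
      unfolding C_def using square_integrable_indicator[OF square_integrable_diff[OF \<phi>s h(1)], of \<Omega>] sq_norm_minus_commute[of lborel \<phi> h] by auto
    have "(\<lambda>x. indicator \<Omega> x * (convolve \<eta> h x - h x)) = (\<lambda>x. (A x + B x) + C x)"
      by (auto simp: A_def B_def C_def convolve_diff[OF C1 hi \<phi>i] algebra_simps)
    moreover have "sqrt (sq_norm lborel (\<lambda>x. (A x + B x) + C x)) \<le> sqrt (sq_norm lborel A) + sqrt (sq_norm lborel B) + sqrt (sq_norm lborel C)"
      using sqrt_sq_norm_triangle[OF square_integrable_add[OF sA(1) sB] sC(1)] sqrt_sq_norm_triangle[OF sA(1) sB] by linarith
    moreover have "sqrt (sq_norm lborel A) \<le> e / 4" "sqrt (sq_norm lborel C) \<le> e / 4"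
      using sA(2) sC(2) small real_sqrt_le_mono order_trans by blast+
    ultimately show ?thesis using nB by simp
  qed
  then show ?thesis using d(1) by blast
qed

text \<open>The kernel lives on a cube of half side \<delta>, and the Euclidean norm is at most the
  sum of the absolute coordinates; this gives the radius. Reflected translates are again multiples
  of box bumps, so they are tests wherever the ball fits.\<close>

lemma exists_averaging_kernel:
  fixes \<Omega> :: "(real^'n) set"
  assumes "\<delta> > 0"
  shows "\<exists>\<eta> :: real^'n \<Rightarrow> real. averaging_kernel \<eta> \<and> (\<forall>x. \<eta> x \<noteq> 0 \<longrightarrow> norm x < real CARD('n) * \<delta>)
    \<and> (\<forall>x \<Omega>. cball x (real CARD('n) * \<delta>) \<subseteq> \<Omega> \<longrightarrow> (\<lambda>y. \<eta> (x - y)) \<in> bump_tests \<Omega>)"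
proof -
  let ?v = "(\<chi> i. \<delta>) :: real^'n"
  define b where "b = box_bump 1 (- ?v) ?v"
  define c where "c = (LINT x|lborel. b x)"
  have b: "b \<in> bump_tests UNIV" unfolding b_def by (intro box_bump_bump_tests) auto
  have cc: "continuous_compact b" by (intro C1_compact_imp_continuous_compact bump_tests_C1_compact[OF b])
  have bi: "integrable lborel b" by (rule continuous_compact_integrable[OF cc])
  have b0: "b x \<ge> 0" for x by (simp add: b_def box_bump_bounds)
  have bnz: "b x \<noteq> 0 \<longleftrightarrow> x \<in> box (- ?v) ?v" for x unfolding b_def by (intro box_bump_nonzero_iff) simp
  have c: "c > 0"
  proof -
    have "c \<noteq> 0"
    proof
      assume "c = 0"
      then have "AE x in lborel. b x = 0"
        using integral_nonneg_eq_0_iff_AE[OF bi] b0 by (simp add: c_def)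
      then have "AE x in lborel. x \<notin> box (- ?v) ?v" by eventually_elim (use bnz in blast)
      then have "emeasure lborel (box (- ?v) ?v) = 0"
        by (subst (asm) AE_iff_measurable[OF _ refl]) auto
      moreover have "emeasure lborel (box (- ?v) ?v) = ennreal (\<Prod>b\<in>Basis. (?v - (- ?v)) \<bullet> b)"
        using \<open>\<delta> > 0\<close> by (intro emeasure_lborel_box) (auto simp: Basis_vec_def inner_axis)
      moreover have "(\<Prod>b\<in>Basis. (?v - (- ?v)) \<bullet> b) > 0"
        using \<open>\<delta> > 0\<close> by (intro prod_pos) (auto simp: Basis_vec_def inner_axis)
      ultimately show False by (metis ennreal_eq_0_iff linorder_not_le)
    qed
    moreover have "c \<ge> 0" unfolding c_def using b0 by simp
    ultimately show ?thesis by simp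
  qed
  define \<eta> where "\<eta> x = b x / c" for x
  have \<eta>t: "\<eta> \<in> bump_tests UNIV" using bump_tests_lincomb[OF b b, of "1/c" 0] by (simp add: \<eta>_def[abs_def])
  have "averaging_kernel \<eta>"
    using bump_tests_C1_compact[OF \<eta>t] b0 c by (simp add: averaging_kernel_def) (simp add: \<eta>_def[abs_def] c_def)
  moreover have "norm x < real CARD('n) * \<delta>" if "\<eta> x \<noteq> 0" for x
  proof -
    have "x \<in> box (- ?v) ?v" using that bnz by (simp add: \<eta>_def)
    then have x: "\<bar>x $ i\<bar> < \<delta>" for i by (auto simp: mem_box_cart abs_less_iff minus_less_iff)
    have "norm x \<le> (\<Sum>i\<in>UNIV. \<bar>x $ i\<bar>)" by (rule norm_le_l1_cart)
    also have "\<dots> < (\<Sum>i\<in>(UNIV::'n set). \<delta>)" by (intro sum_strict_mono x) auto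
    finally show ?thesis by simp
  qed
  moreover have "(\<lambda>y. \<eta> (x - y)) \<in> bump_tests \<Omega>" if sub: "cball x (real CARD('n) * \<delta>) \<subseteq> \<Omega>" for x \<Omega>
  proof -
    have "(\<lambda>y. b (x - y)) = box_bump 1 (x - ?v) (x + ?v)"
      unfolding b_def box_bump_def fun_eq_iff
      by (intro allI prod.cong refl) (simp add: mult.commute algebra_simps)
    moreover have "cbox (x - ?v) (x + ?v) \<subseteq> \<Omega>"
    proof
      fix y assume "y \<in> cbox (x - ?v) (x + ?v)"
      then have y: "\<bar>(x - y) $ i\<bar> \<le> \<delta>" for i by (auto simp: mem_box_cart abs_le_iff algebra_simps)
      have "norm (x - y) \<le> (\<Sum>i\<in>UNIV. \<bar>(x - y) $ i\<bar>)" by (rule norm_le_l1_cart)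
      also have "\<dots> \<le> (\<Sum>i\<in>(UNIV::'n set). \<delta>)" by (intro sum_mono y)
      finally show "y \<in> \<Omega>" using sub by (auto simp: dist_norm)
    qed
    ultimately have "(\<lambda>y. b (x - y)) \<in> bump_tests \<Omega>"
      using box_bump_bump_tests[of 1 "x - ?v" "x + ?v" \<Omega>] by simp
    from bump_tests_lincomb[OF this this, of "1/c" 0] show ?thesis by (simp add: \<eta>_def)
  qed
  ultimately show ?thesis by blast
qed

subsection \<open>Friedrichs' inequality for weakly conjugate functions\<close>

text \<open>Lets \<open>friedrichs_holomorphic\<close> be applied on level t. Both radii are
  multiplied by t, so the constant stays the same.\<close>

lemma (in gauge_function) scaled:
  assumes "t > 0"
  shows "gauge_function (\<lambda>z. N z / t) (t * \<rho>) (t * R)"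
proof
  fix s :: real and z w :: complex
  show "s \<ge> 0 \<Longrightarrow> N (of_real s * z) / t = s * (N z / t)" by (simp add: homogeneous)
  show "N (z + w) / t \<le> N z / t + norm w / (t * \<rho>)"
    using N_add_le[of z w] assms divide_right_mono[of "N (z + w)" "N z + norm w / \<rho>" t]
    by (simp add: add_divide_distrib mult.commute)
  show "norm z / (t * R) \<le> N z / t"
    using divide_right_mono[OF N_lower[of z], of t] assms by (simp add: mult.commute)
qed (use assms rho_pos rho_le_R in auto)

lemma friedrichs_bound_scale: "t > 0 \<Longrightarrow> friedrichs_bound (t * \<rho>) (t * R) = friedrichs_bound \<rho> R"
  by (simp add: friedrichs_bound_def power_mult_distrib)

locale star_domain = gauge_function +
  fixes c :: "real^2" and \<Omega> :: "(real^2) set"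
  assumes Omega_eq: "\<Omega> = {x. N (complex_of (x - c)) < 1}"
begin

definition dilate :: "real \<Rightarrow> (real^2) set" where
  "dilate t = {x. N (complex_of (x - c)) < t}"

lemma open_dilate: "open (dilate t)"
  unfolding dilate_def
  by (intro open_Collect_less continuous_on_compose2[OF continuous_N] continuous_intros) auto

lemma dilate_measurable [measurable]: "dilate t \<in> sets borel"
  using open_dilate by auto

lemma open_Omega: "open \<Omega>" using open_dilate[of 1] by (simp add: Omega_eq dilate_def)

lemma bounded_dilate: "bounded (dilate t)"
proof (rule boundedI)
  fix x assume "x \<in> dilate t"
  then have "R * N (complex_of (x - c)) \<le> R * t" using R_pos by (auto simp: dilate_def)
  then have "norm (x - c) \<le> R * t" using norm_le_N[of "complex_of (x - c)"] by simp
  then show "norm x \<le> R * t + norm c" using norm_triangle_sub[of x c] by linarith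
qed

lemma bounded_Omega: "bounded \<Omega>" using bounded_dilate[of 1] by (simp add: Omega_eq dilate_def)

lemma dilate_subset_Omega: "t \<le> 1 \<Longrightarrow> dilate t \<subseteq> \<Omega>" by (auto simp: dilate_def Omega_eq)

lemma emeasure_dilate_finite: "emeasure lborel (dilate t) < \<infinity>"
  using emeasure_bounded_finite[OF bounded_dilate] by simp

text \<open>The Lipschitz bound of \<open>N\<close> plays the part of the distance to the boundary:
  between level t and level 1 there is room for \<rho> (1 - t).\<close>

lemma cball_subset_Omega:
  assumes "x \<in> dilate t" "d \<le> \<rho> * (1 - t)"
  shows "cball x d \<subseteq> \<Omega>"
proof
  fix y assume "y \<in> cball x d"
  then have "norm (y - x) \<le> \<rho> * (1 - t)" using assms by (simp add: dist_norm norm_minus_commute)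
  then have "norm (y - x) / \<rho> \<le> 1 - t" using rho_pos by (simp add: divide_le_eq mult.commute)
  moreover have "complex_of (y - c) = complex_of (x - c) + complex_of (y - x)"
    using linear_add[OF linear_complex_of, of "x - c" "y - x"] by simp
  then have "N (complex_of (y - c)) \<le> N (complex_of (x - c)) + norm (y - x) / \<rho>"
    using N_add_le[of "complex_of (x - c)" "complex_of (y - x)"] by simp
  ultimately show "y \<in> \<Omega>" using assms(1) by (simp add: Omega_eq dilate_def)
qed

text \<open>The weak form of the Cauchy-Riemann equations for h + \<i> g on \<Omega>, that is d_1 h
  = d_2 g and d_2 h = - d_1 g.\<close>

definition weakly_conjugate :: "(real^2 \<Rightarrow> real) \<Rightarrow> (real^2 \<Rightarrow> real) \<Rightarrow> bool" where
  "weakly_conjugate h g \<longleftrightarrow> (\<forall>\<phi>\<in>bump_tests \<Omega>.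
     (LINT x|lborel. partial_deriv 1 \<phi> x * h x) = (LINT x|lborel. partial_deriv 2 \<phi> x * g x) \<and>
     (LINT x|lborel. partial_deriv 2 \<phi> x * h x) = - (LINT x|lborel. partial_deriv 1 \<phi> x * g x))"

lemma partial_deriv_reflect:
  assumes "C1_compact \<eta>"
  shows "partial_deriv j (\<lambda>y. \<eta> (x - y)) y = - partial_deriv j \<eta> (x - y)"
proof -
  have "((\<lambda>y. x - y) has_derivative (\<lambda>k. - k)) (at y)" by (auto intro!: derivative_eq_intros)
  from has_derivative_compose[OF this C1_compact_has_derivative[OF assms]]
  have "((\<lambda>y. \<eta> (x - y)) has_derivative (\<lambda>k. \<Sum>j\<in>UNIV. (- k) $ j * partial_deriv j \<eta> (x - y))) (at y)" .
  from partial_deriv_eqI[OF this, of j] show ?thesis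
    by (simp add: axis_def if_distrib[of "\<lambda>y. y * _"] if_distrib[of uminus] sum_negf cong: if_cong)
qed

text \<open>The weak equations are tested with the reflected kernel centred at x. Its derivatives
  are those of \<eta> with a minus sign, which cancels, so the convolutions satisfy the classical
  equations at x.\<close>

lemma mollified_holomorphic:
  assumes conj: "weakly_conjugate h g" and h: "integrable lborel h" and g: "integrable lborel g"
    and \<eta>: "C1_compact \<eta>" and tests: "\<And>x. x \<in> dilate t \<Longrightarrow> (\<lambda>y. \<eta> (x - y)) \<in> bump_tests \<Omega>"
  shows "(\<lambda>z. Complex (convolve \<eta> h (c + plane_of z)) (convolve \<eta> g (c + plane_of z))) holomorphic_on {z. N z < t}"
    (is "?F holomorphic_on _")
proof -
  have "open {z. N z < t}" using open_sublevel[of t] by (simp add: sublevel_def)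
  moreover have "?F field_differentiable (at z)" if "N z < t" for z
  proof -
    define x where "x = c + plane_of z"
    have "x \<in> dilate t" using that by (simp add: x_def dilate_def)
    from tests[OF this] have \<phi>: "(\<lambda>y. \<eta> (x - y)) \<in> bump_tests \<Omega>" .
    let ?a = "\<lambda>j. convolve (partial_deriv j \<eta>) h x" and ?b = "\<lambda>j. convolve (partial_deriv j \<eta>) g x"
    have cr: "?a 1 = ?b 2" "?a 2 = - ?b 1"
      using conj \<phi> unfolding weakly_conjugate_def convolve_def
      by (auto simp: partial_deriv_reflect[OF \<eta>] dest!: bspec)
    have lin: "((\<lambda>z. c + plane_of z) has_derivative plane_of) (at z)"
      by (auto intro!: derivative_eq_intros bounded_linear_imp_has_derivative
          linear_plane_of[unfolded linear_conv_bounded_linear])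
    have "((\<lambda>z. convolve \<eta> h (c + plane_of z)) has_derivative (\<lambda>k. \<Sum>j\<in>UNIV. plane_of k $ j * ?a j)) (at z)"
      using has_derivative_compose[OF lin convolve_has_derivative[OF \<eta> h]] by (simp add: x_def)
    moreover have "((\<lambda>z. convolve \<eta> g (c + plane_of z)) has_derivative (\<lambda>k. \<Sum>j\<in>UNIV. plane_of k $ j * ?b j)) (at z)"
      using has_derivative_compose[OF lin convolve_has_derivative[OF \<eta> g]] by (simp add: x_def)
    ultimately have "(?F has_derivative (\<lambda>k. of_real (\<Sum>j\<in>UNIV. plane_of k $ j * ?a j)
        + \<i> * of_real (\<Sum>j\<in>UNIV. plane_of k $ j * ?b j))) (at z)"
      unfolding Complex_eq by (intro derivative_intros)
    moreover have "(\<lambda>k. of_real (\<Sum>j\<in>UNIV. plane_of k $ j * ?a j) + \<i> * of_real (\<Sum>j\<in>UNIV. plane_of k $ j * ?b j))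
       = (*) (Complex (?a 1) (?b 1))"
      by (auto simp: fun_eq_iff complex_eq_iff sum_2 cr algebra_simps)
    ultimately show ?thesis
      unfolding field_differentiable_def has_field_derivative_def by metis
  qed
  ultimately show ?thesis
    by (simp add: holomorphic_on_open field_differentiable_def)
qed

lemma integral_complex_plane:
  fixes f :: "real^2 \<Rightarrow> real"
  assumes [measurable]: "f \<in> borel_measurable borel"
  shows "(LINT z|lborel. f (c + plane_of z)) = (LINT x|lborel. f x)"
proof -
  have "(LINT z|lborel. f (c + plane_of z)) = (LINT z|distr lborel borel complex_of. f (c + plane_of z))"
    by (simp add: lborel_distr_complex_of)
  also have "\<dots> = (LINT x|lborel. f (c + x))" by (subst integral_distr) auto
  also have "\<dots> = (LINT x|lborel. f x)" using lborel_integral_shift[of f c] by (simp add: add.commute)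
  finally show ?thesis .
qed

lemma sq_norm_indicator: "sq_norm lborel (\<lambda>x. indicator A x * f x) = (LINT x|lborel. indicator A x * (f x)\<^sup>2)"
  for f :: "real^2 \<Rightarrow> real"
  unfolding sq_norm_def by (intro Bochner_Integration.integral_cong) (auto simp: indicator_def)

text \<open>The mollified pair is holomorphic beyond level t; the kernel shrinks first, then t tends
  to 1. The value at the centre, which has no meaning for h, is traded for the mean value on the
  way.\<close>

theorem friedrichs_weak:
  assumes conj: "weakly_conjugate h g"
    and h: "square_integrable lborel h" "\<And>x. x \<notin> \<Omega> \<Longrightarrow> h x = 0"
    and g: "square_integrable lborel g" "\<And>x. x \<notin> \<Omega> \<Longrightarrow> g x = 0"
    and mean: "(LINT x|lborel. h x) = 0"
  shows "sq_norm lborel h \<le> friedrichs_bound \<rho> R * sq_norm lborel g"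
proof -
  define \<Gamma> where "\<Gamma> = friedrichs_bound \<rho> R"
  have \<Gamma>: "\<Gamma> > 0" unfolding \<Gamma>_def by (rule friedrichs_bound_pos)
  have [measurable]: "h \<in> borel_measurable borel" "g \<in> borel_measurable borel"
    using h g by (auto simp: square_integrable_def)
  have hi: "integrable lborel h" and gi: "integrable lborel g"
    using square_integrable_imp_integrable[OF h(1) bounded_Omega h(2)]
      square_integrable_imp_integrable[OF g(1) bounded_Omega g(2)] by auto
  define G where "G = sqrt (\<Gamma> * sq_norm lborel g)"
  have ind_int: "integrable lborel (\<lambda>x. indicator (dilate t) x :: real)" for t
    using emeasure_dilate_finite[of t] by (intro integrable_real_indicator) auto
  have approx: "\<exists>a. sqrt (sq_norm lborel (\<lambda>x. indicator (dilate t) x * (h x - a))) \<le> G + e"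
    if t: "0 < t" "t < 1" and "e > 0" for t e
  proof -
    obtain d where d: "d > 0" "\<And>\<eta>. averaging_kernel \<eta> \<Longrightarrow> \<forall>x. \<eta> x \<noteq> 0 \<longrightarrow> norm x < d \<Longrightarrow>
      sqrt (sq_norm lborel (\<lambda>x. indicator \<Omega> x * (convolve \<eta> h x - h x))) \<le> e"
      using convolve_tendsto[OF open_Omega bounded_Omega h \<open>e > 0\<close>] by blast
    \<comment> \<open>Level t' leaves room on both sides: the kernel stays inside \<Omega>, and t'/t
      > 1 is the margin \<kappa> of \<open>friedrichs_holomorphic\<close>.\<close>
    define t' where "t' = (1 + t) / 2"
    have t': "t < t'" "t' < 1" using t by (auto simp: t'_def)
    define \<delta> where "\<delta> = min d (\<rho> * (1 - t')) / 2"
    have \<delta>: "\<delta> > 0" "2 * \<delta> \<le> d" "2 * \<delta> \<le> \<rho> * (1 - t')" using d(1) t' rho_pos by (auto simp: \<delta>_def)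
    obtain \<eta> :: "real^2 \<Rightarrow> real" where \<eta>: "averaging_kernel \<eta>" "\<And>x. \<eta> x \<noteq> 0 \<Longrightarrow> norm x < 2 * \<delta>"
      "\<And>x \<Omega>. cball x (2 * \<delta>) \<subseteq> \<Omega> \<Longrightarrow> (\<lambda>y. \<eta> (x - y)) \<in> bump_tests \<Omega>"
      using exists_averaging_kernel[OF \<delta>(1), where 'n=2] by auto
    have C1: "C1_compact \<eta>" using \<eta>(1) by (simp add: averaging_kernel_def)
    have close: "sqrt (sq_norm lborel (\<lambda>x. indicator \<Omega> x * (convolve \<eta> h x - h x))) \<le> e"
      using \<eta>(2) \<delta>(2) by (intro d(2) \<eta>(1)) fastforce
    define u where "u = convolve \<eta> h"
    define v where "v = convolve \<eta> g"
    have su: "square_integrable lborel u" and sv: "square_integrable lborel v" "sq_norm lborel v \<le> sq_norm lborel g"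
      unfolding u_def v_def using convolve_square_integrable[OF \<eta>(1)] h g hi gi by auto
    have [measurable]: "u \<in> borel_measurable borel" "v \<in> borel_measurable borel"
      using su sv by (auto simp: square_integrable_def)
    define F where "F z = Complex (u (c + plane_of z)) (v (c + plane_of z))" for z
    have holF: "F holomorphic_on {z. N z < t'}"
      unfolding F_def u_def v_def
      by (rule mollified_holomorphic[OF conj hi gi C1 \<eta>(3)]) (rule cball_subset_Omega[OF _ \<delta>(3)])
    interpret S: gauge_function "\<lambda>z. N z / t" "t * \<rho>" "t * R" by (rule scaled[OF t(1)])
    have set_eq: "{z. N z / t < t' / t} = {z. N z < t'}" using t by (simp add: divide_less_cancel)
    define a where "a = Re (F 0)"
    have ind: "indicator (S.sublevel 1) z = (indicator (dilate t) (c + plane_of z) :: real)" for z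
      using t by (auto simp: S.sublevel_def dilate_def indicator_def divide_less_eq)
    have "(LINT z|lborel. indicator (S.sublevel 1) z * (Re (F z) - Re (F 0))\<^sup>2)
      \<le> friedrichs_bound (t * \<rho>) (t * R) * (LINT z|lborel. indicator (S.sublevel 1) z * (Im (F z))\<^sup>2)"
      using holF t t' by (intro S.friedrichs_holomorphic[of "t' / t"]) (auto simp: set_eq)
    then have "(LINT z|lborel. indicator (dilate t) (c + plane_of z) * (u (c + plane_of z) - a)\<^sup>2)
      \<le> \<Gamma> * (LINT z|lborel. indicator (dilate t) (c + plane_of z) * (v (c + plane_of z))\<^sup>2)"
      using t by (simp only: ind friedrichs_bound_scale[OF t(1)] \<Gamma>_def[symmetric] a_def[symmetric]) (simp add: F_def)
    then have "sq_norm lborel (\<lambda>x. indicator (dilate t) x * (u x - a)) \<le> \<Gamma> * sq_norm lborel (\<lambda>x. indicator (dilate t) x * v x)"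
      using integral_complex_plane[of "\<lambda>x. indicator (dilate t) x * (u x - a)\<^sup>2"]
        integral_complex_plane[of "\<lambda>x. indicator (dilate t) x * (v x)\<^sup>2"]
      by (simp add: sq_norm_indicator)
    also have "\<dots> \<le> \<Gamma> * sq_norm lborel g"
      using \<Gamma> square_integrable_indicator(2)[OF sv(1), of "dilate t"] sv(2)
      by (intro mult_left_mono) auto
    finally have 1: "sqrt (sq_norm lborel (\<lambda>x. indicator (dilate t) x * (u x - a))) \<le> G" by (simp add: G_def)
    have s1: "square_integrable lborel (\<lambda>x. indicator (dilate t) x * (u x - a))"
    proof -
      have "square_integrable lborel (\<lambda>x. indicator (dilate t) x * a)"
      proof -
        have "(norm (indicator (dilate t) x * a))\<^sup>2 = a\<^sup>2 * indicator (dilate t) x" for x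
          by (simp add: indicator_def)
        then show ?thesis
          using integrable_mult_right[OF ind_int[of t], of "a\<^sup>2"] by (simp add: square_integrable_def)
      qed
      from square_integrable_diff[OF square_integrable_indicator(1)[OF su, of "dilate t"] this]
      show ?thesis by (simp add: right_diff_distrib)
    qed
    have s2: "square_integrable lborel (\<lambda>x. indicator \<Omega> x * (u x - h x))"
      using open_Omega by (intro square_integrable_indicator square_integrable_diff su h) auto
    have s3: "square_integrable lborel (\<lambda>x. indicator (dilate t) x * (indicator \<Omega> x * (u x - h x)))"
      "sq_norm lborel (\<lambda>x. indicator (dilate t) x * (indicator \<Omega> x * (u x - h x))) \<le> sq_norm lborel (\<lambda>x. indicator \<Omega> x * (u x - h x))"
      using square_integrable_indicator[OF s2, of "dilate t"] by auto
    have "(\<lambda>x. indicator (dilate t) x * (h x - a)) = 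
       (\<lambda>x. indicator (dilate t) x * (u x - a) - indicator (dilate t) x * (indicator \<Omega> x * (u x - h x)))"
      using dilate_subset_Omega[of t] t by (auto simp: fun_eq_iff indicator_def)
    moreover have "sqrt (sq_norm lborel (\<lambda>x. indicator (dilate t) x * (u x - a) - indicator (dilate t) x * (indicator \<Omega> x * (u x - h x))))
      \<le> sqrt (sq_norm lborel (\<lambda>x. indicator (dilate t) x * (u x - a))) + sqrt (sq_norm lborel (\<lambda>x. indicator (dilate t) x * (indicator \<Omega> x * (u x - h x))))"
      using sqrt_sq_norm_triangle[OF s1 square_integrable_scale[OF s3(1), of "-1"]] sq_norm_scale[of lborel "-1" "\<lambda>x. indicator (dilate t) x * (indicator \<Omega> x * (u x - h x))"]
      by simp
    moreover have "sqrt (sq_norm lborel (\<lambda>x. indicator (dilate t) x * (indicator \<Omega> x * (u x - h x)))) \<le> e"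
      using s3(2) close real_sqrt_le_mono order_trans unfolding u_def by blast
    ultimately have "sqrt (sq_norm lborel (\<lambda>x. indicator (dilate t) x * (h x - a))) \<le> G + e"
      using 1 by (simp only:)
    then show ?thesis by blast
  qed
  define v where "v t = measure lborel (dilate t)" for t
  define m where "m t = (LINT x|lborel. indicator (dilate t) x * h x)" for t
  define H where "H t = (LINT x|lborel. indicator (dilate t) x * (h x)\<^sup>2)" for t
  have ih: "integrable lborel (\<lambda>x. indicator (dilate t) x * h x)" "integrable lborel (\<lambda>x. indicator (dilate t) x * (h x)\<^sup>2)" for t
    using integrable_mult_indicator[OF _ hi, of "dilate t"] 
      integrable_mult_indicator[of "dilate t" lborel "\<lambda>x. (h x)\<^sup>2"] h(1) by (auto simp: square_integrable_def)
  \<comment> \<open>The constant a is out of control as e and t vary. After expanding the square,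
    2amv - a^2 v^2 \<le> m^2 removes it from the inequality.\<close>
  have var: "v t * H t \<le> (m t)\<^sup>2 + v t * (G + e)\<^sup>2" if t: "0 < t" "t < 1" and "e > 0" for t e
  proof -
    obtain a where a: "sqrt (sq_norm lborel (\<lambda>x. indicator (dilate t) x * (h x - a))) \<le> G + e"
      using approx[OF t \<open>e > 0\<close>] by blast
    have "sq_norm lborel (\<lambda>x. indicator (dilate t) x * (h x - a)) \<le> (G + e)\<^sup>2"
      using a by (rule sqrt_le_D)
    moreover have "sq_norm lborel (\<lambda>x. indicator (dilate t) x * (h x - a)) = H t - 2 * a * m t + a\<^sup>2 * v t"
    proof -
      have "sq_norm lborel (\<lambda>x. indicator (dilate t) x * (h x - a))
        = (LINT x|lborel. indicator (dilate t) x * (h x)\<^sup>2 - 2 * a * (indicator (dilate t) x * h x) + a\<^sup>2 * indicator (dilate t) x)"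
        unfolding sq_norm_indicator
        by (intro Bochner_Integration.integral_cong) (auto simp: power2_eq_square algebra_simps)
      also have "\<dots> = H t - 2 * a * m t + a\<^sup>2 * v t"
        using ih[of t] ind_int[of t] by (simp add: H_def m_def v_def)
      finally show ?thesis .
    qed
    ultimately have "H t - 2 * a * m t + a\<^sup>2 * v t \<le> (G + e)\<^sup>2" by simp
    then have "v t * (H t - 2 * a * m t + a\<^sup>2 * v t) \<le> v t * (G + e)\<^sup>2"
      by (intro mult_left_mono) (auto simp: v_def)
    moreover have "0 \<le> (m t - a * v t)\<^sup>2" by simp
    ultimately show ?thesis by (simp add: power2_eq_square algebra_simps)
  qed
  have var0: "v t * H t \<le> (m t)\<^sup>2 + v t * G\<^sup>2" if t: "0 < t" "t < 1" for t
  proof (rule LIMSEQ_le_const)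
    have "(\<lambda>n. (m t)\<^sup>2 + v t * (G + 1 / real (Suc n))\<^sup>2) \<longlonglongrightarrow> (m t)\<^sup>2 + v t * (G + 0)\<^sup>2"
      by (intro tendsto_intros inverse_Suc_tendsto)
    then show "(\<lambda>n. (m t)\<^sup>2 + v t * (G + 1 / real (Suc n))\<^sup>2) \<longlonglongrightarrow> (m t)\<^sup>2 + v t * G\<^sup>2" by simp
    show "\<exists>N. \<forall>n\<ge>N. v t * H t \<le> (m t)\<^sup>2 + v t * (G + 1 / real (Suc n))\<^sup>2"
      using var[OF t] by auto
  qed
  \<comment> \<open>\<open>s 0\<close> is 1/2 and not 0, as the levels have to be positive.\<close>
  define s where "s n = 1 - 1 / real (Suc (Suc n))" for n
  have s: "0 < s n" "s n < 1" for n by (auto simp: s_def field_simps)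
  have s_lim: "s \<longlonglongrightarrow> 1"
    unfolding s_def using tendsto_diff[OF tendsto_const LIMSEQ_Suc[OF inverse_Suc_tendsto(1)], of 1] by simp
  have ind_lim: "(\<lambda>n. indicator (dilate (s n)) x :: real) \<longlonglongrightarrow> indicator \<Omega> x" for x
  proof (cases "x \<in> \<Omega>")
    case True
    then have "\<forall>\<^sub>F n in sequentially. N (complex_of (x - c)) < s n"
      by (intro order_tendstoD(1)[OF s_lim]) (simp add: Omega_eq)
    then have "\<forall>\<^sub>F n in sequentially. indicator \<Omega> x = (indicator (dilate (s n)) x :: real)"
      by eventually_elim (use True in \<open>simp add: dilate_def\<close>)
    then show ?thesis by (rule Lim_transform_eventually[OF tendsto_const])
  next
    case False
    then have "indicator (dilate (s n)) x = (0 :: real)" for n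
      using dilate_subset_Omega[of "s n"] s(2)[of n] by (auto simp: indicator_def)
    then show ?thesis using False by simp
  qed
  have [measurable]: "\<Omega> \<in> sets borel" using open_Omega by auto
  have m_lim: "(\<lambda>n. m (s n)) \<longlonglongrightarrow> 0"
  proof -
    have "(\<lambda>n. m (s n)) \<longlonglongrightarrow> (LINT x|lborel. indicator \<Omega> x * h x)"
      unfolding m_def
    proof (rule integral_dominated_convergence[where w="\<lambda>x. norm (h x)"])
      show "AE x in lborel. (\<lambda>n. indicator (dilate (s n)) x * h x) \<longlonglongrightarrow> indicator \<Omega> x * h x"
        by (intro AE_I2 tendsto_mult ind_lim tendsto_const)
    qed (use hi in \<open>auto simp: indicator_def\<close>)
    also have "(LINT x|lborel. indicator \<Omega> x * h x) = (LINT x|lborel. h x)"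
      using h(2) by (intro Bochner_Integration.integral_cong) (auto simp: indicator_def)
    finally show ?thesis by (simp add: mean)
  qed
  have H_lim: "(\<lambda>n. H (s n)) \<longlonglongrightarrow> sq_norm lborel h"
  proof -
    have "(\<lambda>n. H (s n)) \<longlonglongrightarrow> (LINT x|lborel. indicator \<Omega> x * (h x)\<^sup>2)"
      unfolding H_def
    proof (rule integral_dominated_convergence[where w="\<lambda>x. (h x)\<^sup>2"])
      show "AE x in lborel. (\<lambda>n. indicator (dilate (s n)) x * (h x)\<^sup>2) \<longlonglongrightarrow> indicator \<Omega> x * (h x)\<^sup>2"
        by (intro AE_I2 tendsto_mult ind_lim tendsto_const)
    qed (use h(1) in \<open>auto simp: indicator_def square_integrable_def\<close>)
    also have "(LINT x|lborel. indicator \<Omega> x * (h x)\<^sup>2) = sq_norm lborel h"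
      unfolding sq_norm_def using h(2) by (intro Bochner_Integration.integral_cong) (auto simp: indicator_def)
    finally show ?thesis .
  qed
  have v_lim: "(\<lambda>n. v (s n)) \<longlonglongrightarrow> measure lborel \<Omega>"
  proof -
    have "(\<lambda>n. LINT x|lborel. indicator (dilate (s n)) x :: real) \<longlonglongrightarrow> (LINT x|lborel. indicator \<Omega> x)"
    proof (rule integral_dominated_convergence[where w="indicator (dilate 1)"])
      show "AE x in lborel. (\<lambda>n. indicator (dilate (s n)) x :: real) \<longlonglongrightarrow> indicator \<Omega> x"
        by (intro AE_I2 ind_lim)
      show "AE x in lborel. norm (indicator (dilate (s n)) x :: real) \<le> indicator (dilate 1) x" for n
        using s(2)[of n] by (intro AE_I2) (auto simp: indicator_def dilate_def)
    qed (use ind_int in auto)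
    then show ?thesis by (simp add: v_def)
  qed
  have "measure lborel \<Omega> * sq_norm lborel h \<le> 0\<^sup>2 + measure lborel \<Omega> * G\<^sup>2"
  proof (rule LIMSEQ_le)
    show "(\<lambda>n. v (s n) * H (s n)) \<longlonglongrightarrow> measure lborel \<Omega> * sq_norm lborel h" by (intro tendsto_intros v_lim H_lim)
    show "(\<lambda>n. (m (s n))\<^sup>2 + v (s n) * G\<^sup>2) \<longlonglongrightarrow> 0\<^sup>2 + measure lborel \<Omega> * G\<^sup>2" by (intro tendsto_intros v_lim m_lim)
  qed (use var0 s in blast)
  moreover have "measure lborel \<Omega> > 0"
  proof -
    have "c \<in> \<Omega>" by (simp add: Omega_eq linear_0[OF linear_complex_of])
    then obtain r where r: "r > 0" "ball c r \<subseteq> \<Omega>" using open_Omega open_contains_ball by blast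
    have "0 < measure lborel (ball c r)" using r by (simp add: content_ball_pos)
    also have "\<dots> \<le> measure lborel \<Omega>"
      using r emeasure_bounded_finite[OF bounded_Omega]
      by (intro measure_mono_fmeasurable) (auto simp: fmeasurable_def)
    finally show ?thesis .
  qed
  ultimately have "sq_norm lborel h \<le> G\<^sup>2" by simp
  also have "G\<^sup>2 = \<Gamma> * sq_norm lborel g" using \<Gamma> by (simp add: G_def)
  finally show ?thesis by (simp add: \<Gamma>_def)
qed

end

subsection \<open>The projection on gradients\<close>

definition gradient :: "(2 \<Rightarrow> real^2 \<Rightarrow> real) \<Rightarrow> real^2 \<Rightarrow> real^2^2" where
  "gradient v x = (\<chi> k j. partial_deriv j (v k) x)"

lemma gradient_nth [simp]: "gradient v x $ k $ j = partial_deriv j (v k) x"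
  by (simp add: gradient_def)

lemma norm_matrix_sq: "(norm A)\<^sup>2 = (\<Sum>k\<in>UNIV. \<Sum>j\<in>UNIV. (A $ k $ j)\<^sup>2)" for A :: "real^2^2"
  unfolding power2_norm_eq_inner by (simp add: inner_vec_def power2_eq_square)

lemma square_integrable_matrix_iff:
  fixes A :: "'a \<Rightarrow> real^2^2"
  shows "square_integrable M A \<longleftrightarrow> (\<forall>k j. square_integrable M (\<lambda>x. A x $ k $ j))"
proof
  assume A: "square_integrable M A"
  have [measurable]: "A \<in> borel_measurable M" using A by (simp add: square_integrable_def)
  have m: "(\<lambda>x. A x $ k $ j) \<in> borel_measurable M" for k j
    by (rule borel_measurable_continuous_on[of "\<lambda>B. B $ k $ j" A M]) (auto intro!: continuous_intros)
  show "\<forall>k j. square_integrable M (\<lambda>x. A x $ k $ j)"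
  proof (intro allI)
    fix k j
    have "integrable M (\<lambda>x. (A x $ k $ j)\<^sup>2)"
    proof (rule Bochner_Integration.integrable_bound)
      show "integrable M (\<lambda>x. (norm (A x))\<^sup>2)" using A by (simp add: square_integrable_def)
      show "(\<lambda>x. (A x $ k $ j)\<^sup>2) \<in> borel_measurable M" using m by simp
      show "AE x in M. norm ((A x $ k $ j)\<^sup>2) \<le> norm ((norm (A x))\<^sup>2)"
      proof (rule AE_I2)
        fix x
        have "(A x $ k $ j)\<^sup>2 \<le> (\<Sum>j\<in>UNIV. (A x $ k $ j)\<^sup>2)" by (rule member_le_sum) auto
        also have "\<dots> \<le> (\<Sum>k\<in>UNIV. \<Sum>j\<in>UNIV. (A x $ k $ j)\<^sup>2)"
          by (rule member_le_sum[of k UNIV "\<lambda>k. \<Sum>j\<in>UNIV. (A x $ k $ j)\<^sup>2"]) (auto intro: sum_nonneg)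
        finally show "norm ((A x $ k $ j)\<^sup>2) \<le> norm ((norm (A x))\<^sup>2)"
          by (simp add: norm_matrix_sq)
      qed
    qed
    then show "square_integrable M (\<lambda>x. A x $ k $ j)" using m by (simp add: square_integrable_def)
  qed
next
  assume A: "\<forall>k j. square_integrable M (\<lambda>x. A x $ k $ j)"
  then have m: "(\<lambda>x. A x $ k $ j) \<in> borel_measurable M" for k j by (simp add: square_integrable_def)
  have "A \<in> borel_measurable M"
  proof (rule borel_measurable_euclidean_space[THEN iffD2, rule_format])
    fix b :: "real^2^2" assume "b \<in> Basis"
    then obtain k j where "b = axis k (axis j 1)" by (auto simp: Basis_vec_def)
    then show "(\<lambda>x. A x \<bullet> b) \<in> borel_measurable M" using m[of k j] by (simp add: inner_axis)
  qed
  moreover have "integrable M (\<lambda>x. (norm (A x))\<^sup>2)"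
    unfolding norm_matrix_sq using A by (intro Bochner_Integration.integrable_sum) (auto simp: square_integrable_def)
  ultimately show "square_integrable M A" by (simp add: square_integrable_def)
qed

lemma sq_inner_matrix:
  fixes A B :: "'a \<Rightarrow> real^2^2"
  assumes "square_integrable M A" "square_integrable M B"
  shows "sq_inner M A B = (\<Sum>k\<in>UNIV. \<Sum>j\<in>UNIV. LINT x|M. A x $ k $ j * B x $ k $ j)"
proof -
  have "integrable M (\<lambda>x. A x $ k $ j * B x $ k $ j)" for k j
    using square_integrable_inner[of M "\<lambda>x. A x $ k $ j" "\<lambda>x. B x $ k $ j"] assms
    by (simp add: square_integrable_matrix_iff)
  then show ?thesis by (simp add: sq_inner_def inner_vec_def Bochner_Integration.integrable_sum)
qed

lemma sq_norm_tendsto_0_comparison: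
  assumes "\<And>n. sq_norm M (f n) \<le> C * sq_norm M (g n)" "(\<lambda>n. sq_norm M (g n)) \<longlonglongrightarrow> 0"
  shows "(\<lambda>n. sq_norm M (f n)) \<longlonglongrightarrow> 0"
proof (rule tendsto_sandwich[where f="\<lambda>n. 0"])
  show "(\<lambda>n. C * sq_norm M (g n)) \<longlonglongrightarrow> 0" using tendsto_mult_right_zero[OF assms(2)] .
qed (use assms(1) in auto)

lemma bump_tests_eq_0: 
  assumes "\<phi> \<in> bump_tests \<Omega>" "x \<notin> \<Omega>"
  shows "\<phi> x = 0" "partial_deriv j \<phi> x = 0"
proof -
  have x: "x \<notin> closure {x. \<phi> x \<noteq> 0}" using assms by (auto simp: bump_tests_def test_functions_def)
  then show "\<phi> x = 0" using closure_subset[of "{x. \<phi> x \<noteq> 0}"] by auto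
  have "((\<lambda>x. 0) has_derivative (\<lambda>k. 0)) (at x)" by simp
  then have "(\<phi> has_derivative (\<lambda>k. 0)) (at x)"
    by (rule has_derivative_transform_within_open[where s="- closure {x. \<phi> x \<noteq> 0}"])
      (use x closure_subset[of "{x. \<phi> x \<noteq> 0}"] in auto)
  then show "partial_deriv j \<phi> x = 0" by (simp add: partial_deriv_eqI)
qed

lemma partial_deriv_lincomb:
  assumes "C1_compact f" "C1_compact g"
  shows "partial_deriv j (\<lambda>x. a * f x + b * g x) x = a * partial_deriv j f x + b * partial_deriv j g x"
proof -
  have d: "f differentiable (at x)" "g differentiable (at x)" using assms by (auto simp: C1_compact_def)
  have "((\<lambda>x. a * f x + b * g x) has_derivative (\<lambda>k. a * frechet_derivative f (at x) k + b * frechet_derivative g (at x) k)) (at x)"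
    by (intro has_derivative_add has_derivative_mult_right d[unfolded frechet_derivative_works])
  from partial_deriv_eqI[OF this, of j] show ?thesis by (simp add: partial_deriv_def)
qed

lemma partial_deriv_zero: "partial_deriv j (\<lambda>x. 0) x = 0"
  using partial_deriv_eqI[OF has_derivative_const] .

lemma square_integrable_partial_deriv: "\<phi> \<in> bump_tests \<Omega> \<Longrightarrow> square_integrable lborel (partial_deriv j \<phi>)"
  by (intro continuous_compact_square_integrable C1_compact_imp_continuous_compact bump_tests_C1_compact)

lemma square_integrable_gradient:
  "(\<And>k. v k \<in> bump_tests \<Omega>) \<Longrightarrow> square_integrable lborel (gradient v)"
  unfolding square_integrable_matrix_iff by (auto intro: square_integrable_partial_deriv)

text \<open>The squares of divergence and curl exceed the squared gradient by twice its determinant,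
  whose integral vanishes by \<open>integral_partial_deriv_swap\<close>.\<close>

lemma gradient_div_curl:
  assumes v: "\<And>k. v k \<in> bump_tests \<Omega>"
  shows "sq_norm lborel (gradient v) = sq_norm lborel (\<lambda>x. gradient v x $ 1 $ 1 + gradient v x $ 2 $ 2)
    + sq_norm lborel (\<lambda>x. gradient v x $ 2 $ 1 - gradient v x $ 1 $ 2)"
proof -
  let ?d = "\<lambda>k j. partial_deriv j (v k)"
  have s: "square_integrable lborel (?d k j)" for k j by (rule square_integrable_partial_deriv[OF v])
  have swap: "(LINT x|lborel. ?d 1 1 x * ?d 2 2 x) = (LINT x|lborel. ?d 1 2 x * ?d 2 1 x)"
    by (intro integral_partial_deriv_swap bump_tests_C1_compact[OF v])
  have "sq_norm lborel (\<lambda>x. ?d 1 1 x + ?d 2 2 x) + sq_norm lborel (\<lambda>x. ?d 2 1 x - ?d 1 2 x)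
     = sq_norm lborel (?d 1 1) + sq_norm lborel (?d 2 2) + sq_norm lborel (?d 2 1) + sq_norm lborel (?d 1 2)"
    unfolding sq_norm_add[OF s s] sq_norm_diff[OF s s] using swap by (simp add: sq_inner_def mult.commute)
  also have "\<dots> = sq_norm lborel (gradient v)"
    using sq_inner_matrix[OF square_integrable_gradient[OF v] square_integrable_gradient[OF v]]
    by (simp add: sq_inner_self[symmetric] sum_2) (simp add: sq_inner_def)
  finally show ?thesis by simp
qed

section \<open>Projection of a pressure on gradient fields and the estimate of its energy\<close>

context star_domain
begin

text \<open>The conclusion speaks of test fields because their limit is only a matrix field.
  Numerator and squared seminorm tend to the same E, so the quotients tend to sqrt E divided by the
  norm of p.\<close>

theorem stokes_projection:
  assumes p: "square_integrable lborel p" "\<And>x. x \<notin> \<Omega> \<Longrightarrow> p x = 0" "(LINT x|lborel. p x) = 0"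
  shows "\<exists>v E. (\<forall>n k. v n k \<in> bump_tests \<Omega>) \<and> sq_norm lborel p \<le> (friedrichs_bound \<rho> R + 1) * E
    \<and> (\<lambda>n. LINT x|lborel. p x * (\<Sum>j\<in>UNIV. partial_deriv j (v n j) x)) \<longlonglongrightarrow> E
    \<and> (\<lambda>n. sq_norm lborel (gradient (v n))) \<longlonglongrightarrow> E"
proof -
  define \<Gamma> where "\<Gamma> = friedrichs_bound \<rho> R"
  have \<Gamma>: "\<Gamma> > 0" unfolding \<Gamma>_def by (rule friedrichs_bound_pos)
  have [measurable]: "\<Omega> \<in> sets borel" using open_Omega by auto
  \<comment> \<open>p times the identity matrix: its inner product with a gradient is p times the
    divergence.\<close>
  define f :: "real^2 \<Rightarrow> real^2^2" where "f x = (\<chi> k j. if k = j then p x else 0)" for x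
  define Y where "Y = {gradient v | v. \<forall>k. v k \<in> bump_tests \<Omega>}"
  have f: "square_integrable lborel f"
    unfolding square_integrable_matrix_iff
  proof (intro allI)
    fix k j show "square_integrable lborel (\<lambda>x. f x $ k $ j)"
      using p(1) by (cases "k = j") (auto simp: f_def square_integrable_def)
  qed
  have "\<exists>g y. square_integrable lborel g \<and> (\<forall>n. y n \<in> Y) \<and> (\<lambda>n. sq_norm lborel (\<lambda>x. y n x - g x)) \<longlonglongrightarrow> 0
     \<and> (\<forall>z\<in>Y. sq_inner lborel (\<lambda>x. f x - g x) z = 0)"
  proof (rule square_integrable_projection[OF f])
    show "square_integrable lborel y" if "y \<in> Y" for y
      using that square_integrable_gradient by (auto simp: Y_def)
    have "gradient (\<lambda>k x. 0) \<in> Y" unfolding Y_def using zero_bump_tests by blast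
    then show "Y \<noteq> {}" by blast
    fix y z :: "real^2 \<Rightarrow> real^2^2" and a b
    assume "y \<in> Y" "z \<in> Y"
    then obtain v w where vw: "y = gradient v" "z = gradient w" "\<And>k. v k \<in> bump_tests \<Omega>" "\<And>k. w k \<in> bump_tests \<Omega>"
      by (auto simp: Y_def)
    have "(\<lambda>x. a *\<^sub>R y x + b *\<^sub>R z x) = gradient (\<lambda>k x. a * v k x + b * w k x)"
      using bump_tests_C1_compact[OF vw(3)] bump_tests_C1_compact[OF vw(4)]
      by (simp add: fun_eq_iff vec_eq_iff vw(1,2) partial_deriv_lincomb)
    then show "(\<lambda>x. a *\<^sub>R y x + b *\<^sub>R z x) \<in> Y"
      using bump_tests_lincomb[OF vw(3,4)] unfolding Y_def by blast
  qed
  then obtain g y where g: "square_integrable lborel g" "\<And>n. y n \<in> Y"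
    "(\<lambda>n. sq_norm lborel (\<lambda>x. y n x - g x)) \<longlonglongrightarrow> 0" "\<And>z. z \<in> Y \<Longrightarrow> sq_inner lborel (\<lambda>x. f x - g x) z = 0"
    by blast
  from g(2) have "\<forall>n. \<exists>v. y n = gradient v \<and> (\<forall>k. v k \<in> bump_tests \<Omega>)" by (auto simp: Y_def)
  then obtain v where v: "\<And>n. y n = gradient (v n)" "\<And>n k. v n k \<in> bump_tests \<Omega>" by metis
  have Y0: "z x = 0" if "z \<in> Y" "x \<notin> \<Omega>" for z x
  proof -
    obtain v where "z = gradient v" "\<And>k. v k \<in> bump_tests \<Omega>" using \<open>z \<in> Y\<close> by (auto simp: Y_def)
    then show ?thesis using bump_tests_eq_0(2)[OF _ \<open>x \<notin> \<Omega>\<close>] by (simp add: vec_eq_iff)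
  qed
  \<comment> \<open>Gradients of test fields do not see the projection outside \<Omega>. Cutting it
    off keeps the limit relation and provides functions that vanish off \<Omega>, as
    \<open>friedrichs_weak\<close> asks for.\<close>
  define G where "G x = indicator \<Omega> x *\<^sub>R g x" for x
  have sG: "square_integrable lborel G"
  proof -
    have [measurable]: "g \<in> borel_measurable borel" using g(1) by (simp add: square_integrable_def)
    have "integrable lborel (\<lambda>x. indicator \<Omega> x *\<^sub>R (norm (g x))\<^sup>2)"
      using g(1) by (intro integrable_mult_indicator) (auto simp: square_integrable_def)
    moreover have "(norm (G x))\<^sup>2 = indicator \<Omega> x *\<^sub>R (norm (g x))\<^sup>2" for x by (simp add: G_def indicator_def)
    ultimately show ?thesis by (simp add: square_integrable_def G_def[abs_def])
  qed
  have sy: "square_integrable lborel (y n)" for n unfolding v(1) by (rule square_integrable_gradient[OF v(2)])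
  have sY: "square_integrable lborel z" if "z \<in> Y" for z
    using that square_integrable_gradient by (auto simp: Y_def)
  have G_lim: "(\<lambda>n. sq_norm lborel (\<lambda>x. y n x - G x)) \<longlonglongrightarrow> 0"
  proof (rule sq_norm_tendsto_0_comparison[OF _ g(3)])
    show "sq_norm lborel (\<lambda>x. y n x - G x) \<le> 1 * sq_norm lborel (\<lambda>x. y n x - g x)" for n
      unfolding sq_norm_def mult_1
    proof (rule integral_mono)
      show "integrable lborel (\<lambda>x. (norm (y n x - G x))\<^sup>2)" "integrable lborel (\<lambda>x. (norm (y n x - g x))\<^sup>2)"
        using square_integrable_diff[OF sy sG] square_integrable_diff[OF sy g(1)] by (auto simp: square_integrable_def)
      show "(norm (y n x - G x))\<^sup>2 \<le> (norm (y n x - g x))\<^sup>2" for x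
        using Y0[OF g(2)[of n], of x] by (cases "x \<in> \<Omega>") (auto simp: G_def)
    qed
  qed
  have orth: "sq_inner lborel f z = sq_inner lborel G z" if z: "z \<in> Y" for z
  proof -
    have "sq_inner lborel G z = sq_inner lborel g z"
      unfolding sq_inner_def using Y0[OF z]
      by (intro Bochner_Integration.integral_cong) (auto simp: G_def indicator_def)
    then show ?thesis using g(4)[OF z] sq_inner_diff_left[OF f g(1) sY[OF z]] by simp
  qed
  define q where "q x = G x $ 1 $ 1 + G x $ 2 $ 2" for x
  define r where "r x = G x $ 2 $ 1 - G x $ 1 $ 2" for x
  have sGc: "square_integrable lborel (\<lambda>x. G x $ k $ j)" for k j using sG by (simp add: square_integrable_matrix_iff)
  have sq: "square_integrable lborel q" and sr: "square_integrable lborel r"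
    unfolding q_def r_def by (intro square_integrable_add square_integrable_diff sGc)+
  have q0: "x \<notin> \<Omega> \<Longrightarrow> q x = 0" and r0: "x \<notin> \<Omega> \<Longrightarrow> r x = 0" for x by (auto simp: q_def r_def G_def)
  define qn where "qn n x = y n x $ 1 $ 1 + y n x $ 2 $ 2" for n x
  define rn where "rn n x = y n x $ 2 $ 1 - y n x $ 1 $ 2" for n x
  have syc: "square_integrable lborel (\<lambda>x. y n x $ k $ j)" for n k j using sy by (simp add: square_integrable_matrix_iff)
  have sqn: "square_integrable lborel (qn n)" and srn: "square_integrable lborel (rn n)" for n
    unfolding qn_def[abs_def] rn_def[abs_def] by (intro square_integrable_add square_integrable_diff syc)+
  have two: "(a + b)\<^sup>2 \<le> 2 * (norm A)\<^sup>2"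
    if "(a\<^sup>2 + b\<^sup>2) \<le> (norm A)\<^sup>2" for a b :: real and A :: "real^2^2"
  proof -
    have "0 \<le> (a - b)\<^sup>2" by simp
    then show ?thesis using that by (simp add: power2_eq_square algebra_simps)
  qed
  have q_lim: "(\<lambda>n. sq_norm lborel (\<lambda>x. qn n x - q x)) \<longlonglongrightarrow> 0"
  proof (rule sq_norm_tendsto_0_comparison[OF _ G_lim])
    show "sq_norm lborel (\<lambda>x. qn n x - q x) \<le> 2 * sq_norm lborel (\<lambda>x. y n x - G x)" for n
      unfolding sq_norm_def integral_mult_right_zero[symmetric]
    proof (rule integral_mono)
      show "integrable lborel (\<lambda>x. (norm (qn n x - q x))\<^sup>2)" "integrable lborel (\<lambda>x. 2 * (norm (y n x - G x))\<^sup>2)"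
        using square_integrable_diff[OF sqn sq] square_integrable_diff[OF sy sG] by (auto simp: square_integrable_def)
      fix x
      let ?A = "y n x - G x"
      have "(?A $ 1 $ 1 + ?A $ 2 $ 2)\<^sup>2 \<le> 2 * (norm ?A)\<^sup>2" by (rule two) (simp add: norm_matrix_sq sum_2)
      moreover have "qn n x - q x = ?A $ 1 $ 1 + ?A $ 2 $ 2" by (simp add: qn_def q_def)
      ultimately show "(norm (qn n x - q x))\<^sup>2 \<le> 2 * (norm (y n x - G x))\<^sup>2" by simp
    qed
  qed
  have r_lim: "(\<lambda>n. sq_norm lborel (\<lambda>x. rn n x - r x)) \<longlonglongrightarrow> 0"
  proof (rule sq_norm_tendsto_0_comparison[OF _ G_lim])
    show "sq_norm lborel (\<lambda>x. rn n x - r x) \<le> 2 * sq_norm lborel (\<lambda>x. y n x - G x)" for n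
      unfolding sq_norm_def integral_mult_right_zero[symmetric]
    proof (rule integral_mono)
      show "integrable lborel (\<lambda>x. (norm (rn n x - r x))\<^sup>2)" "integrable lborel (\<lambda>x. 2 * (norm (y n x - G x))\<^sup>2)"
        using square_integrable_diff[OF srn sr] square_integrable_diff[OF sy sG] by (auto simp: square_integrable_def)
      fix x
      let ?A = "y n x - G x"
      have "(?A $ 2 $ 1 + (- ?A $ 1 $ 2))\<^sup>2 \<le> 2 * (norm ?A)\<^sup>2"
        by (rule two) (unfold norm_matrix_sq sum_2 power2_minus, simp)
      moreover have "rn n x - r x = ?A $ 2 $ 1 + (- ?A $ 1 $ 2)" by (simp add: rn_def r_def)
      ultimately show "(norm (rn n x - r x))\<^sup>2 \<le> 2 * (norm (y n x - G x))\<^sup>2" by simp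
    qed
  qed
  have E_lim: "(\<lambda>n. sq_norm lborel (y n)) \<longlonglongrightarrow> sq_norm lborel G" by (rule sq_norm_tendsto[OF sy sG G_lim])
  have energy: "sq_norm lborel G = sq_norm lborel q + sq_norm lborel r"
  proof (rule LIMSEQ_unique[OF E_lim])
    have "sq_norm lborel (y n) = sq_norm lborel (qn n) + sq_norm lborel (rn n)" for n
      unfolding qn_def rn_def v(1) by (rule gradient_div_curl[OF v(2)])
    then show "(\<lambda>n. sq_norm lborel (y n)) \<longlonglongrightarrow> sq_norm lborel q + sq_norm lborel r"
      using tendsto_add[OF sq_norm_tendsto[OF sqn sq q_lim] sq_norm_tendsto[OF srn sr r_lim]] by simp
  qed
  have inner_f: "sq_inner lborel f A = sq_inner lborel p (\<lambda>x. A x $ 1 $ 1 + A x $ 2 $ 2)" for A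
    unfolding sq_inner_def by (intro Bochner_Integration.integral_cong) (auto simp: f_def inner_vec_def sum_2 algebra_simps)
  \<comment> \<open>The orthogonality is tested with the approximating gradients themselves; the
    limit of <f, y n> = <G, y n> is the claim.\<close>
  have pq: "sq_inner lborel p q = sq_norm lborel G"
  proof (rule LIMSEQ_unique)
    show "(\<lambda>n. sq_inner lborel (qn n) p) \<longlonglongrightarrow> sq_inner lborel p q"
      using sq_inner_tendsto[OF sqn sq p(1) q_lim] by (simp add: sq_inner_commute[of lborel q])
    have "(\<lambda>n. sq_inner lborel (y n) G) \<longlonglongrightarrow> sq_norm lborel G"
      using sq_inner_tendsto[OF sy sG sG G_lim] by (simp add: sq_inner_self)
    moreover have "sq_inner lborel (y n) G = sq_inner lborel (qn n) p" for n
      using orth[OF g(2)[of n]] inner_f[of "y n"] by (simp add: sq_inner_commute qn_def[abs_def])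
    ultimately show "(\<lambda>n. sq_inner lborel (qn n) p) \<longlonglongrightarrow> sq_norm lborel G" by simp
  qed
  have sp1: "square_integrable lborel (indicator \<Omega> :: real^2 \<Rightarrow> real)"
  proof -
    have "integrable lborel (indicator \<Omega> :: real^2 \<Rightarrow> real)"
      using emeasure_bounded_finite[OF bounded_Omega] by (intro integrable_real_indicator) auto
    moreover have "(norm (indicator \<Omega> x :: real))\<^sup>2 = indicator \<Omega> x" for x by (simp add: indicator_def)
    ultimately show ?thesis by (simp add: square_integrable_def)
  qed
  have mean_q: "(LINT x|lborel. q x) = 0"
  proof -
    have "sq_inner lborel (qn n) (indicator \<Omega>) = 0" for n
    proof -
      have "sq_inner lborel (qn n) (indicator \<Omega>) = (LINT x|lborel. partial_deriv 1 (v n 1) x + partial_deriv 2 (v n 2) x)"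
        unfolding sq_inner_def using bump_tests_eq_0(2)[OF v(2)]
        by (intro Bochner_Integration.integral_cong) (auto simp: qn_def v(1) indicator_def)
      also have "\<dots> = 0"
        using integral_partial_deriv_0[OF bump_tests_C1_compact[OF v(2)]]
          continuous_compact_integrable[OF C1_compact_imp_continuous_compact(2)[OF bump_tests_C1_compact[OF v(2)]]]
        by simp
      finally show ?thesis .
    qed
    then have "sq_inner lborel q (indicator \<Omega>) = 0"
      using sq_inner_tendsto[OF sqn sq sp1 q_lim] by (simp add: LIMSEQ_const_iff)
    moreover have "sq_inner lborel q (indicator \<Omega>) = (LINT x|lborel. q x)"
      unfolding sq_inner_def using q0 by (intro Bochner_Integration.integral_cong) (auto simp: indicator_def)
    ultimately show ?thesis by simp
  qed
  define h where "h x = q x - p x" for x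
  have sh: "square_integrable lborel h" unfolding h_def by (intro square_integrable_diff sq p)
  have h0: "x \<notin> \<Omega> \<Longrightarrow> h x = 0" for x using q0 p(2) by (simp add: h_def)
  have mean_h: "(LINT x|lborel. h x) = 0"
    using square_integrable_imp_integrable[OF sq bounded_Omega q0] square_integrable_imp_integrable[OF p(1) bounded_Omega p(2)]
    by (simp add: h_def mean_q p(3))
  have "weakly_conjugate h r"
    unfolding weakly_conjugate_def
  proof (intro ballI)
    fix \<phi> assume \<phi>: "\<phi> \<in> bump_tests \<Omega>"
    let ?d = "\<lambda>j. partial_deriv j \<phi>"
    have sd: "square_integrable lborel (?d j)" for j by (rule square_integrable_partial_deriv[OF \<phi>])
    have i: "integrable lborel (\<lambda>x. G x $ k $ j * ?d i x)" "integrable lborel (\<lambda>x. p x * ?d i x)" for k j i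
      using square_integrable_inner[OF sGc sd] square_integrable_inner[OF p(1) sd] by simp_all
    define I where "I k j i = (LINT x|lborel. G x $ k $ j * ?d i x)" for k j i
    have curl_free: "I k 1 2 = I k 2 1" for k
    proof -
      \<comment> \<open>\<open>T\<close> has the divergence-free row \<open>(\<partial>\<^sub>2\<phi>, - \<partial>\<^sub>1\<phi>)\<close>, hence is orthogonal to gradients.\<close>
      define T :: "real^2 \<Rightarrow> real^2^2" where "T x = (\<chi> l j. if l = k then (if j = 1 then ?d 2 x else - ?d 1 x) else 0)" for x
      have sT: "square_integrable lborel T"
        unfolding square_integrable_matrix_iff
      proof (intro allI)
        fix l j
        show "square_integrable lborel (\<lambda>x. T x $ l $ j)"
          using sd[of 2] square_integrable_scale[OF sd[of 1], of "-1"]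
          by (cases "l = k"; cases "j = 1") (auto simp: T_def square_integrable_def)
      qed
      have T_in: "A x \<bullet> T x = A x $ k $ 1 * ?d 2 x - A x $ k $ 2 * ?d 1 x" for A x
        using exhaust_2[of k] by (auto simp: T_def inner_vec_def sum_2)
      have "sq_inner lborel (y n) T = 0" for n
      proof -
        have "sq_inner lborel (y n) T = (LINT x|lborel. partial_deriv 1 (v n k) x * ?d 2 x - partial_deriv 2 (v n k) x * ?d 1 x)"
          unfolding sq_inner_def T_in by (simp add: v(1))
        also have "\<dots> = (LINT x|lborel. partial_deriv 1 (v n k) x * ?d 2 x) - (LINT x|lborel. partial_deriv 2 (v n k) x * ?d 1 x)"
          using square_integrable_inner[OF square_integrable_partial_deriv[OF v(2)] sd] by simp
        also have "\<dots> = 0"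
          using integral_partial_deriv_swap[OF bump_tests_C1_compact[OF v(2)] bump_tests_C1_compact[OF \<phi>], of 1 n k 2] by simp
        finally show ?thesis .
      qed
      then have "sq_inner lborel G T = 0"
        using sq_inner_tendsto[OF sy sG sT G_lim] by (simp add: LIMSEQ_const_iff)
      then show ?thesis using i by (simp add: sq_inner_def T_in I_def)
    qed
    \<comment> \<open>Orthogonality tested with the field whose only nonzero component, the k-th, is
      \<phi>: weakly, the divergence of row k of G is the k-th partial derivative of p.\<close>
    have weak: "I k 1 1 + I k 2 2 = (LINT x|lborel. p x * ?d k x)" for k
    proof -
      define w where "w l = (if l = k then \<phi> else (\<lambda>x. 0))" for l :: 2
      have "\<forall>l. w l \<in> bump_tests \<Omega>" using \<phi> zero_bump_tests by (auto simp: w_def)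
      then have w: "gradient w \<in> Y" unfolding Y_def by blast
      have "A x \<bullet> gradient w x = A x $ k $ 1 * ?d 1 x + A x $ k $ 2 * ?d 2 x" for A x
        using exhaust_2[of k] by (auto simp: inner_vec_def sum_2 w_def partial_deriv_zero)
      then have "sq_inner lborel G (gradient w) = I k 1 1 + I k 2 2"
        using i by (simp add: sq_inner_def I_def)
      moreover have "sq_inner lborel f (gradient w) = (LINT x|lborel. p x * ?d k x)"
        using exhaust_2[of k] unfolding inner_f by (auto simp: sq_inner_def w_def partial_deriv_zero)
      ultimately show ?thesis using orth[OF w] by simp
    qed
    \<comment> \<open>The weak equation cancels one diagonal entry of G together with p. For the
      other one the curl-free row exchanges the derivatives of \<phi>, and the antisymmetric part
      \<open>r\<close> remains.\<close>
    have "(LINT x|lborel. ?d j x * h x) = I 1 1 j + I 2 2 j - (LINT x|lborel. p x * ?d j x)" for j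
      using i by (simp add: h_def q_def I_def algebra_simps)
    moreover have "(LINT x|lborel. ?d j x * r x) = I 2 1 j - I 1 2 j" for j
      using i by (simp add: r_def I_def algebra_simps)
    ultimately show "(LINT x|lborel. ?d 1 x * h x) = (LINT x|lborel. ?d 2 x * r x)
      \<and> (LINT x|lborel. ?d 2 x * h x) = - (LINT x|lborel. ?d 1 x * r x)"
      using curl_free[of 1] curl_free[of 2] weak[of 1] weak[of 2] by simp
  qed
  then have fried: "sq_norm lborel h \<le> \<Gamma> * sq_norm lborel r"
    unfolding \<Gamma>_def by (rule friedrichs_weak[OF _ sh h0 sr r0 mean_h])
  let ?P = "sq_norm lborel p" and ?Q = "sq_norm lborel q" and ?S = "sq_norm lborel r" and ?H = "sq_norm lborel h"
  have H_eq: "?H = ?P - ?Q - 2 * ?S"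
    unfolding h_def using sq_norm_diff[OF sq p(1)] pq energy by (simp add: sq_inner_commute)
  have S_eq: "sq_inner lborel h q = - ?S"
    unfolding h_def using sq_inner_diff_left[OF sq p(1) sq] pq energy by (simp add: sq_inner_self)
  \<comment> \<open>Friedrichs' inequality enters a second time, through Cauchy-Schwarz for <h, q> =
    -S; cancelling S is why S = 0 is treated apart.\<close>
  have S_le: "?S \<le> \<Gamma> * ?Q"
  proof (cases "?S = 0")
    case False
    then have S: "?S > 0" by (simp add: order_less_le)
    have "?S \<le> sqrt ?H * sqrt ?Q"
      using sq_inner_Cauchy_Schwarz[OF sh sq] S_eq by simp
    then have "?S\<^sup>2 \<le> (sqrt ?H * sqrt ?Q)\<^sup>2" by (intro power_mono) auto
    also have "\<dots> = ?H * ?Q" by (simp add: power_mult_distrib)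
    also have "\<dots> \<le> (\<Gamma> * ?S) * ?Q" by (intro mult_right_mono fried) auto
    finally have "?S * ?S \<le> ?S * (\<Gamma> * ?Q)" by (simp add: power2_eq_square mult_ac)
    then show ?thesis using S by simp
  qed (use \<Gamma> in auto)
  have "?P \<le> (\<Gamma> + 1) * sq_norm lborel G"
    using fried H_eq S_le unfolding energy by (simp add: algebra_simps)
  moreover have "(\<lambda>n. LINT x|lborel. p x * (\<Sum>j\<in>UNIV. partial_deriv j (v n j) x)) \<longlonglongrightarrow> sq_norm lborel G"
  proof -
    have "(LINT x|lborel. p x * (\<Sum>j\<in>UNIV. partial_deriv j (v n j) x)) = sq_inner lborel (qn n) p" for n
      unfolding sq_inner_def qn_def v(1) by (simp add: sum_2 mult.commute)
    then show ?thesis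
      using sq_inner_tendsto[OF sqn sq p(1) q_lim] pq by (simp add: sq_inner_commute[of lborel q])
  qed
  moreover have "(\<lambda>n. sq_norm lborel (gradient (v n))) \<longlonglongrightarrow> sq_norm lborel G"
    using E_lim by (simp add: v(1))
  ultimately show ?thesis using v(2) unfolding \<Gamma>_def by blast
qed

end

subsection \<open>The inf-sup constant\<close>

text \<open>The inf-sup constant is phrased with \<open>lebesgue_on\<close> and equality almost
  everywhere, the analysis with Borel functions on the whole space that vanish off \<Omega>. This is
  the passage between the two.\<close>

lemma lebesgue_on_integral_transfer:
  fixes F F' :: "'a::euclidean_space \<Rightarrow> real"
  assumes S: "S \<in> sets borel" and F: "F \<in> borel_measurable (lebesgue_on S)"
    and F': "F' \<in> borel_measurable borel" "\<And>x. x \<notin> S \<Longrightarrow> F' x = 0"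
    and eq: "AE x in lebesgue_on S. F x = F' x"
  shows "(LINT x|lebesgue_on S. F x) = (LINT x|lborel. F' x)"
    and "integrable (lebesgue_on S) F \<longleftrightarrow> integrable lborel F'"
proof -
  have Sl: "S \<inter> space lebesgue \<in> sets lebesgue" using S by simp
  have m: "F' \<in> borel_measurable (lebesgue_on S)"
    using F'(1) by (intro measurable_restrict_space1 measurable_completion) simp
  have ind: "indicator S x *\<^sub>R F' x = F' x" for x using F'(2) by (cases "x \<in> S") auto
  have "(LINT x|lebesgue_on S. F x) = (LINT x|lebesgue_on S. F' x)"
    by (rule integral_cong_AE[OF F m eq])
  also have "\<dots> = (LINT x|lebesgue. F' x)"
    unfolding integral_restrict_space[OF Sl] ind ..
  also have "\<dots> = (LINT x|lborel. F' x)"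
    using F'(1) by (intro integral_completion) simp
  finally show "(LINT x|lebesgue_on S. F x) = (LINT x|lborel. F' x)" .
  have "integrable (lebesgue_on S) F \<longleftrightarrow> integrable (lebesgue_on S) F'"
    by (rule integrable_cong_AE[OF F m eq])
  also have "\<dots> \<longleftrightarrow> integrable lebesgue F'"
    unfolding integrable_restrict_space[OF Sl] ind ..
  also have "\<dots> \<longleftrightarrow> integrable lborel F'"
    using F'(1) by (intro integrable_completion) simp
  finally show "integrable (lebesgue_on S) F \<longleftrightarrow> integrable lborel F'" .
qed

lemma borel_representative:
  fixes F :: "'a::euclidean_space \<Rightarrow> real"
  assumes S: "S \<in> sets borel" and F: "F \<in> borel_measurable (lebesgue_on S)"
  obtains F' where "F' \<in> borel_measurable borel" "\<And>x. x \<notin> S \<Longrightarrow> F' x = 0" "AE x in lebesgue_on S. F x = F' x"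
proof -
  have Sl: "S \<in> sets lebesgue" using S by simp
  have "(\<lambda>x. if x \<in> S then F x else 0) \<in> borel_measurable lebesgue"
    using borel_measurable_if[OF Sl] F by blast
  then obtain g where g: "g \<in> borel_measurable lborel" "AE x in lborel. (if x \<in> S then F x else 0) = g x"
    using completion_ex_borel_measurable_real by blast
  define F' where "F' x = indicator S x * g x" for x
  show thesis
  proof (rule that[of F'])
    show "F' \<in> borel_measurable borel" unfolding F'_def using g(1) S by simp
    show "x \<notin> S \<Longrightarrow> F' x = 0" for x by (simp add: F'_def)
    have "AE x in lebesgue. (if x \<in> S then F x else 0) = g x" using g(2) by (rule AE_completion)
    then have "AE x in lebesgue. x \<in> S \<longrightarrow> F x = F' x"
      by eventually_elim (auto simp: F'_def)
    then show "AE x in lebesgue_on S. F x = F' x"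
      using Sl by (simp add: AE_restrict_space_iff)
  qed
qed

lemma L2_representative:
  fixes f :: "real^'n \<Rightarrow> real"
  assumes S: "S \<in> sets borel" and f: "f \<in> L2 S"
  obtains f' where "square_integrable lborel f'" "\<And>x. x \<notin> S \<Longrightarrow> f' x = 0" "AE x in lebesgue_on S. f x = f' x"
proof -
  have fm: "f \<in> borel_measurable (lebesgue_on S)" and f2: "integrable (lebesgue_on S) (\<lambda>x. (f x)\<^sup>2)"
    using f by (auto simp: L2_def)
  obtain f' where f': "f' \<in> borel_measurable borel" "\<And>x. x \<notin> S \<Longrightarrow> f' x = 0" "AE x in lebesgue_on S. f x = f' x"
    using borel_representative[OF S fm] by blast
  have "integrable lborel (\<lambda>x. (f' x)\<^sup>2)"
  proof (rule lebesgue_on_integral_transfer(2)[OF S, THEN iffD1, OF _ _ _ _ f2])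
    show "AE x in lebesgue_on S. (f x)\<^sup>2 = (f' x)\<^sup>2" using f'(3) by eventually_elim simp
  qed (use fm f' in auto)
  then show thesis using f' that by (auto simp: square_integrable_def)
qed

lemma L2_inner_transfer:
  fixes f g :: "real^'n \<Rightarrow> real"
  assumes S: "S \<in> sets borel" and f: "f \<in> borel_measurable (lebesgue_on S)" and g: "g \<in> borel_measurable (lebesgue_on S)"
    and f': "f' \<in> borel_measurable borel" and g': "g' \<in> borel_measurable borel"
    and zero: "\<And>x. x \<notin> S \<Longrightarrow> f' x * g' x = 0"
    and eq: "AE x in lebesgue_on S. f x = f' x" "AE x in lebesgue_on S. g x = g' x"
  shows "L2_inner S f g = (LINT x|lborel. f' x * g' x)"
  unfolding L2_inner_def
proof (rule lebesgue_on_integral_transfer(1)[OF S])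
  show "AE x in lebesgue_on S. f x * g x = f' x * g' x" using eq by eventually_elim simp
qed (use f g f' g' zero in auto)

lemma borel_measurable_lebesgue_on:
  fixes f :: "'a::euclidean_space \<Rightarrow> real"
  shows "f \<in> borel_measurable borel \<Longrightarrow> f \<in> borel_measurable (lebesgue_on S)"
  by (intro measurable_restrict_space1 measurable_completion) simp

lemma square_integrable_L2:
  fixes f :: "real^'n \<Rightarrow> real"
  assumes S: "S \<in> sets borel" and f: "square_integrable lborel f" "\<And>x. x \<notin> S \<Longrightarrow> f x = 0"
  shows "f \<in> L2 S"
proof -
  have fm: "f \<in> borel_measurable borel" using f(1) by (simp add: square_integrable_def)
  have "integrable (lebesgue_on S) (\<lambda>x. (f x)\<^sup>2)"
    by (rule lebesgue_on_integral_transfer(2)[OF S, THEN iffD2])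
      (use f fm in \<open>auto simp: square_integrable_def intro!: borel_measurable_lebesgue_on\<close>)
  then show ?thesis using borel_measurable_lebesgue_on[OF fm] by (simp add: L2_def)
qed

section \<open>Weak derivatives of test functions\<close>

lemma test_function_measurable: "\<phi> \<in> test_functions \<Omega> \<Longrightarrow> \<phi> \<in> borel_measurable borel"
  by (intro continuous_compact_measurable C1_compact_imp_continuous_compact test_function_C1_compact)

text \<open>Both candidates have the same inner product with every test function, so the fundamental
  lemma applies to their difference. This is how anything is learned about the function chosen by
  \<open>weak_deriv\<close>.\<close>

lemma weak_deriv_unique:
  assumes \<Omega>: "open \<Omega>" "bounded \<Omega>" and g1: "has_weak_deriv \<Omega> j f g1" and g2: "has_weak_deriv \<Omega> j f g2"
  shows "AE x in lebesgue_on \<Omega>. g1 x = g2 x"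
proof -
  have S: "\<Omega> \<in> sets borel" using \<Omega> by auto
  obtain h1 where h1: "square_integrable lborel h1" "\<And>x. x \<notin> \<Omega> \<Longrightarrow> h1 x = 0" "AE x in lebesgue_on \<Omega>. g1 x = h1 x"
    using L2_representative[OF S, of g1] g1 by (auto simp: has_weak_deriv_def)
  obtain h2 where h2: "square_integrable lborel h2" "\<And>x. x \<notin> \<Omega> \<Longrightarrow> h2 x = 0" "AE x in lebesgue_on \<Omega>. g2 x = h2 x"
    using L2_representative[OF S, of g2] g2 by (auto simp: has_weak_deriv_def)
  have i: "integrable lborel h1" "integrable lborel h2"
    using square_integrable_imp_integrable[OF h1(1) \<Omega>(2) h1(2)] square_integrable_imp_integrable[OF h2(1) \<Omega>(2) h2(2)] by auto
  have "AE x in lborel. x \<in> \<Omega> \<longrightarrow> h1 x - h2 x = 0"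
  proof (rule fundamental_lemma[OF \<Omega>(1)])
    show "integrable lborel (\<lambda>x. h1 x - h2 x)" using i by simp
    fix \<phi> assume \<phi>: "\<phi> \<in> test_functions \<Omega>"
    have cc: "continuous_compact \<phi>" by (intro C1_compact_imp_continuous_compact test_function_C1_compact[OF \<phi>])
    note \<phi>m = test_function_measurable[OF \<phi>]
    have "L2_inner \<Omega> g1 \<phi> = L2_inner \<Omega> g2 \<phi>"
      using g1 g2 \<phi> by (force simp: has_weak_deriv_def)
    moreover have "L2_inner \<Omega> g1 \<phi> = (LINT x|lborel. h1 x * \<phi> x)"
      using g1 h1 by (intro L2_inner_transfer[OF S _ borel_measurable_lebesgue_on[OF \<phi>m] _ \<phi>m])
        (auto simp: has_weak_deriv_def L2_def square_integrable_def)
    moreover have "L2_inner \<Omega> g2 \<phi> = (LINT x|lborel. h2 x * \<phi> x)"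
      using g2 h2 by (intro L2_inner_transfer[OF S _ borel_measurable_lebesgue_on[OF \<phi>m] _ \<phi>m])
        (auto simp: has_weak_deriv_def L2_def square_integrable_def)
    ultimately have "(LINT x|lborel. \<phi> x * h1 x) = (LINT x|lborel. \<phi> x * h2 x)" by (simp add: mult.commute)
    moreover have "(LINT x|lborel. (h1 x - h2 x) * \<phi> x) = (LINT x|lborel. \<phi> x * h1 x - \<phi> x * h2 x)"
      by (intro Bochner_Integration.integral_cong) (auto simp: algebra_simps)
    ultimately show "(LINT x|lborel. (h1 x - h2 x) * \<phi> x) = 0"
      using continuous_compact_integrable_mult[OF cc i(1)] continuous_compact_integrable_mult[OF cc i(2)] by simp
  qed
  then have "AE x in lborel. x \<in> \<Omega> \<longrightarrow> h1 x = h2 x" by eventually_elim auto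
  then have "AE x in lebesgue. x \<in> \<Omega> \<longrightarrow> h1 x = h2 x" by (rule AE_completion)
  then have "AE x in lebesgue_on \<Omega>. h1 x = h2 x" using S by (simp add: AE_restrict_space_iff)
  then show ?thesis using h1(3) h2(3) by eventually_elim simp
qed

lemma bump_tests_has_weak_deriv:
  assumes "open \<Omega>" "\<phi> \<in> bump_tests \<Omega>"
  shows "has_weak_deriv \<Omega> j \<phi> (partial_deriv j \<phi>)"
proof -
  have S: "\<Omega> \<in> sets borel" using assms by auto
  note C1 = bump_tests_C1_compact[OF assms(2)]
  note cc = C1_compact_imp_continuous_compact[OF C1]
  have "\<phi> \<in> L2 \<Omega>" "partial_deriv j \<phi> \<in> L2 \<Omega>"
    using bump_tests_eq_0[OF assms(2)]
    by (auto intro!: square_integrable_L2[OF S] continuous_compact_square_integrable cc)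
  moreover have "L2_inner \<Omega> \<phi> (partial_deriv j \<psi>) = - L2_inner \<Omega> (partial_deriv j \<phi>) \<psi>" if \<psi>: "\<psi> \<in> test_functions \<Omega>" for \<psi>
  proof -
    note C1' = test_function_C1_compact[OF \<psi>]
    note cc' = C1_compact_imp_continuous_compact[OF C1']
    have "L2_inner \<Omega> \<phi> (partial_deriv j \<psi>) = (LINT x|lborel. \<phi> x * partial_deriv j \<psi> x)"
      using bump_tests_eq_0[OF assms(2)]
      by (intro L2_inner_transfer[OF S] borel_measurable_lebesgue_on continuous_compact_measurable cc cc') auto
    moreover have "L2_inner \<Omega> (partial_deriv j \<phi>) \<psi> = (LINT x|lborel. partial_deriv j \<phi> x * \<psi> x)"
      using bump_tests_eq_0[OF assms(2)]
      by (intro L2_inner_transfer[OF S] borel_measurable_lebesgue_on continuous_compact_measurable cc cc') auto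
    ultimately show ?thesis using integral_by_parts[OF C1 C1', of j] by simp
  qed
  ultimately show ?thesis by (simp add: has_weak_deriv_def)
qed

lemma bump_tests_weak_deriv:
  assumes "open \<Omega>" "bounded \<Omega>" "\<phi> \<in> bump_tests \<Omega>"
  shows "AE x in lebesgue_on \<Omega>. weak_deriv \<Omega> j \<phi> x = partial_deriv j \<phi> x"
    and "weak_deriv \<Omega> j \<phi> \<in> borel_measurable (lebesgue_on \<Omega>)"
proof -
  have "has_weak_deriv \<Omega> j \<phi> (weak_deriv \<Omega> j \<phi>)"
    unfolding weak_deriv_def by (rule someI[where P="has_weak_deriv \<Omega> j \<phi>", OF bump_tests_has_weak_deriv[OF assms(1,3)]])
  then show "AE x in lebesgue_on \<Omega>. weak_deriv \<Omega> j \<phi> x = partial_deriv j \<phi> x"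
    "weak_deriv \<Omega> j \<phi> \<in> borel_measurable (lebesgue_on \<Omega>)"
    using weak_deriv_unique[OF assms(1,2) _ bump_tests_has_weak_deriv[OF assms(1,3)]]
    by (auto simp: has_weak_deriv_def L2_def)
qed

lemma bump_tests_L2_norm_weak_deriv:
  assumes "open \<Omega>" "bounded \<Omega>" "\<phi> \<in> bump_tests \<Omega>"
  shows "(L2_norm \<Omega> (weak_deriv \<Omega> j \<phi>))\<^sup>2 = sq_norm lborel (partial_deriv j \<phi>)"
proof -
  have S: "\<Omega> \<in> sets borel" using assms by auto
  note cc = C1_compact_imp_continuous_compact[OF bump_tests_C1_compact[OF assms(3)]]
  have "L2_inner \<Omega> (weak_deriv \<Omega> j \<phi>) (weak_deriv \<Omega> j \<phi>) = (LINT x|lborel. partial_deriv j \<phi> x * partial_deriv j \<phi> x)"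
    using bump_tests_weak_deriv[OF assms, of j] bump_tests_eq_0(2)[OF assms(3)]
    by (intro L2_inner_transfer[OF S] continuous_compact_measurable cc) auto
  also have "\<dots> = sq_norm lborel (partial_deriv j \<phi>)" by (simp add: sq_norm_def power2_eq_square)
  finally show ?thesis by (simp add: L2_norm_def)
qed

text \<open>A test function approximates itself, so only the norm of the zero function has to be
  found.\<close>

lemma bump_tests_H1_0:
  assumes "open \<Omega>" "bounded \<Omega>" "\<phi> \<in> bump_tests \<Omega>"
  shows "\<phi> \<in> H1_0 \<Omega>"
proof -
  have "\<phi> \<in> H1 \<Omega>"
    using bump_tests_has_weak_deriv[OF assms(1,3)] unfolding H1_def has_weak_deriv_def by blast
  moreover have "H1_norm \<Omega> (\<lambda>x. \<phi> x - \<phi> x) = 0"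
  proof -
    \<comment> \<open>The chosen weak derivative of the zero function is known to be 0 only almost
      everywhere; hence the detour through its norm.\<close>
    have "partial_deriv j (\<lambda>x. 0) = (\<lambda>x. 0 :: real)" for j :: 'a by (auto simp: partial_deriv_zero)
    then have "L2_norm \<Omega> (weak_deriv \<Omega> j (\<lambda>x. 0)) = 0" for j
      using bump_tests_L2_norm_weak_deriv[OF assms(1,2) zero_bump_tests, of j] by (simp add: sq_norm_def)
    then show ?thesis by (simp add: H1_norm_def L2_norm_def L2_inner_def)
  qed
  moreover have "\<phi> \<in> test_functions \<Omega>" using assms(3) by (simp add: bump_tests_def)
  ultimately show ?thesis unfolding H1_0_def by force
qed

text \<open>The gauge is the Minkowski functional of \<open>\<Omega> - c\<close>.\<close>

lemma star_domain_minkowski: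
  fixes \<Omega> :: "(real^2) set" and c :: "real^2"
  assumes "open \<Omega>" "\<rho> > 0" "\<Omega> \<subseteq> ball c R" "star_shaped_wrt_ball \<Omega> c \<rho>"
  shows "\<exists>N. star_domain N \<rho> R c \<Omega>"
proof -
  define A where "A = {z. c + plane_of z \<in> \<Omega>}"
  have "open A"
    unfolding A_def using \<open>open \<Omega>\<close> open_vimage[OF \<open>open \<Omega>\<close>, of "\<lambda>z. c + plane_of z"]
    by (simp add: vimage_def continuous_on_add continuous_on_plane_of continuous_on_id)
  have np: "norm (plane_of z) = norm z" for z by (metis complex_of_plane_of norm_complex_of)
  have bA: "ball 0 \<rho> \<subseteq> A"
    using assms(4) np by (force simp: A_def star_shaped_wrt_ball_def dist_norm)
  have Ab: "norm z < R" if "z \<in> A" for z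
    using assms(3) that np[of z] by (force simp: A_def dist_norm)
  have star: "of_real (1 - u) * a + of_real u * z \<in> A" if "norm a < \<rho>" "z \<in> A" "0 \<le> u" "u \<le> 1" for a z u
  proof -
    have "c + plane_of a \<in> ball c \<rho>" using that np[of a] by (simp add: dist_norm)
    then have "closed_segment (c + plane_of a) (c + plane_of z) \<subseteq> \<Omega>"
      using assms(4) that by (auto simp: star_shaped_wrt_ball_def A_def)
    moreover have "c + plane_of (of_real (1 - u) * a + of_real u * z) = (1 - u) *\<^sub>R (c + plane_of a) + u *\<^sub>R (c + plane_of z)"
      by (simp add: vec_eq_iff forall_2 algebra_simps)
    ultimately show ?thesis using that unfolding A_def closed_segment_def by auto
  qed
  have "0 \<in> A" using bA assms(2) by auto
  have "ball c \<rho> \<subseteq> ball c R" using assms(3,4) by (auto simp: star_shaped_wrt_ball_def)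
  then have "\<rho> \<le> R" using assms(2) by (simp add: ball_subset_ball_iff)
  define T where "T z = {s. s > 0 \<and> z / of_real s \<in> A}" for z
  define N where "N z = Inf (T z)" for z
  have bdd: "bdd_below (T z)" for z by (rule bdd_belowI[of _ 0]) (auto simp: T_def)
  have T_mem: "s \<in> T z" if "norm z / \<rho> < s" for s z
  proof -
    have "s > 0" using that assms(2) by (meson divide_nonneg_pos le_less_trans norm_ge_zero)
    then have "norm (z / of_real s) < \<rho>" using that assms(2) by (simp add: norm_divide divide_less_eq mult.commute)
    then show ?thesis using bA \<open>s > 0\<close> by (auto simp: T_def)
  qed
  have ne: "T z \<noteq> {}" for z using T_mem[of z "norm z / \<rho> + 1"] by auto
  have N0: "N z \<ge> 0" for z unfolding N_def by (rule cInf_greatest[OF ne]) (auto simp: T_def)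
  \<comment> \<open>The axioms are read off this equivalence. From left to right it uses the star
    shape about the centre; from right to left the openness of \<open>A\<close> provides a slightly
    smaller admissible s.\<close>
  have N_less_iff: "N z < t \<longleftrightarrow> z / of_real t \<in> A" if t: "t > 0" for z t
  proof
    assume "N z < t"
    then obtain s where s: "s > 0" "z / of_real s \<in> A" "s < t"
      unfolding N_def cInf_less_iff[OF ne bdd] by (auto simp: T_def)
    have "of_real (1 - s / t) * 0 + of_real (s / t) * (z / of_real s) \<in> A"
      using s t assms(2) by (intro star) auto
    moreover have "of_real (s / t) * (z / of_real s) = z / of_real t" using s t by simp
    ultimately show "z / of_real t \<in> A" by simp
  next
    assume zt: "z / of_real t \<in> A"
    have "(\<lambda>s. z / of_real s) \<midarrow>t\<rightarrow> z / of_real t" using t by (intro tendsto_intros) auto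
    then have "\<forall>\<^sub>F s in at t. z / of_real s \<in> A" using \<open>open A\<close> zt by (rule topological_tendstoD)
    then obtain d where d: "d > 0" "\<And>s. s \<noteq> t \<Longrightarrow> dist s t < d \<Longrightarrow> z / of_real s \<in> A"
      unfolding eventually_at by blast
    define s where "s = t - min (d / 2) (t / 2)"
    have s: "0 < s" "s < t" "dist s t < d" using t d(1) by (auto simp: s_def dist_real_def)
    then have "s \<in> T z" using d(2)[of s] by (auto simp: T_def)
    then have "N z \<le> s" unfolding N_def using bdd by (rule cInf_lower)
    then show "N z < t" using s by simp
  qed
  have N_eqI: "x = y" if "x \<ge> 0" "y \<ge> 0" "\<And>t. t > 0 \<Longrightarrow> x < t \<longleftrightarrow> y < t" for x y :: real
    using that(3)[of x] that(3)[of y] that(1,2) by (metis less_le linorder_neqE_linordered_idom order_less_irrefl)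
  have "star_domain N \<rho> R c \<Omega>"
  proof
    fix s :: real and z w :: complex
    show "N (of_real s * z) = s * N z" if "s \<ge> 0"
    proof (cases "s = 0")
      case True
      have "N 0 = 0" by (rule N_eqI) (use N0 N_less_iff \<open>0 \<in> A\<close> in auto)
      then show ?thesis using True by simp
    next
      case False
      with that have s: "s > 0" by simp
      show ?thesis
      proof (rule N_eqI)
        fix t :: real assume t: "t > 0"
        have "N (of_real s * z) < t \<longleftrightarrow> of_real s * z / of_real t \<in> A" by (rule N_less_iff[OF t])
        also have "of_real s * z / of_real t = z / of_real (t / s)" using s by (simp add: field_simps)
        also have "z / of_real (t / s) \<in> A \<longleftrightarrow> N z < t / s" using s t by (intro N_less_iff[symmetric]) simp
        also have "\<dots> \<longleftrightarrow> s * N z < t" using s by (simp add: field_simps)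
        finally show "N (of_real s * z) < t \<longleftrightarrow> s * N z < t" .
      qed (use N0 s in auto)
    qed
    show "N (z + w) \<le> N z + norm w / \<rho>"
    proof (rule field_le_epsilon)
      fix e :: real assume "e > 0"
      \<comment> \<open>(z + w)/(t + u) is the convex combination of w/u, in the disc of radius
        \<rho>, and z/t, in \<open>A\<close>, with weights u/(t + u) and t/(t + u). Here
        star-shapedness with respect to the whole disc is used.\<close>
      define t where "t = N z + e / 2"
      define u where "u = norm w / \<rho> + e / 2"
      have t: "t > 0" "N z < t" using N0[of z] \<open>e > 0\<close> by (auto simp: t_def)
      have u: "u > 0" "norm w / \<rho> < u" using assms(2) \<open>e > 0\<close> by (auto simp: u_def add_nonneg_pos)
      have "norm (w / of_real u) < \<rho>" using u assms(2) by (simp add: norm_divide divide_less_eq mult.commute)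
      moreover have "z / of_real t \<in> A" using N_less_iff[OF t(1)] t(2) by simp
      ultimately have "of_real (1 - t / (t + u)) * (w / of_real u) + of_real (t / (t + u)) * (z / of_real t) \<in> A"
        using t u by (intro star) auto
      moreover have "of_real (1 - t / (t + u)) * (w / of_real u) + of_real (t / (t + u)) * (z / of_real t) = (z + w) / of_real (t + u)"
      proof -
        have "1 - t / (t + u) = u / (t + u)" using t u by (simp add: field_simps)
        then have "of_real (1 - t / (t + u)) * (w / of_real u) = w / of_real (t + u)" using u by simp
        moreover have "of_real (t / (t + u)) * (z / of_real t) = z / of_real (t + u)" using t by simp
        ultimately show ?thesis by (simp add: add_divide_distrib)
      qed
      ultimately have "N (z + w) < t + u" using N_less_iff[of "t + u" "z + w"] t u by simp
      then show "N (z + w) \<le> N z + norm w / \<rho> + e" by (simp add: t_def u_def)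
    qed
    show "norm z / R \<le> N z"
    proof (rule dense_ge)
      fix t assume t: "N z < t"
      then have "t > 0" using N0[of z] by simp
      then have "norm (z / of_real t) < R" using N_less_iff t Ab by blast
      then show "norm z / R \<le> t"
        using \<open>t > 0\<close> assms(2) \<open>\<rho> \<le> R\<close> by (simp add: norm_divide field_simps)
    qed
    show "\<Omega> = {x. N (complex_of (x - c)) < 1}"
      using N_less_iff[of 1] by (auto simp: A_def)
  qed (use assms(2) \<open>\<rho> \<le> R\<close> in auto)
  then show ?thesis by blast
qed

text \<open>As \<Gamma> + 1 = 2/(1 - k) and \<rho>/R = sqrt ((1 + k)(1 - k)), both forms of the
  bound equal sqrt ((1 - k)/2). The second claim comes from k \<le> 1.\<close>

lemma inf_sup_bound_eq:
  fixes \<rho> R :: real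
  assumes "0 < \<rho>" "\<rho> \<le> R"
  defines "k \<equiv> sqrt (1 - \<rho>\<^sup>2 / R\<^sup>2)"
  shows "\<rho> / (sqrt 2 * R) * (1 + k) powr (- 1 / 2) = 1 / sqrt (friedrichs_bound \<rho> R + 1)"
    and "\<rho> / (sqrt 2 * R) * (1 + k) powr (- 1 / 2) \<ge> \<rho> / (2 * R)"
proof -
  have R: "R > 0" using assms by simp
  have q: "\<rho>\<^sup>2 / R\<^sup>2 \<le> 1" "\<rho>\<^sup>2 / R\<^sup>2 > 0" using assms R by (simp_all add: power_mono)
  have k: "0 \<le> k" "k < 1" "k\<^sup>2 = 1 - \<rho>\<^sup>2 / R\<^sup>2" using q by (auto simp: k_def)
  have pw: "(1 + k) powr (- 1 / 2) = 1 / sqrt (1 + k)"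
    using k by (simp add: powr_minus_divide powr_half_sqrt)
  have fb: "friedrichs_bound \<rho> R + 1 = 2 / (1 - k)"
    using k unfolding friedrichs_bound_def k_def[symmetric] by (simp add: field_simps)
  have "\<rho> / R = sqrt ((1 + k) * (1 - k))"
  proof (rule real_sqrt_unique[symmetric])
    show "(\<rho> / R)\<^sup>2 = (1 + k) * (1 - k)" using k(3) by (simp add: power_divide power2_eq_square algebra_simps)
  qed (use assms R in auto)
  then have "\<rho> / R = sqrt (1 + k) * sqrt (1 - k)" by (simp add: real_sqrt_mult)
  moreover have "\<rho> / (sqrt 2 * R) * (1 + k) powr (- 1 / 2) = (\<rho> / R) / (sqrt 2 * sqrt (1 + k))"
    unfolding pw by simp
  ultimately have "\<rho> / (sqrt 2 * R) * (1 + k) powr (- 1 / 2) = sqrt (1 - k) / sqrt 2"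
    using k by simp
  also have "\<dots> = 1 / sqrt (friedrichs_bound \<rho> R + 1)" by (simp add: fb real_sqrt_divide)
  finally show "\<rho> / (sqrt 2 * R) * (1 + k) powr (- 1 / 2) = 1 / sqrt (friedrichs_bound \<rho> R + 1)" .
  have "sqrt 2 * sqrt (1 + k) \<le> sqrt 2 * sqrt 2" using k by (intro mult_left_mono) auto
  moreover have "0 < sqrt 2 * sqrt (1 + k)" "0 \<le> \<rho> / R" using k(1) assms(1) R by simp_all
  ultimately have "\<rho> / R / 2 \<le> \<rho> / R / (sqrt 2 * sqrt (1 + k))"
    by (intro divide_left_mono) auto
  then show "\<rho> / (sqrt 2 * R) * (1 + k) powr (- 1 / 2) \<ge> \<rho> / (2 * R)"
    unfolding pw by (simp add: mult_ac)
qed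

theorem theorem2p3:
  fixes \<Omega> :: "(real^2) set" and c :: "real^2" and R \<rho> :: real
  assumes "open \<Omega>" and "connected \<Omega>" and "\<Omega> \<noteq> {}"
    and "\<rho> > 0"
    and "\<Omega> \<subseteq> ball c R"
    and "star_shaped_wrt_ball \<Omega> c \<rho>"
  shows "inf_sup_constant \<Omega>
           \<ge> ereal (\<rho> / (sqrt 2 * R) * (1 + sqrt (1 - \<rho>\<^sup>2 / R\<^sup>2)) powr (- 1 / 2))
       \<and> \<rho> / (sqrt 2 * R) * (1 + sqrt (1 - \<rho>\<^sup>2 / R\<^sup>2)) powr (- 1 / 2) \<ge> \<rho> / (2 * R)"
proof -
  obtain N where "star_domain N \<rho> R c \<Omega>" using star_domain_minkowski[OF assms(1,4,5,6)] by blast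
  then interpret star_domain N \<rho> R c \<Omega> .
  note bound = inf_sup_bound_eq[OF rho_pos rho_le_R]
  define \<Gamma> where "\<Gamma> = friedrichs_bound \<rho> R"
  have \<Gamma>: "\<Gamma> > 0" unfolding \<Gamma>_def by (rule friedrichs_bound_pos)
  have S: "\<Omega> \<in> sets borel" using assms(1) by auto
  have "ereal (1 / sqrt (\<Gamma> + 1)) \<le> (SUP v\<in>{v \<in> H1_0_vec \<Omega>. \<not> (AE x in lebesgue_on \<Omega>. v x = 0)}.
        ereal (L2_inner \<Omega> (weak_div \<Omega> v) p / (H1_seminorm_vec \<Omega> v * L2_norm \<Omega> p)))" (is "_ \<le> ?sup")
    if p: "p \<in> L2_mean_zero \<Omega>" "\<not> (AE x in lebesgue_on \<Omega>. p x = 0)" for p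
  proof -
    have pL: "p \<in> L2 \<Omega>" and pm: "p \<in> borel_measurable (lebesgue_on \<Omega>)" and p0: "(LINT x|lebesgue_on \<Omega>. p x) = 0"
      using p(1) by (auto simp: L2_mean_zero_def L2_def)
    obtain p' where p': "square_integrable lborel p'" "\<And>x. x \<notin> \<Omega> \<Longrightarrow> p' x = 0" "AE x in lebesgue_on \<Omega>. p x = p' x"
      using L2_representative[OF S pL] by blast
    have p'm: "p' \<in> borel_measurable borel" using p'(1) by (simp add: square_integrable_def)
    have mean: "(LINT x|lborel. p' x) = 0"
      using lebesgue_on_integral_transfer(1)[OF S pm p'm p'(2,3)] p0 by simp
    have norm_p: "L2_norm \<Omega> p = sqrt (sq_norm lborel p')"
    proof -
      have "L2_inner \<Omega> p p = (LINT x|lborel. p' x * p' x)"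
        using p'(2,3) by (intro L2_inner_transfer[OF S pm pm p'm p'm]) auto
      then show ?thesis by (simp add: L2_norm_def sq_norm_def power2_eq_square)
    qed
    have P: "sq_norm lborel p' > 0"
    proof (rule ccontr)
      assume "\<not> sq_norm lborel p' > 0"
      then have "sq_norm lborel p' = 0" using sq_norm_nonneg[of lborel p'] by linarith
      then have "AE x in lborel. (p' x)\<^sup>2 = 0"
        using p'(1) integral_nonneg_eq_0_iff_AE[of lborel "\<lambda>x. (p' x)\<^sup>2"] by (simp add: sq_norm_def square_integrable_def)
      then have "AE x in lborel. x \<in> \<Omega> \<longrightarrow> p' x = 0" by eventually_elim auto
      then have "AE x in lebesgue. x \<in> \<Omega> \<longrightarrow> p' x = 0" by (rule AE_completion)
      then have "AE x in lebesgue_on \<Omega>. p' x = 0" using S by (simp add: AE_restrict_space_iff)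
      then have "AE x in lebesgue_on \<Omega>. p x = 0" using p'(3) by eventually_elim simp
      then show False using p(2) by simp
    qed
    obtain v E where v: "\<And>n k. v n k \<in> bump_tests \<Omega>" and E: "sq_norm lborel p' \<le> (\<Gamma> + 1) * E"
      and num: "(\<lambda>n. LINT x|lborel. p' x * (\<Sum>j\<in>UNIV. partial_deriv j (v n j) x)) \<longlonglongrightarrow> E"
      and den: "(\<lambda>n. sq_norm lborel (gradient (v n))) \<longlonglongrightarrow> E"
      using stokes_projection[OF p'(1,2) mean] unfolding \<Gamma>_def by blast
    have "E > 0" using E P \<Gamma> by (metis add_pos_pos less_le_trans zero_less_mult_pos zero_less_one)
    define w where "w n x = (\<chi> k. v n k x)" for n x
    have wk: "(\<lambda>x. w n x $ k) = v n k" for n k by (simp add: w_def)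
    define ratio where "ratio n = (LINT x|lborel. p' x * (\<Sum>j\<in>UNIV. partial_deriv j (v n j) x))
        / (sqrt (sq_norm lborel (gradient (v n))) * sqrt (sq_norm lborel p'))" for n
    have ratio_eq: "L2_inner \<Omega> (weak_div \<Omega> (w n)) p / (H1_seminorm_vec \<Omega> (w n) * L2_norm \<Omega> p) = ratio n" for n
    proof -
      have "L2_inner \<Omega> (weak_div \<Omega> (w n)) p = (LINT x|lborel. (\<Sum>j\<in>UNIV. partial_deriv j (v n j) x) * p' x)"
      proof (rule L2_inner_transfer[OF S _ pm _ p'm])
        show "weak_div \<Omega> (w n) \<in> borel_measurable (lebesgue_on \<Omega>)"
          unfolding weak_div_def[abs_def] wk
          by (intro borel_measurable_sum bump_tests_weak_deriv(2)[OF assms(1) bounded_Omega v])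
        show "(\<lambda>x. \<Sum>j\<in>UNIV. partial_deriv j (v n j) x) \<in> borel_measurable borel"
          by (intro borel_measurable_sum continuous_compact_measurable C1_compact_imp_continuous_compact bump_tests_C1_compact[OF v])
        have "AE x in lebesgue_on \<Omega>. \<forall>j\<in>UNIV. weak_deriv \<Omega> j (v n j) x = partial_deriv j (v n j) x"
          by (intro AE_finite_allI bump_tests_weak_deriv(1)[OF assms(1) bounded_Omega v]) auto
        then show "AE x in lebesgue_on \<Omega>. weak_div \<Omega> (w n) x = (\<Sum>j\<in>UNIV. partial_deriv j (v n j) x)"
          by eventually_elim (simp add: weak_div_def wk)
      qed (use p' in auto)
      moreover have "H1_seminorm_vec \<Omega> (w n) = sqrt (sq_norm lborel (gradient (v n)))"
      proof -
        have "sq_norm lborel (gradient (v n)) = (\<Sum>k\<in>UNIV. \<Sum>j\<in>UNIV. sq_norm lborel (partial_deriv j (v n k)))"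
          unfolding sq_inner_self[symmetric]
          using sq_inner_matrix[OF square_integrable_gradient[OF v[of n]] square_integrable_gradient[OF v[of n]]]
          by (simp add: sq_inner_def)
        then show ?thesis
          unfolding H1_seminorm_vec_def wk bump_tests_L2_norm_weak_deriv[OF assms(1) bounded_Omega v] by simp
      qed
      ultimately show ?thesis by (simp add: ratio_def norm_p mult.commute)
    qed
    \<comment> \<open>The supremum runs over fields that are not almost everywhere 0. The components
      are continuous, so a field vanishing almost everywhere vanishes identically and has gradient
      0.\<close>
    have admissible: "w n \<in> {v \<in> H1_0_vec \<Omega>. \<not> (AE x in lebesgue_on \<Omega>. v x = 0)}"
      if pos: "sq_norm lborel (gradient (v n)) > 0" for n
    proof -
      have "w n \<in> H1_0_vec \<Omega>"
        unfolding H1_0_vec_def using bump_tests_H1_0[OF assms(1) bounded_Omega v] by (simp add: wk)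
      moreover have False if ae: "AE x in lebesgue_on \<Omega>. w n x = 0"
      proof -
        have "v n k x = 0" for k x
        proof -
          have "AE x in lebesgue. x \<in> \<Omega> \<longrightarrow> w n x = 0" using ae S by (simp add: AE_restrict_space_iff)
          then have "AE x in lebesgue. x \<in> {x. v n k x = 0}"
          proof eventually_elim
            case (elim x)
            then show ?case using bump_tests_eq_0(1)[OF v] by (cases "x \<in> \<Omega>") (auto simp: w_def vec_eq_iff)
          qed
          moreover have "closed {x. v n k x = 0}"
            using C1_compact_imp_continuous_compact(1)[OF bump_tests_C1_compact[OF v[of n k]]]
            by (intro closed_Collect_eq continuous_on_const) (simp add: continuous_compact_def)
          ultimately show ?thesis using mem_closed_if_AE_lebesgue[of "{x. v n k x = 0}" x] by simp
        qed
        then have "v n k = (\<lambda>x. 0)" for k by auto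
        then have "gradient (v n) x = 0" for x by (simp add: vec_eq_iff partial_deriv_zero)
        then show False using pos by (simp add: sq_norm_def)
      qed
      ultimately show ?thesis by blast
    qed
    \<comment> \<open>Fields with zero gradient may occur early in the sequence; E > 0 excludes them
      from some index on, and the limit of the later quotients still lies below the
      supremum.\<close>
    have "\<forall>\<^sub>F n in sequentially. sq_norm lborel (gradient (v n)) > 0"
      by (rule order_tendstoD(1)[OF den \<open>E > 0\<close>])
    then have ev: "\<forall>\<^sub>F n in sequentially. ereal (ratio n) \<le> ?sup"
    proof eventually_elim
      case (elim n)
      show ?case unfolding ratio_eq[symmetric] by (rule SUP_upper[OF admissible[OF elim]])
    qed
    have "ratio \<longlonglongrightarrow> E / (sqrt E * sqrt (sq_norm lborel p'))"
      unfolding ratio_def using \<open>E > 0\<close> P by (intro tendsto_intros num den) auto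
    also have "E / (sqrt E * sqrt (sq_norm lborel p')) = sqrt E / sqrt (sq_norm lborel p')"
      using \<open>E > 0\<close> by (metis divide_divide_eq_left less_imp_le real_div_sqrt)
    finally have lim: "(\<lambda>n. ereal (ratio n)) \<longlonglongrightarrow> ereal (sqrt E / sqrt (sq_norm lborel p'))" by simp
    have "sqrt (sq_norm lborel p') \<le> sqrt (\<Gamma> + 1) * sqrt E" using E by (simp add: real_sqrt_mult[symmetric])
    then have "1 / sqrt (\<Gamma> + 1) \<le> sqrt E / sqrt (sq_norm lborel p')"
      using P \<Gamma> by (simp add: divide_le_eq le_divide_eq mult.commute)
    then have "ereal (1 / sqrt (\<Gamma> + 1)) \<le> ereal (sqrt E / sqrt (sq_norm lborel p'))" by simp
    also have "\<dots> \<le> ?sup" by (rule tendsto_upperbound[OF lim ev]) simp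
    finally show ?thesis .
  qed
  then have "ereal (1 / sqrt (\<Gamma> + 1)) \<le> inf_sup_constant \<Omega>"
    unfolding inf_sup_constant_def by (intro INF_greatest) auto
  then show ?thesis using bound by (simp add: \<Gamma>_def)
qed

end
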